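(* Let $K$ be a field and $N\subset M$ an extension of $K$-algebras such that - $N\subset M$ is of depth 2, - $M_N$ is balanced, - the centralizer $R:=C_M(N)$ is a separable $K$-algebra. Then the left bialgebroid $A=\mathrm{End}({}_NM_N)$ over $R$ (with the structure described in the context), acting on $M$ in the natural way by $\alpha:A\otimes M\to M$, $\alpha(a\otimes m)=a(m)$, is the Galois bialgebroid $\mathrm{Gal}(M/N)$, i.e. $\langle A,\alpha\rangle$ is a terminal object of the category $\mathrm{Aut}(M/N)$. That is to say, any weak bialgebra $\langle A,\Delta_A,\varepsilon_A\rangle$ with underlying left bialgebroid $A$ has the following universal property: if $\alpha_W:W\otimes M\to M$ is a left module algebra action of a weak bialgebra $W$ over $K$ such that $M^W\supset N$, then there is a unique weak left morphism $f:W\to A$ of weak bialgebras such that $\alpha\circ(f\otimes\mathrm{id}_M)=\alpha_W$.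
   Context: All algebras are unital associative and algebra maps are unital. **Depth 2.** $N\subset M$ is of depth 2 if $M\otimes_NM$ is, as an $N$-$M$-bimodule, a direct summand of a finite direct sum of copies of ${}_NM_M$, and, as an $M$-$N$-bimodule, a direct summand of a finite direct sum of copies of ${}_MM_N$. **Balanced.** $M_N$ is balanced if, with $\mathcal E=\mathrm{End}(M_N)$, the endomorphisms of the left $\mathcal E$-module ${}_{\mathcal E}M$ are exactly the right multiplications by elements of $N$ (so $\mathrm{End}({}_{\mathcal E}M)\cong N$ canonically). $C_M(N)=\{m\in M: mn=nm\ \forall n\in N\}$. **Left bialgebroid** (over a commutative ring $k$; here $k=K$). $\langle B,S,s,t,\gamma,\pi\rangle$ with $k$-algebras $B,S$ such that: (1) $s:S\to B$, $t:S^{\rm op}\to B$ are $k$-algebra homomorphisms with commuting images; $B$ is an $S$-$S$-bimodule via $r\cdot b\cdot r'=s(r)t(r')b$; (2) $\gamma:B\to B\otimes_SB$, $b\mapsto b_{(1)}\otimes b_{(2)}$, and $\pi:B\to S$ are $S$-$S$-bimodule maps making $B$ a comonoid in ${}_S\mathcal M_S$; (3) $\gamma(b)(t(r)\otimes1)=\gamma(b)(1\otimes s(r))$, $\gamma(b)\gamma(c)=\gamma(bc)$, $\gamma(1)=1\otimes1$; (4) $\pi(bs(\pi(c)))=\pi(bc)=\pi(bt(\pi(c)))$, $\pi(1)=1_S$. It is finite if $B$ is finitely generated projective over $S$ both as a left and as a right module. **Maps of left bialgebroids** $\langle B,S_B,\dots\rangle\to\langle C,S_C,\dots\rangle$: algebra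 homomorphisms $\varphi:B\to C$ for which there is an algebra homomorphism $\omega:S_B\to S_C$ (unique, $\omega=\pi_C\circ\varphi\circ s_B$) with $\varphi s_B=s_C\omega$, $\varphi t_B=t_C\omega$, $\pi_C\varphi=\omega\pi_B$, and $\gamma_C\varphi=\tau^\omega(\varphi\otimes\varphi)\gamma_B$, where $\tau^\omega:C\otimes_{S_B}C\to C\otimes_{S_C}C$ is the canonical epimorphism ($C$ being an $S_B$-bimodule along $\omega$). **Module algebroid actions.** A left $B$-module algebroid action on a $k$-algebra $M$ is a left $B$-module structure $\alpha_B:B\otimes M\to M$, $b\otimes m\mapsto b\triangleright m$, making $M$ a monoid in the monoidal category of left $B$-modules: the multiplication of $M$ factors through $M\otimes_SM$, i.e. $(t(r)\triangleright m)m'=m(s(r)\triangleright m')$, and $b\triangleright(mm')=(b_{(1)}\triangleright m)(b_{(2)}\triangleright m')$, $b\triangleright1_M=s(\pi(b))\triangleright1_M$. The invariant subalgebra is $M^B=\{m: b\triangleright m=s(\pi(b))\triangleright m\ \forall b\in B\}$. **The category $\mathrm{Aut}(M/N)$.** Objects: pairs $\langle B,\alpha_B\rangle$ with $B$ a finite left bialgebroid in $k$-algebras and $\alpha_B:B\otimes M\to M$ a left $B$-module algebroid action with $N\subset M^B$. Arrows $\langle B,\alpha_B\rangle\to\langle C,\alpha_C\rangle$: maps $f:B\to C$ of left bialgebroids with $\alpha_C\circ(f\otimes\mathrm{id}_M)=\alpha_B$. The bialgebroid in a terminal object (unique up to isomorphism) is denoted $\mathrm{Gal}(M/N)$ and called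 the Galois quantum groupoid (Galois bialgebroid) of $M/N$. **The bialgebroid $A=\mathrm{End}({}_NM_N)$** of a depth 2 extension. Base $R=C_M(N)$; $s(r)(m)=rm$, $t(r)(m)=mr$; $\pi(a)=a(1_M)$. There is an isomorphism $A\otimes_RA\to\mathrm{Hom}_{N\text{-}N}(M\otimes_NM,M)$, $a\otimes a'\mapsto(m\otimes m'\mapsto a(m)a'(m'))$, and $\gamma(a)$ is the element corresponding to $m\otimes m'\mapsto a(mm')$. **Weak bialgebra (WBA) over $K$.** A finite dimensional $K$-space $W$ with a $K$-algebra structure and a coassociative counital $K$-coalgebra structure $\langle W,\Delta,\varepsilon\rangle$, $\Delta(w)=w_{(1)}\otimes w_{(2)}$, such that $\Delta(xy)=\Delta(x)\Delta(y)$; $\varepsilon(xy_{(1)})\varepsilon(y_{(2)}z)=\varepsilon(xyz)=\varepsilon(xy_{(2)})\varepsilon(y_{(1)}z)$; $(\Delta(1)\otimes 1)(1\otimes\Delta(1))=(\Delta\otimes\mathrm{id})\Delta(1)=(1\otimes\Delta(1))(\Delta(1)\otimes1)$. Put $\pi^L(w)=\varepsilon(1_{(1)}w)1_{(2)}$ and $W^L=\pi^L(W)$ (a subalgebra). Its underlying left bialgebroid is $\beta_l(W)=\langle W,W^L,s^L,t^L,\gamma^L,\pi^L\rangle$ with $s^L$ the inclusion, $t^L(l)=1_{(1)}\varepsilon(1_{(2)}l)$, and $\gamma^L$ the composite of $\Delta$ with the canonical map $W\otimes_KW\to W\otimes_{W^L}W$. A weak left morphism $W\to W'$ of WBAs is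 a map of left bialgebroids $\beta_l(W)\to\beta_l(W')$. A WBA $\langle A,\Delta_A,\varepsilon_A\rangle$ (on the algebra $A=\mathrm{End}({}_NM_N)$) has underlying left bialgebroid $A$ if $\beta_l(A)$ is the left bialgebroid $\langle A,R,s,t,\gamma,\pi\rangle$ with $A=\mathrm{End}({}_NM_N)$, $R=C_M(N)$, $s(r)(m)=rm$, $t(r)(m)=mr$, $\pi(a)=a(1_M)$, and $\gamma(a)\in A\otimes_RA$ the element corresponding to $m\otimes m'\mapsto a(mm')$ under the isomorphism $A\otimes_RA\cong\mathrm{Hom}_{N\text{-}N}(M\otimes_NM,M)$, $a\otimes a'\mapsto(m\otimes m'\mapsto a(m)a'(m'))$, with $A^L=s(R)$ identified with $R$ via $s$. **Module algebra actions of a WBA.** A left $W$-module structure on the algebra $M$ with $w\triangleright(mm')=(w_{(1)}\triangleright m)(w_{(2)}\triangleright m')$ and $w\triangleright1_M=\pi^L(w)\triangleright1_M$; $M^W=\{m: w\triangleright m=\pi^L(w)\triangleright m\ \forall w\in W\}$. *)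

theory Defs
  imports
    "HOL-Algebra.Module"
    "HOL-Algebra.Subrings"
    "HOL-Algebra.Generated_Groups"
    "HOL-Algebra.Free_Abelian_Groups"
begin

section \<open>Algebras over a commutative ring\<close>

text \<open>
  The locale \<open>algebra\<close> of HOL-Algebra is about commutative algebras, so unital associative
  algebras are introduced here, on the same \<open>module\<close> record.
\<close>

definition k_algebra :: "('k, 'q) ring_scheme \<Rightarrow> ('k, 'a, 'p) module_scheme \<Rightarrow> bool" where
  "k_algebra K A \<longleftrightarrow> module K A \<and> ring A \<and>
     (\<forall>c\<in>carrier K. \<forall>x\<in>carrier A. \<forall>y\<in>carrier A.
        (c \<odot>\<^bsub>A\<^esub> x) \<otimes>\<^bsub>A\<^esub> y = c \<odot>\<^bsub>A\<^esub> (x \<otimes>\<^bsub>A\<^esub> y) \<and>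
        x \<otimes>\<^bsub>A\<^esub> (c \<odot>\<^bsub>A\<^esub> y) = c \<odot>\<^bsub>A\<^esub> (x \<otimes>\<^bsub>A\<^esub> y))"

definition subalgebra_of :: "('k, 'q) ring_scheme \<Rightarrow> 'a set \<Rightarrow> ('k, 'a, 'p) module_scheme \<Rightarrow> bool" where
  "subalgebra_of K N M \<longleftrightarrow> subring N M \<and> (\<forall>c\<in>carrier K. \<forall>n\<in>N. c \<odot>\<^bsub>M\<^esub> n \<in> N)"

definition alg_hom ::
  "('k, 'q) ring_scheme \<Rightarrow> ('k, 'a, 'p) module_scheme \<Rightarrow> ('k, 'b, 'r) module_scheme \<Rightarrow> ('a \<Rightarrow> 'b) \<Rightarrow> bool" where
  "alg_hom K A B f \<longleftrightarrow> f \<in> ring_hom A B \<and>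
     (\<forall>c\<in>carrier K. \<forall>x\<in>carrier A. f (c \<odot>\<^bsub>A\<^esub> x) = c \<odot>\<^bsub>B\<^esub> f x)"

definition op_alg :: "('k, 'a, 'p) module_scheme \<Rightarrow> ('k, 'a, 'p) module_scheme" where
  "op_alg A = A\<lparr>mult := \<lambda>x y. y \<otimes>\<^bsub>A\<^esub> x\<rparr>"

definition finite_dim :: "('k, 'q) ring_scheme \<Rightarrow> ('k, 'a, 'p) module_scheme \<Rightarrow> bool" where
  "finite_dim K V \<longleftrightarrow> (\<exists>X. finite X \<and> X \<subseteq> carrier V \<and>
     (\<forall>v\<in>carrier V. \<exists>c\<in>X \<rightarrow> carrier K. v = (\<Oplus>\<^bsub>V\<^esub>x\<in>X. c x \<odot>\<^bsub>V\<^esub> x)))"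

definition centralizer_of :: "('k, 'a, 'p) module_scheme \<Rightarrow> 'a set \<Rightarrow> 'a set" where
  "centralizer_of M N = {m \<in> carrier M. \<forall>n\<in>N. m \<otimes>\<^bsub>M\<^esub> n = n \<otimes>\<^bsub>M\<^esub> m}"


section \<open>Bimodules\<close>

text \<open>
  As for \<open>module\<close> in HOL-Algebra, the record extends \<open>ring\<close> only in order to carry the
  additive group; the fields \<open>mult\<close> and \<open>one\<close> are irrelevant.  The acting rings are not part of
  the record: a predicate below takes the sets \<open>L\<close>, \<open>P\<close> of scalars that act from the left and from
  the right, and an empty set means that the action on that side is disregarded
  (one-sided modules).
\<close>

record ('l, 'r, 'x) bimod = "'x ring" +
  lact :: "'l \<Rightarrow> 'x \<Rightarrow> 'x"
  ract :: "'x \<Rightarrow> 'r \<Rightarrow> 'x"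

definition as_bimod ::
  "('x, 'q) ring_scheme \<Rightarrow> ('l \<Rightarrow> 'x \<Rightarrow> 'x) \<Rightarrow> ('x \<Rightarrow> 'r \<Rightarrow> 'x) \<Rightarrow> ('l, 'r, 'x) bimod" where
  "as_bimod A l r = \<lparr>carrier = carrier A, mult = mult A, one = \<one>\<^bsub>A\<^esub>,
     ring.zero = \<zero>\<^bsub>A\<^esub>, add = add A, lact = l, ract = r\<rparr>"

definition reg_bimod :: "('a, 'q) ring_scheme \<Rightarrow> ('a, 'a, 'a) bimod" where
  "reg_bimod A = as_bimod A (mult A) (mult A)"

text \<open>A module over a commutative ring as a symmetric bimodule.\<close>

definition sym_bimod :: "('k, 'a, 'p) module_scheme \<Rightarrow> ('k, 'k, 'a) bimod" where
  "sym_bimod V = as_bimod V (smult V) (\<lambda>x c. c \<odot>\<^bsub>V\<^esub> x)"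

definition bimod_hom ::
  "'l set \<Rightarrow> 'r set \<Rightarrow> ('l, 'r, 'x) bimod \<Rightarrow> ('l, 'r, 'y) bimod \<Rightarrow> ('x \<Rightarrow> 'y) \<Rightarrow> bool" where
  "bimod_hom L P X Y f \<longleftrightarrow> f \<in> carrier X \<rightarrow> carrier Y \<and>
     (\<forall>x\<in>carrier X. \<forall>x'\<in>carrier X. f (x \<oplus>\<^bsub>X\<^esub> x') = f x \<oplus>\<^bsub>Y\<^esub> f x') \<and>
     (\<forall>l\<in>L. \<forall>x\<in>carrier X. f (lact X l x) = lact Y l (f x)) \<and>
     (\<forall>r\<in>P. \<forall>x\<in>carrier X. f (ract X x r) = ract Y (f x) r)"

text \<open>Direct sum of \<open>n\<close> copies.\<close>

definition pow_bimod :: "nat \<Rightarrow> ('l, 'r, 'x) bimod \<Rightarrow> ('l, 'r, nat \<Rightarrow> 'x) bimod" where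
  "pow_bimod n X = \<lparr>carrier = {..<n} \<rightarrow>\<^sub>E carrier X, mult = undefined, one = undefined,
     ring.zero = (\<lambda>i\<in>{..<n}. \<zero>\<^bsub>X\<^esub>), add = (\<lambda>v w. \<lambda>i\<in>{..<n}. v i \<oplus>\<^bsub>X\<^esub> w i),
     lact = (\<lambda>l v. \<lambda>i\<in>{..<n}. lact X l (v i)), ract = (\<lambda>v r. \<lambda>i\<in>{..<n}. ract X (v i) r)\<rparr>"

definition sub_bimod :: "'l set \<Rightarrow> 'r set \<Rightarrow> 'x set \<Rightarrow> ('l, 'r, 'x) bimod \<Rightarrow> bool" where
  "sub_bimod L P U X \<longleftrightarrow> subgroup U (add_monoid X) \<and>
     (\<forall>l\<in>L. \<forall>u\<in>U. lact X l u \<in> U) \<and> (\<forall>r\<in>P. \<forall>u\<in>U. ract X u r \<in> U)"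

text \<open>\<open>X\<close> is isomorphic to a sub-bimodule \<open>U\<close> of \<open>Y\<close> that has a complement \<open>V\<close>.\<close>

definition direct_summand ::
  "'l set \<Rightarrow> 'r set \<Rightarrow> ('l, 'r, 'x) bimod \<Rightarrow> ('l, 'r, 'y) bimod \<Rightarrow> bool" where
  "direct_summand L P X Y \<longleftrightarrow> (\<exists>U V \<phi>.
     sub_bimod L P U Y \<and> sub_bimod L P V Y \<and>
     U \<inter> V = {\<zero>\<^bsub>Y\<^esub>} \<and> U <+>\<^bsub>Y\<^esub> V = carrier Y \<and>
     bimod_hom L P X Y \<phi> \<and> bij_betw \<phi> (carrier X) U)"

definition hom_group ::
  "'l set \<Rightarrow> 'r set \<Rightarrow> ('l, 'r, 'x) bimod \<Rightarrow> ('l, 'r, 'y) bimod \<Rightarrow> ('x \<Rightarrow> 'y) ring" where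
  "hom_group L P X Y = \<lparr>carrier = {f \<in> extensional (carrier X). bimod_hom L P X Y f},
     mult = undefined, one = undefined,
     ring.zero = (\<lambda>x\<in>carrier X. \<zero>\<^bsub>Y\<^esub>), add = (\<lambda>f g. \<lambda>x\<in>carrier X. f x \<oplus>\<^bsub>Y\<^esub> g x)\<rparr>"

text \<open>Finitely generated projective left and right \<open>S\<close>-modules: direct summands of some \<open>S\<^sup>n\<close>.\<close>

definition fg_projective_left :: "('s, 'q) ring_scheme \<Rightarrow> ('s, 's, 'x) bimod \<Rightarrow> bool" where
  "fg_projective_left S X \<longleftrightarrow>
     (\<exists>n. direct_summand (carrier S) {} X (pow_bimod n (reg_bimod S)))"

definition fg_projective_right :: "('s, 'q) ring_scheme \<Rightarrow> ('s, 's, 'x) bimod \<Rightarrow> bool" where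
  "fg_projective_right S X \<longleftrightarrow>
     (\<exists>n. direct_summand {} (carrier S) X (pow_bimod n (reg_bimod S)))"


section \<open>Tensor products\<close>

text \<open>
  \<open>tensor S X Y\<close> is \<open>X \<otimes>\<^sub>S Y\<close> for a right \<open>S\<close>-module \<open>X\<close> and a left \<open>S\<close>-module \<open>Y\<close>: the free abelian
  group on the set of pairs modulo the biadditivity and balancing relations.
\<close>

definition tensor_rels ::
  "('s, 'q) ring_scheme \<Rightarrow> ('l, 's, 'x) bimod \<Rightarrow> ('s, 'r, 'y) bimod \<Rightarrow> ('x \<times> 'y \<Rightarrow>\<^sub>0 int) set" where
  "tensor_rels S X Y =
     {frag_of (x \<oplus>\<^bsub>X\<^esub> x', y) - frag_of (x, y) - frag_of (x', y) | x x' y.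
        x \<in> carrier X \<and> x' \<in> carrier X \<and> y \<in> carrier Y} \<union>
     {frag_of (x, y \<oplus>\<^bsub>Y\<^esub> y') - frag_of (x, y) - frag_of (x, y') | x y y'.
        x \<in> carrier X \<and> y \<in> carrier Y \<and> y' \<in> carrier Y} \<union>
     {frag_of (ract X x s, y) - frag_of (x, lact Y s y) | x s y.
        x \<in> carrier X \<and> s \<in> carrier S \<and> y \<in> carrier Y}"

abbreviation pair_group ::
  "('l, 's, 'x) bimod \<Rightarrow> ('s, 'r, 'y) bimod \<Rightarrow> ('x \<times> 'y \<Rightarrow>\<^sub>0 int) monoid" where
  "pair_group X Y \<equiv> free_Abelian_group (carrier X \<times> carrier Y)"

definition tensor_null ::
  "('s, 'q) ring_scheme \<Rightarrow> ('l, 's, 'x) bimod \<Rightarrow> ('s, 'r, 'y) bimod \<Rightarrow> ('x \<times> 'y \<Rightarrow>\<^sub>0 int) set" where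
  "tensor_null S X Y = generate (pair_group X Y) (tensor_rels S X Y)"

definition tensor_group ::
  "('s, 'q) ring_scheme \<Rightarrow> ('l, 's, 'x) bimod \<Rightarrow> ('s, 'r, 'y) bimod \<Rightarrow> ('x \<times> 'y \<Rightarrow>\<^sub>0 int) set ring" where
  "tensor_group S X Y = (let Q = pair_group X Y Mod tensor_null S X Y in
     \<lparr>carrier = carrier Q, mult = undefined, one = undefined,
      ring.zero = \<one>\<^bsub>Q\<^esub>, add = mult Q\<rparr>)"

definition tens ::
  "('s, 'q) ring_scheme \<Rightarrow> ('l, 's, 'x) bimod \<Rightarrow> ('s, 'r, 'y) bimod \<Rightarrow> 'x \<Rightarrow> 'y \<Rightarrow> ('x \<times> 'y \<Rightarrow>\<^sub>0 int) set" where
  "tens S X Y x y = tensor_null S X Y #>\<^bsub>pair_group X Y\<^esub> frag_of (x, y)"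

definition tensor_eval ::
  "('z, 'q) ring_scheme \<Rightarrow> ('x \<Rightarrow> 'y \<Rightarrow> 'z) \<Rightarrow> ('x \<times> 'y \<Rightarrow>\<^sub>0 int) \<Rightarrow> 'z" where
  "tensor_eval Z f c =
     (\<Oplus>\<^bsub>Z\<^esub>p\<in>Poly_Mapping.keys c. [Poly_Mapping.lookup c p] \<cdot>\<^bsub>Z\<^esub> f (fst p) (snd p))"

text \<open>
  The homomorphism \<open>x \<otimes> y \<mapsto> f x y\<close> into \<open>Z\<close> induced by a balanced map \<open>f\<close>.  For a balanced \<open>f\<close> all
  representatives \<open>c\<close> of the coset \<open>T\<close> give the same \<open>z\<close>, see \<open>tensor_lift_universal\<close>; for other \<open>f\<close>
  the value is meaningless.  This also is the meaning of Sweedler notation: \<open>f b\<^sub>1 b\<^sub>2\<close> is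
  \<open>tensor_lift Z f (\<gamma> b)\<close>.
\<close>

definition tensor_lift ::
  "('z, 'q) ring_scheme \<Rightarrow> ('x \<Rightarrow> 'y \<Rightarrow> 'z) \<Rightarrow> ('x \<times> 'y \<Rightarrow>\<^sub>0 int) set \<Rightarrow> 'z" where
  "tensor_lift Z f T = (THE z. \<exists>c\<in>T. z = tensor_eval Z f c)"

definition tensor ::
  "('s, 'q) ring_scheme \<Rightarrow> ('l, 's, 'x) bimod \<Rightarrow> ('s, 'r, 'y) bimod
    \<Rightarrow> ('l, 'r, ('x \<times> 'y \<Rightarrow>\<^sub>0 int) set) bimod" where
  "tensor S X Y = as_bimod (tensor_group S X Y)
     (\<lambda>l. tensor_lift (tensor_group S X Y) (\<lambda>x y. tens S X Y (lact X l x) y))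
     (\<lambda>c r. tensor_lift (tensor_group S X Y) (\<lambda>x y. tens S X Y x (ract Y y r)) c)"

lemma add_pow_int_closed:
  assumes "abelian_group Z" "z \<in> carrier Z"
  shows "[(k::int)] \<cdot>\<^bsub>Z\<^esub> z \<in> carrier Z"
proof -
  interpret Z: abelian_group Z by fact
  show ?thesis using Z.add.int_pow_closed[OF assms(2), of k] by (simp add: add_pow_def)
qed

lemma add_pow_int_add:
  assumes "abelian_group Z" "z \<in> carrier Z"
  shows "[(k + l::int)] \<cdot>\<^bsub>Z\<^esub> z = [k] \<cdot>\<^bsub>Z\<^esub> z \<oplus>\<^bsub>Z\<^esub> [l] \<cdot>\<^bsub>Z\<^esub> z"
proof -
  interpret Z: abelian_group Z by fact
  show ?thesis using Z.add.int_pow_mult[OF assms(2), of k l] by (simp add: add_pow_def)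
qed

lemma tensor_eval_superset:
  assumes Z: "abelian_group Z" and F: "finite F" "Poly_Mapping.keys c \<subseteq> F"
    and f: "\<And>p. p \<in> F \<Longrightarrow> f (fst p) (snd p) \<in> carrier Z"
  shows "tensor_eval Z f c = (\<Oplus>\<^bsub>Z\<^esub>p\<in>F. [Poly_Mapping.lookup c p] \<cdot>\<^bsub>Z\<^esub> f (fst p) (snd p))"
proof -
  interpret Z: abelian_group Z by fact
  show ?thesis unfolding tensor_eval_def
  proof (rule Z.add.finprod_mono_neutral_cong_left[OF F])
    fix p assume "p \<in> F - Poly_Mapping.keys c"
    then show "[Poly_Mapping.lookup c p] \<cdot>\<^bsub>Z\<^esub> f (fst p) (snd p) = \<zero>\<^bsub>Z\<^esub>"
      by (simp add: in_keys_iff add_pow_def)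
  qed (use f Z in \<open>auto intro: add_pow_int_closed\<close>)
qed

lemma tensor_eval_closed:
  assumes Z: "abelian_group Z"
    and f: "\<And>p. p \<in> Poly_Mapping.keys c \<Longrightarrow> f (fst p) (snd p) \<in> carrier Z"
  shows "tensor_eval Z f c \<in> carrier Z"
proof -
  interpret Z: abelian_group Z by fact
  show ?thesis unfolding tensor_eval_def
    by (rule Z.finsum_closed) (use f Z in \<open>auto intro: add_pow_int_closed\<close>)
qed

lemma tensor_eval_add:
  assumes Z: "abelian_group Z"
    and f: "\<And>p. p \<in> Poly_Mapping.keys c \<union> Poly_Mapping.keys d \<Longrightarrow> f (fst p) (snd p) \<in> carrier Z"
  shows "tensor_eval Z f (c + d) = tensor_eval Z f c \<oplus>\<^bsub>Z\<^esub> tensor_eval Z f d"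
proof -
  interpret Z: abelian_group Z by fact
  let ?F = "Poly_Mapping.keys c \<union> Poly_Mapping.keys d"
  have 1: "Poly_Mapping.keys (c + d) \<subseteq> ?F" by (rule keys_add)
  have e: "tensor_eval Z f (c + d) =
     (\<Oplus>\<^bsub>Z\<^esub>p\<in>?F. [Poly_Mapping.lookup (c + d) p] \<cdot>\<^bsub>Z\<^esub> f (fst p) (snd p))"
    by (rule tensor_eval_superset[OF Z _ 1]) (use f in auto)
  have "tensor_eval Z f (c + d) =
     (\<Oplus>\<^bsub>Z\<^esub>p\<in>?F. [Poly_Mapping.lookup c p] \<cdot>\<^bsub>Z\<^esub> f (fst p) (snd p) \<oplus>\<^bsub>Z\<^esub>
        [Poly_Mapping.lookup d p] \<cdot>\<^bsub>Z\<^esub> f (fst p) (snd p))"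
    unfolding e
    by (rule Z.add.finprod_cong') (use f Z in \<open>auto simp: lookup_add add_pow_int_add intro!: add_pow_int_closed Z.a_closed\<close>)
  also have "\<dots> = (\<Oplus>\<^bsub>Z\<^esub>p\<in>?F. [Poly_Mapping.lookup c p] \<cdot>\<^bsub>Z\<^esub> f (fst p) (snd p)) \<oplus>\<^bsub>Z\<^esub>
      (\<Oplus>\<^bsub>Z\<^esub>p\<in>?F. [Poly_Mapping.lookup d p] \<cdot>\<^bsub>Z\<^esub> f (fst p) (snd p))"
    by (rule Z.finsum_addf) (use f Z in \<open>auto intro!: add_pow_int_closed\<close>)
  also have "\<dots> = tensor_eval Z f c \<oplus>\<^bsub>Z\<^esub> tensor_eval Z f d"
    using tensor_eval_superset[OF Z, of ?F c f] tensor_eval_superset[OF Z, of ?F d f] f by simp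
  finally show ?thesis .
qed

lemma tensor_eval_frag_of:
  assumes Z: "abelian_group Z" and f: "f x y \<in> carrier Z"
  shows "tensor_eval Z f (frag_of (x, y)) = f x y"
proof -
  interpret Z: abelian_group Z by fact
  have "[(1::int)] \<cdot>\<^bsub>Z\<^esub> f x y = f x y" using f by (simp add: add_pow_def int_pow_def2)
  then show ?thesis unfolding tensor_eval_def using f
    by (simp add: keys_frag_of Z.finsum_insert)
qed

lemma tensor_null_normal:
  assumes X: "abelian_group X" and Y: "abelian_group Y"
    and XS: "\<And>x s. \<lbrakk>x \<in> carrier X; s \<in> carrier S\<rbrakk> \<Longrightarrow> ract X x s \<in> carrier X"
    and SY: "\<And>s y. \<lbrakk>s \<in> carrier S; y \<in> carrier Y\<rbrakk> \<Longrightarrow> lact Y s y \<in> carrier Y"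
  shows "tensor_null S X Y \<lhd> pair_group X Y" "tensor_rels S X Y \<subseteq> carrier (pair_group X Y)"
proof -
  interpret X: abelian_group X by fact
  interpret Y: abelian_group Y by fact
  interpret G: comm_group "pair_group X Y" by (rule abelian_free_Abelian_group)
  have frag_diff: "c - d \<in> carrier (pair_group X Y)"
    if "c \<in> carrier (pair_group X Y)" "d \<in> carrier (pair_group X Y)" for c d
    using keys_diff[of c d] that by auto
  show rels: "tensor_rels S X Y \<subseteq> carrier (pair_group X Y)"
    unfolding tensor_rels_def
    by (intro Un_least subsetI; elim CollectE exE conjE; hypsubst; intro frag_diff)
      (use XS SY in simp_all)
  have "subgroup (tensor_null S X Y) (pair_group X Y)"
    unfolding tensor_null_def by (rule G.generate_is_subgroup[OF rels])
  then show "tensor_null S X Y \<lhd> pair_group X Y"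
    by (rule G.subgroup_imp_normal)
qed

lemma tensor_lift_universal:
  assumes X: "abelian_group X" and Y: "abelian_group Y" and Z: "abelian_group Z"
    and XS: "\<And>x s. \<lbrakk>x \<in> carrier X; s \<in> carrier S\<rbrakk> \<Longrightarrow> ract X x s \<in> carrier X"
    and SY: "\<And>s y. \<lbrakk>s \<in> carrier S; y \<in> carrier Y\<rbrakk> \<Longrightarrow> lact Y s y \<in> carrier Y"
    and f: "\<And>x y. \<lbrakk>x \<in> carrier X; y \<in> carrier Y\<rbrakk> \<Longrightarrow> f x y \<in> carrier Z"
    and f_add1: "\<And>x x' y. \<lbrakk>x \<in> carrier X; x' \<in> carrier X; y \<in> carrier Y\<rbrakk> \<Longrightarrow>
      f (x \<oplus>\<^bsub>X\<^esub> x') y = f x y \<oplus>\<^bsub>Z\<^esub> f x' y"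
    and f_add2: "\<And>x y y'. \<lbrakk>x \<in> carrier X; y \<in> carrier Y; y' \<in> carrier Y\<rbrakk> \<Longrightarrow>
      f x (y \<oplus>\<^bsub>Y\<^esub> y') = f x y \<oplus>\<^bsub>Z\<^esub> f x y'"
    and f_bal: "\<And>x s y. \<lbrakk>x \<in> carrier X; s \<in> carrier S; y \<in> carrier Y\<rbrakk> \<Longrightarrow>
      f (ract X x s) y = f x (lact Y s y)"
  shows "tensor_lift Z f \<in> hom (add_monoid (tensor S X Y)) (add_monoid Z)"
    and "\<And>x y. \<lbrakk>x \<in> carrier X; y \<in> carrier Y\<rbrakk> \<Longrightarrow> tensor_lift Z f (tens S X Y x y) = f x y"
proof -
  interpret X: abelian_group X by fact
  interpret Y: abelian_group Y by fact
  interpret Z: abelian_group Z by fact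
  let ?G = "pair_group X Y" and ?H = "tensor_null S X Y" and ?e = "tensor_eval Z f"
  interpret G: comm_group ?G by (rule abelian_free_Abelian_group)
  interpret H: normal ?H ?G by (rule tensor_null_normal(1)[OF X Y XS SY])
  have e_hom: "?e \<in> hom ?G (add_monoid Z)"
  proof (rule homI)
    fix c d assume cd: "c \<in> carrier ?G" "d \<in> carrier ?G"
    have "?e (c + d) = ?e c \<oplus>\<^bsub>Z\<^esub> ?e d"
      by (rule tensor_eval_add[OF Z]) (use cd f in \<open>force simp: subset_iff\<close>)
    then show "?e (c \<otimes>\<^bsub>?G\<^esub> d) = ?e c \<otimes>\<^bsub>add_monoid Z\<^esub> ?e d" by simp
  next
    fix c assume c: "c \<in> carrier ?G"
    have "?e c \<in> carrier Z"
      by (rule tensor_eval_closed[OF Z]) (use c f in \<open>force simp: subset_iff\<close>)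
    then show "?e c \<in> carrier (add_monoid Z)" by simp
  qed
  interpret e: group_hom ?G "add_monoid Z" ?e
    by (intro group_hom.intro group_hom_axioms.intro e_hom G.is_group Z.a_group)
  have e_frag: "?e (frag_of (x, y)) = f x y" if "x \<in> carrier X" "y \<in> carrier Y" for x y
    using tensor_eval_frag_of[OF Z, of f x y] f[OF that] by blast
  have e_diff: "?e (c - d) = ?e c \<ominus>\<^bsub>Z\<^esub> ?e d" if "c \<in> carrier ?G" "d \<in> carrier ?G" for c d
  proof -
    have "?e (c \<otimes>\<^bsub>?G\<^esub> inv\<^bsub>?G\<^esub> d) = ?e c \<ominus>\<^bsub>Z\<^esub> ?e d"
      unfolding e.hom_mult[OF that(1) G.inv_closed[OF that(2)]] e.hom_inv[OF that(2)]
      by (simp add: a_minus_def a_inv_def)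
    then show ?thesis using that by simp
  qed
  have frag: "frag_of (x, y) \<in> carrier ?G" if "x \<in> carrier X" "y \<in> carrier Y" for x y
    using that by simp
  have frag_diff: "c - d \<in> carrier ?G" if "c \<in> carrier ?G" "d \<in> carrier ?G" for c d
    using keys_diff[of c d] that by auto
  have cancel: "u \<oplus>\<^bsub>Z\<^esub> v \<ominus>\<^bsub>Z\<^esub> u \<ominus>\<^bsub>Z\<^esub> v = \<zero>\<^bsub>Z\<^esub>" if "u \<in> carrier Z" "v \<in> carrier Z" for u v
  proof -
    have "u \<oplus>\<^bsub>Z\<^esub> v \<ominus>\<^bsub>Z\<^esub> u = v"
      using that Z.r_neg1[of u v] Z.a_comm[of "u \<oplus>\<^bsub>Z\<^esub> v" "\<ominus>\<^bsub>Z\<^esub> u"] by (simp add: a_minus_def)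
    then show ?thesis using that by (simp add: a_minus_def Z.r_neg)
  qed
  have rels: "?e c = \<zero>\<^bsub>Z\<^esub>" if "c \<in> tensor_rels S X Y" for c
    using that unfolding tensor_rels_def
  proof (elim UnE CollectE exE conjE)
    fix x x' y assume a: "c = frag_of (x \<oplus>\<^bsub>X\<^esub> x', y) - frag_of (x, y) - frag_of (x', y)"
      "x \<in> carrier X" "x' \<in> carrier X" "y \<in> carrier Y"
    show ?thesis unfolding a(1)
      using a(2-) by (simp add: e_diff frag frag_diff e_frag f f_add1 cancel del: carrier_free_Abelian_group_iff)
  next
    fix x y y' assume a: "c = frag_of (x, y \<oplus>\<^bsub>Y\<^esub> y') - frag_of (x, y) - frag_of (x, y')"
      "x \<in> carrier X" "y \<in> carrier Y" "y' \<in> carrier Y"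
    show ?thesis unfolding a(1)
      using a(2-) by (simp add: e_diff frag frag_diff e_frag f f_add2 cancel del: carrier_free_Abelian_group_iff)
  next
    fix x s y assume a: "c = frag_of (ract X x s, y) - frag_of (x, lact Y s y)"
      "x \<in> carrier X" "s \<in> carrier S" "y \<in> carrier Y"
    show ?thesis unfolding a(1)
      using a(2-) by (simp add: e_diff frag e_frag f XS SY f_bal a_minus_def Z.r_neg del: carrier_free_Abelian_group_iff)
  qed
  have rels_carr: "tensor_rels S X Y \<subseteq> carrier ?G"
    by (rule tensor_null_normal(2)[OF X Y XS SY])
  have ker: "?H \<subseteq> kernel ?G (add_monoid Z) ?e"
    unfolding tensor_null_def
    by (rule G.generate_subgroup_incl[OF _ e.subgroup_kernel])
      (use rels subsetD[OF rels_carr] in \<open>auto simp: kernel_def simp del: carrier_free_Abelian_group_iff\<close>)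
  have null: "?e h = \<zero>\<^bsub>Z\<^esub>" if "h \<in> ?H" for h
    using subsetD[OF ker that] by (simp add: kernel_def)
  have lift: "tensor_lift Z f (?H #>\<^bsub>?G\<^esub> c) = ?e c" if c: "c \<in> carrier ?G" for c
  proof -
    have eq: "?e d = ?e c" if "d \<in> ?H #>\<^bsub>?G\<^esub> c" for d
    proof -
      from that have "\<exists>h\<in>?H. d = h \<otimes>\<^bsub>?G\<^esub> c" by (simp add: r_coset_def)
      then obtain h where h: "h \<in> ?H" "d = h \<otimes>\<^bsub>?G\<^esub> c" ..
      show ?thesis unfolding h(2) e.hom_mult[OF H.mem_carrier[OF h(1)] c] null[OF h(1)]
        using e.hom_closed[OF c] by simp
    qed
    have mem: "c \<in> ?H #>\<^bsub>?G\<^esub> c" by (rule G.rcos_self[OF c H.is_subgroup])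
    show ?thesis unfolding tensor_lift_def
    proof (rule the_equality)
      show "\<exists>d\<in>?H #>\<^bsub>?G\<^esub> c. ?e c = ?e d" using mem by (rule bexI[rotated]) (rule refl)
      show "z = ?e c" if "\<exists>d\<in>?H #>\<^bsub>?G\<^esub> c. z = ?e d" for z
        using that by (elim bexE) (simp only: eq)
    qed
  qed
  have carr: "carrier (tensor S X Y) = rcosets\<^bsub>?G\<^esub> ?H"
    by (simp add: tensor_def as_bimod_def tensor_group_def FactGroup_def Let_def)
  have coset: "\<exists>c\<in>carrier ?G. T = ?H #>\<^bsub>?G\<^esub> c" if "T \<in> carrier (add_monoid (tensor S X Y))" for T
    using that unfolding RCOSETS_def by (simp add: carr RCOSETS_def del: carrier_free_Abelian_group_iff)
  have add: "add (tensor S X Y) = set_mult ?G"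
    by (simp add: tensor_def as_bimod_def tensor_group_def FactGroup_def Let_def)
  show "tensor_lift Z f \<in> hom (add_monoid (tensor S X Y)) (add_monoid Z)"
  proof (rule homI)
    fix T assume "T \<in> carrier (add_monoid (tensor S X Y))"
    then obtain c where "c \<in> carrier ?G" "T = ?H #>\<^bsub>?G\<^esub> c" using coset by blast
    then show "tensor_lift Z f T \<in> carrier (add_monoid Z)" by (metis lift e.hom_closed)
  next
    fix T U assume "T \<in> carrier (add_monoid (tensor S X Y))" "U \<in> carrier (add_monoid (tensor S X Y))"
    then obtain c d where c: "c \<in> carrier ?G" "T = ?H #>\<^bsub>?G\<^esub> c"
      and d: "d \<in> carrier ?G" "U = ?H #>\<^bsub>?G\<^esub> d" using coset by blast
    have "T \<otimes>\<^bsub>add_monoid (tensor S X Y)\<^esub> U = ?H #>\<^bsub>?G\<^esub> (c \<otimes>\<^bsub>?G\<^esub> d)"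
      unfolding c(2) d(2) H.rcos_sum[OF c(1) d(1), symmetric] by (simp add: add)
    then show "tensor_lift Z f (T \<otimes>\<^bsub>add_monoid (tensor S X Y)\<^esub> U) =
        tensor_lift Z f T \<otimes>\<^bsub>add_monoid Z\<^esub> tensor_lift Z f U"
      by (metis c d lift G.m_closed e.hom_mult)
  qed
  show "tensor_lift Z f (tens S X Y x y) = f x y" if "x \<in> carrier X" "y \<in> carrier Y" for x y
    unfolding tens_def lift[OF frag[OF that]] by (rule e_frag[OF that])
qed

text \<open>\<open>f \<otimes> g\<close> with values in \<open>X \<otimes>\<^sub>S Y\<close>.\<close>

definition tensor_map ::
  "('s, 'q) ring_scheme \<Rightarrow> ('l, 's, 'x) bimod \<Rightarrow> ('s, 'r, 'y) bimod \<Rightarrow> ('u \<Rightarrow> 'x) \<Rightarrow> ('v \<Rightarrow> 'y)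
    \<Rightarrow> ('u \<times> 'v \<Rightarrow>\<^sub>0 int) set \<Rightarrow> ('x \<times> 'y \<Rightarrow>\<^sub>0 int) set" where
  "tensor_map S X Y f g = tensor_lift (tensor S X Y) (\<lambda>u v. tens S X Y (f u) (g v))"

text \<open>The associator \<open>(X \<otimes>\<^sub>S Y) \<otimes>\<^sub>S Z \<rightarrow> X \<otimes>\<^sub>S (Y \<otimes>\<^sub>S Z)\<close>.\<close>

definition tensor_assoc ::
  "('s, 'q) ring_scheme \<Rightarrow> ('l, 's, 'x) bimod \<Rightarrow> ('s, 's, 'y) bimod \<Rightarrow> ('s, 'r, 'z) bimod
    \<Rightarrow> (('x \<times> 'y \<Rightarrow>\<^sub>0 int) set \<times> 'z \<Rightarrow>\<^sub>0 int) set \<Rightarrow> ('x \<times> ('y \<times> 'z \<Rightarrow>\<^sub>0 int) set \<Rightarrow>\<^sub>0 int) set" where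
  "tensor_assoc S X Y Z = (let T = tensor S X (tensor S Y Z) in
     tensor_lift T (\<lambda>c z. tensor_lift T (\<lambda>x y. tens S X (tensor S Y Z) x (tens S Y Z y z)) c))"

text \<open>
  Products in \<open>X \<otimes>\<^sub>S Y\<close> for multiplications \<open>f\<close> on \<open>X\<close> and \<open>g\<close> on \<open>Y\<close>: \<open>tensor_rmult\<close> is
  \<open>c \<cdot> (u \<otimes> v)\<close> as a function of the pair \<open>u, v\<close>, and \<open>tensor_mult\<close> is \<open>c \<cdot> d\<close>.  Over a
  noncommutative \<open>S\<close> the former does not depend on \<open>u \<otimes> v\<close> alone, and the latter makes sense only for
  those \<open>c\<close> for which it does; for bialgebroids this is the axiom \<open>takeuchi\<close> below.
\<close>

definition tensor_rmult ::
  "('s, 'q) ring_scheme \<Rightarrow> ('l, 's, 'x) bimod \<Rightarrow> ('s, 'r, 'y) bimod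
    \<Rightarrow> ('x \<Rightarrow> 'x \<Rightarrow> 'x) \<Rightarrow> ('y \<Rightarrow> 'y \<Rightarrow> 'y)
    \<Rightarrow> ('x \<times> 'y \<Rightarrow>\<^sub>0 int) set \<Rightarrow> 'x \<Rightarrow> 'y \<Rightarrow> ('x \<times> 'y \<Rightarrow>\<^sub>0 int) set" where
  "tensor_rmult S X Y f g c u v =
     tensor_lift (tensor S X Y) (\<lambda>x y. tens S X Y (f x u) (g y v)) c"

definition tensor_mult ::
  "('s, 'q) ring_scheme \<Rightarrow> ('l, 's, 'x) bimod \<Rightarrow> ('s, 'r, 'y) bimod
    \<Rightarrow> ('x \<Rightarrow> 'x \<Rightarrow> 'x) \<Rightarrow> ('y \<Rightarrow> 'y \<Rightarrow> 'y)
    \<Rightarrow> ('x \<times> 'y \<Rightarrow>\<^sub>0 int) set \<Rightarrow> ('x \<times> 'y \<Rightarrow>\<^sub>0 int) set \<Rightarrow> ('x \<times> 'y \<Rightarrow>\<^sub>0 int) set" where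
  "tensor_mult S X Y f g c d = tensor_lift (tensor S X Y) (tensor_rmult S X Y f g c) d"

definition comonoid ::
  "('s, 'q) ring_scheme \<Rightarrow> ('s, 's, 'x) bimod \<Rightarrow> ('x \<Rightarrow> ('x \<times> 'x \<Rightarrow>\<^sub>0 int) set) \<Rightarrow> ('x \<Rightarrow> 's) \<Rightarrow> bool" where
  "comonoid S X \<gamma> \<pi> \<longleftrightarrow>
     bimod_hom (carrier S) (carrier S) X (tensor S X X) \<gamma> \<and>
     bimod_hom (carrier S) (carrier S) X (reg_bimod S) \<pi> \<and>
     (\<forall>x\<in>carrier X.
        tensor_assoc S X X X (tensor_map S (tensor S X X) X \<gamma> id (\<gamma> x)) =
          tensor_map S X (tensor S X X) id \<gamma> (\<gamma> x) \<and>
        tensor_lift X (\<lambda>u v. lact X (\<pi> u) v) (\<gamma> x) = x \<and>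
        tensor_lift X (\<lambda>u v. ract X u (\<pi> v)) (\<gamma> x) = x)"


section \<open>Extensions of algebras\<close>

text \<open>\<open>M \<otimes>\<^sub>N M\<close>, as an \<open>M\<close>-\<open>M\<close>-bimodule; restricting scalars gives the other bimodule structures.\<close>

definition MtensM ::
  "('k, 'm, 'p) module_scheme \<Rightarrow> 'm set \<Rightarrow> ('m, 'm, ('m \<times> 'm \<Rightarrow>\<^sub>0 int) set) bimod" where
  "MtensM M N = tensor (M\<lparr>carrier := N\<rparr>) (reg_bimod M) (reg_bimod M)"

definition depth_two :: "('k, 'm, 'p) module_scheme \<Rightarrow> 'm set \<Rightarrow> bool" where
  "depth_two M N \<longleftrightarrow>
     (\<exists>n. direct_summand N (carrier M) (MtensM M N) (pow_bimod n (reg_bimod M))) \<and>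
     (\<exists>n. direct_summand (carrier M) N (MtensM M N) (pow_bimod n (reg_bimod M)))"

definition balanced_extension :: "('k, 'm, 'p) module_scheme \<Rightarrow> 'm set \<Rightarrow> bool" where
  "balanced_extension M N \<longleftrightarrow>
     (let E = carrier (hom_group {} N (reg_bimod M) (reg_bimod M)) in
      {g \<in> carrier (hom_group {} {} (reg_bimod M) (reg_bimod M)).
         \<forall>f\<in>E. \<forall>m\<in>carrier M. g (f m) = f (g m)} =
      {\<lambda>m\<in>carrier M. m \<otimes>\<^bsub>M\<^esub> n | n. n \<in> N})"

text \<open>\<open>A\<close> is separable: the multiplication \<open>A \<otimes>\<^sub>K A \<rightarrow> A\<close> is a split epimorphism of \<open>A\<close>-\<open>A\<close>-bimodules.\<close>

definition separable_algebra :: "('k, 'q) ring_scheme \<Rightarrow> ('k, 'a, 'p) module_scheme \<Rightarrow> bool" where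
  "separable_algebra K A \<longleftrightarrow> k_algebra K A \<and>
     (\<exists>\<sigma>. bimod_hom (carrier A) (carrier A) (reg_bimod A)
            (tensor K (as_bimod A (mult A) (\<lambda>x c. c \<odot>\<^bsub>A\<^esub> x)) (as_bimod A (smult A) (mult A))) \<sigma> \<and>
          (\<forall>x\<in>carrier A. tensor_lift A (mult A) (\<sigma> x) = x))"


section \<open>Left bialgebroids\<close>

record ('k, 's, 'b) left_bialgebroid =
  talg :: "('k, 'b) module"
  balg :: "('k, 's) module"
  src :: "'s \<Rightarrow> 'b"
  tgt :: "'s \<Rightarrow> 'b"
  comul :: "'b \<Rightarrow> ('b \<times> 'b \<Rightarrow>\<^sub>0 int) set"
  counit :: "'b \<Rightarrow> 's"

text \<open>\<open>B\<close> as an \<open>S\<close>-\<open>S\<close>-bimodule along maps \<open>s\<close>, \<open>t\<close>: \<open>r \<cdot> b \<cdot> r' = s(r) t(r') b\<close>.\<close>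

definition bgd_bimod ::
  "('k, 'b, 'p) module_scheme \<Rightarrow> ('s \<Rightarrow> 'b) \<Rightarrow> ('s \<Rightarrow> 'b) \<Rightarrow> ('s, 's, 'b) bimod" where
  "bgd_bimod A s t = as_bimod A (\<lambda>r b. s r \<otimes>\<^bsub>A\<^esub> b) (\<lambda>b r. t r \<otimes>\<^bsub>A\<^esub> b)"

abbreviation bim :: "('k, 's, 'b) left_bialgebroid \<Rightarrow> ('s, 's, 'b) bimod" where
  "bim B \<equiv> bgd_bimod (talg B) (src B) (tgt B)"

locale left_bialgebroid =
  fixes K :: "('k, 'q) ring_scheme" and B :: "('k, 's, 'b) left_bialgebroid"
  assumes total_algebra: "k_algebra K (talg B)"
    and base_algebra: "k_algebra K (balg B)"
    and src_hom: "alg_hom K (balg B) (talg B) (src B)"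
    and tgt_hom: "alg_hom K (op_alg (balg B)) (talg B) (tgt B)"
    and src_tgt_commute: "\<lbrakk>r \<in> carrier (balg B); r' \<in> carrier (balg B)\<rbrakk> \<Longrightarrow>
      src B r \<otimes>\<^bsub>talg B\<^esub> tgt B r' = tgt B r' \<otimes>\<^bsub>talg B\<^esub> src B r"
    and comonoid: "comonoid (balg B) (bim B) (comul B) (counit B)"
    and takeuchi: "\<lbrakk>b \<in> carrier (talg B); r \<in> carrier (balg B)\<rbrakk> \<Longrightarrow>
      tensor_rmult (balg B) (bim B) (bim B) (mult (talg B)) (mult (talg B))
        (comul B b) (tgt B r) \<one>\<^bsub>talg B\<^esub> =
      tensor_rmult (balg B) (bim B) (bim B) (mult (talg B)) (mult (talg B))
        (comul B b) \<one>\<^bsub>talg B\<^esub> (src B r)"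
    and comul_mult: "\<lbrakk>b \<in> carrier (talg B); c \<in> carrier (talg B)\<rbrakk> \<Longrightarrow>
      tensor_mult (balg B) (bim B) (bim B) (mult (talg B)) (mult (talg B)) (comul B b) (comul B c) =
      comul B (b \<otimes>\<^bsub>talg B\<^esub> c)"
    and comul_one: "comul B \<one>\<^bsub>talg B\<^esub> = tens (balg B) (bim B) (bim B) \<one>\<^bsub>talg B\<^esub> \<one>\<^bsub>talg B\<^esub>"
    and counit_src: "\<lbrakk>b \<in> carrier (talg B); c \<in> carrier (talg B)\<rbrakk> \<Longrightarrow>
      counit B (b \<otimes>\<^bsub>talg B\<^esub> src B (counit B c)) = counit B (b \<otimes>\<^bsub>talg B\<^esub> c)"
    and counit_tgt: "\<lbrakk>b \<in> carrier (talg B); c \<in> carrier (talg B)\<rbrakk> \<Longrightarrow>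
      counit B (b \<otimes>\<^bsub>talg B\<^esub> tgt B (counit B c)) = counit B (b \<otimes>\<^bsub>talg B\<^esub> c)"
    and counit_one: "counit B \<one>\<^bsub>talg B\<^esub> = \<one>\<^bsub>balg B\<^esub>"

definition finite_bialgebroid :: "('k, 's, 'b) left_bialgebroid \<Rightarrow> bool" where
  "finite_bialgebroid B \<longleftrightarrow>
     fg_projective_left (balg B) (bim B) \<and> fg_projective_right (balg B) (bim B)"

text \<open>
  Maps of left bialgebroids.  Functions are extensional so that equality of maps is equality of
  functions.  \<open>bim\<^sub>\<omega>\<close> is the algebra \<open>C\<close> as an \<open>S\<^sub>B\<close>-bimodule along \<open>\<omega>\<close>, and \<open>\<tau>\<close> is the canonical
  epimorphism from the tensor square over \<open>S\<^sub>B\<close> to the tensor square over \<open>S\<^sub>C\<close>.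
\<close>

definition bialgebroid_map ::
  "('k, 'q) ring_scheme \<Rightarrow> ('k, 's, 'b) left_bialgebroid \<Rightarrow> ('k, 'u, 'c) left_bialgebroid
    \<Rightarrow> ('b \<Rightarrow> 'c) \<Rightarrow> bool" where
  "bialgebroid_map K B C \<phi> \<longleftrightarrow>
     \<phi> \<in> extensional (carrier (talg B)) \<and> alg_hom K (talg B) (talg C) \<phi> \<and>
     (\<exists>\<omega>. alg_hom K (balg B) (balg C) \<omega> \<and>
        (let bim\<^sub>\<omega> = bgd_bimod (talg C) (src C \<circ> \<omega>) (tgt C \<circ> \<omega>);
             \<tau> = tensor_lift (tensor (balg C) (bim C) (bim C)) (tens (balg C) (bim C) (bim C))
         in
          (\<forall>r\<in>carrier (balg B). \<phi> (src B r) = src C (\<omega> r) \<and> \<phi> (tgt B r) = tgt C (\<omega> r)) \<and>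
          (\<forall>b\<in>carrier (talg B). counit C (\<phi> b) = \<omega> (counit B b) \<and>
             comul C (\<phi> b) = \<tau> (tensor_map (balg B) bim\<^sub>\<omega> bim\<^sub>\<omega> \<phi> \<phi> (comul B b)))))"


section \<open>Actions of left bialgebroids and the category Aut(M/N)\<close>

definition left_module_action ::
  "('k, 'q) ring_scheme \<Rightarrow> ('k, 'b, 'p) module_scheme \<Rightarrow> ('k, 'm, 'r) module_scheme
    \<Rightarrow> ('b \<Rightarrow> 'm \<Rightarrow> 'm) \<Rightarrow> bool" where
  "left_module_action K B M act \<longleftrightarrow>
     (\<forall>b\<in>carrier B. \<forall>m\<in>carrier M. act b m \<in> carrier M) \<and>
     (\<forall>b\<in>carrier B. \<forall>b'\<in>carrier B. \<forall>m\<in>carrier M. act (b \<oplus>\<^bsub>B\<^esub> b') m = act b m \<oplus>\<^bsub>M\<^esub> act b' m) \<and>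
     (\<forall>b\<in>carrier B. \<forall>m\<in>carrier M. \<forall>m'\<in>carrier M. act b (m \<oplus>\<^bsub>M\<^esub> m') = act b m \<oplus>\<^bsub>M\<^esub> act b m') \<and>
     (\<forall>c\<in>carrier K. \<forall>b\<in>carrier B. \<forall>m\<in>carrier M.
        act (c \<odot>\<^bsub>B\<^esub> b) m = c \<odot>\<^bsub>M\<^esub> act b m \<and> act b (c \<odot>\<^bsub>M\<^esub> m) = c \<odot>\<^bsub>M\<^esub> act b m) \<and>
     (\<forall>b\<in>carrier B. \<forall>b'\<in>carrier B. \<forall>m\<in>carrier M. act (b \<otimes>\<^bsub>B\<^esub> b') m = act b (act b' m)) \<and>
     (\<forall>m\<in>carrier M. act \<one>\<^bsub>B\<^esub> m = m)"

definition module_algebroid_action ::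
  "('k, 'q) ring_scheme \<Rightarrow> ('k, 's, 'b) left_bialgebroid \<Rightarrow> ('k, 'm) module
    \<Rightarrow> ('b \<Rightarrow> 'm \<Rightarrow> 'm) \<Rightarrow> bool" where
  "module_algebroid_action K B M act \<longleftrightarrow>
     left_module_action K (talg B) M act \<and>
     (\<forall>r\<in>carrier (balg B). \<forall>m\<in>carrier M. \<forall>m'\<in>carrier M.
        act (tgt B r) m \<otimes>\<^bsub>M\<^esub> m' = m \<otimes>\<^bsub>M\<^esub> act (src B r) m') \<and>
     (\<forall>b\<in>carrier (talg B). \<forall>m\<in>carrier M. \<forall>m'\<in>carrier M.
        act b (m \<otimes>\<^bsub>M\<^esub> m') = tensor_lift M (\<lambda>x y. act x m \<otimes>\<^bsub>M\<^esub> act y m') (comul B b)) \<and>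
     (\<forall>b\<in>carrier (talg B). act b \<one>\<^bsub>M\<^esub> = act (src B (counit B b)) \<one>\<^bsub>M\<^esub>)"

definition invariants ::
  "('k, 's, 'b) left_bialgebroid \<Rightarrow> ('k, 'm) module \<Rightarrow> ('b \<Rightarrow> 'm \<Rightarrow> 'm) \<Rightarrow> 'm set" where
  "invariants B M act =
     {m \<in> carrier M. \<forall>b\<in>carrier (talg B). act b m = act (src B (counit B b)) m}"

definition Aut_object ::
  "('k, 'q) ring_scheme \<Rightarrow> ('k, 'm) module \<Rightarrow> 'm set
    \<Rightarrow> ('k, 's, 'b) left_bialgebroid \<Rightarrow> ('b \<Rightarrow> 'm \<Rightarrow> 'm) \<Rightarrow> bool" where
  "Aut_object K M N B act \<longleftrightarrow>
     left_bialgebroid K B \<and> finite_bialgebroid B \<and>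
     module_algebroid_action K B M act \<and> N \<subseteq> invariants B M act"

definition Aut_arrow ::
  "('k, 'q) ring_scheme \<Rightarrow> ('k, 'm) module
    \<Rightarrow> ('k, 's, 'b) left_bialgebroid \<Rightarrow> ('b \<Rightarrow> 'm \<Rightarrow> 'm)
    \<Rightarrow> ('k, 'u, 'c) left_bialgebroid \<Rightarrow> ('c \<Rightarrow> 'm \<Rightarrow> 'm) \<Rightarrow> ('b \<Rightarrow> 'c) \<Rightarrow> bool" where
  "Aut_arrow K M B act\<^sub>B C act\<^sub>C f \<longleftrightarrow>
     bialgebroid_map K B C f \<and>
     (\<forall>b\<in>carrier (talg B). \<forall>m\<in>carrier M. act\<^sub>C (f b) m = act\<^sub>B b m)"


section \<open>The left bialgebroid of bimodule endomorphisms\<close>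

definition bimod_End :: "('k, 'm) module \<Rightarrow> 'm set \<Rightarrow> ('k, 'm \<Rightarrow> 'm) module" where
  "bimod_End M N = (let H = hom_group N N (reg_bimod M) (reg_bimod M) in
     \<lparr>carrier = carrier H, mult = compose (carrier M), one = (\<lambda>m\<in>carrier M. m),
      ring.zero = \<zero>\<^bsub>H\<^esub>, add = add H, smult = (\<lambda>c f. \<lambda>m\<in>carrier M. c \<odot>\<^bsub>M\<^esub> f m)\<rparr>)"

definition cent_alg :: "('k, 'm) module \<Rightarrow> 'm set \<Rightarrow> ('k, 'm) module" where
  "cent_alg M N = M\<lparr>carrier := centralizer_of M N\<rparr>"

definition End_src :: "('k, 'm) module \<Rightarrow> 'm \<Rightarrow> 'm \<Rightarrow> 'm" where
  "End_src M r = (\<lambda>m\<in>carrier M. r \<otimes>\<^bsub>M\<^esub> m)"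

definition End_tgt :: "('k, 'm) module \<Rightarrow> 'm \<Rightarrow> 'm \<Rightarrow> 'm" where
  "End_tgt M r = (\<lambda>m\<in>carrier M. m \<otimes>\<^bsub>M\<^esub> r)"

definition End_square ::
  "('k, 'm) module \<Rightarrow> 'm set \<Rightarrow> ('m, 'm, (('m \<Rightarrow> 'm) \<times> ('m \<Rightarrow> 'm) \<Rightarrow>\<^sub>0 int) set) bimod" where
  "End_square M N = (let X = bgd_bimod (bimod_End M N) (End_src M) (End_tgt M) in
     tensor (cent_alg M N) X X)"

text \<open>The map \<open>A \<otimes>\<^sub>R A \<rightarrow> Hom\<^sub>N\<^sub>-\<^sub>N(M \<otimes>\<^sub>N M, M)\<close>, \<open>a \<otimes> a' \<mapsto> (m \<otimes> m' \<mapsto> a(m) a'(m'))\<close>.\<close>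

definition End_square_map ::
  "('k, 'm) module \<Rightarrow> 'm set \<Rightarrow> (('m \<Rightarrow> 'm) \<times> ('m \<Rightarrow> 'm) \<Rightarrow>\<^sub>0 int) set
    \<Rightarrow> ('m \<times> 'm \<Rightarrow>\<^sub>0 int) set \<Rightarrow> 'm" where
  "End_square_map M N = tensor_lift (hom_group N N (MtensM M N) (reg_bimod M))
     (\<lambda>a a'. \<lambda>z\<in>carrier (MtensM M N). tensor_lift M (\<lambda>m m'. a m \<otimes>\<^bsub>M\<^esub> a' m') z)"

definition End_bialgebroid :: "('k, 'm) module \<Rightarrow> 'm set \<Rightarrow> ('k, 'm, 'm \<Rightarrow> 'm) left_bialgebroid" where
  "End_bialgebroid M N = \<lparr>talg = bimod_End M N, balg = cent_alg M N,
     src = End_src M, tgt = End_tgt M,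
     comul = (\<lambda>a. the_inv_into (carrier (End_square M N)) (End_square_map M N)
       (\<lambda>z\<in>carrier (MtensM M N). tensor_lift M (\<lambda>m m'. a (m \<otimes>\<^bsub>M\<^esub> m')) z)),
     counit = (\<lambda>a. a \<one>\<^bsub>M\<^esub>)\<rparr>"


section \<open>Weak bialgebras\<close>

record ('k, 'w) weak_bialgebra =
  walg :: "('k, 'w) module"
  wcomul :: "'w \<Rightarrow> ('w \<times> 'w \<Rightarrow>\<^sub>0 int) set"
  wcounit :: "'w \<Rightarrow> 'k"

text \<open>
  The elements \<open>\<Delta>(1) \<otimes> 1\<close> and \<open>(\<Delta> \<otimes> id)\<Delta>(1)\<close> of \<open>(W \<otimes> W) \<otimes> W\<close> are transported along the
  associator, so that the last two axioms are equations in \<open>W \<otimes> (W \<otimes> W)\<close>.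
\<close>

definition weak_bialgebra :: "('k, 'q) ring_scheme \<Rightarrow> ('k, 'w) weak_bialgebra \<Rightarrow> bool" where
  "weak_bialgebra K W \<longleftrightarrow>
     (let A = walg W; X = sym_bimod A; XX = tensor K X X;
          \<Delta> = wcomul W; \<epsilon> = wcounit W;
          mult2 = tensor_mult K X X (mult A) (mult A);
          mult3 = tensor_mult K X XX (mult A) mult2;
          D1_1 = tensor_assoc K X X X (tens K XX X (\<Delta> \<one>\<^bsub>A\<^esub>) \<one>\<^bsub>A\<^esub>);
          one_D1 = tens K X XX \<one>\<^bsub>A\<^esub> (\<Delta> \<one>\<^bsub>A\<^esub>);
          DD1 = tensor_assoc K X X X (tensor_map K XX X \<Delta> id (\<Delta> \<one>\<^bsub>A\<^esub>))
      in k_algebra K A \<and> finite_dim K A \<and> comonoid K X \<Delta> \<epsilon> \<and>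
         (\<forall>x\<in>carrier A. \<forall>y\<in>carrier A. \<Delta> (x \<otimes>\<^bsub>A\<^esub> y) = mult2 (\<Delta> x) (\<Delta> y)) \<and>
         (\<forall>x\<in>carrier A. \<forall>y\<in>carrier A. \<forall>z\<in>carrier A.
            tensor_lift K (\<lambda>u v. \<epsilon> (x \<otimes>\<^bsub>A\<^esub> u) \<otimes>\<^bsub>K\<^esub> \<epsilon> (v \<otimes>\<^bsub>A\<^esub> z)) (\<Delta> y) = \<epsilon> (x \<otimes>\<^bsub>A\<^esub> y \<otimes>\<^bsub>A\<^esub> z) \<and>
            tensor_lift K (\<lambda>u v. \<epsilon> (x \<otimes>\<^bsub>A\<^esub> v) \<otimes>\<^bsub>K\<^esub> \<epsilon> (u \<otimes>\<^bsub>A\<^esub> z)) (\<Delta> y) = \<epsilon> (x \<otimes>\<^bsub>A\<^esub> y \<otimes>\<^bsub>A\<^esub> z)) \<and>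
         mult3 D1_1 one_D1 = DD1 \<and> mult3 one_D1 D1_1 = DD1)"

definition wpiL :: "('k, 'w) weak_bialgebra \<Rightarrow> 'w \<Rightarrow> 'w" where
  "wpiL W w = tensor_lift (walg W)
     (\<lambda>u v. wcounit W (u \<otimes>\<^bsub>walg W\<^esub> w) \<odot>\<^bsub>walg W\<^esub> v) (wcomul W \<one>\<^bsub>walg W\<^esub>)"

definition wtgt :: "('k, 'w) weak_bialgebra \<Rightarrow> 'w \<Rightarrow> 'w" where
  "wtgt W l = tensor_lift (walg W)
     (\<lambda>u v. wcounit W (v \<otimes>\<^bsub>walg W\<^esub> l) \<odot>\<^bsub>walg W\<^esub> u) (wcomul W \<one>\<^bsub>walg W\<^esub>)"

definition wleft :: "('k, 'w) weak_bialgebra \<Rightarrow> ('k, 'w) module" where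
  "wleft W = (walg W)\<lparr>carrier := wpiL W ` carrier (walg W)\<rparr>"

text \<open>The underlying left bialgebroid \<open>\<beta>\<^sub>l(W)\<close>.\<close>

definition beta_l :: "('k, 'w) weak_bialgebra \<Rightarrow> ('k, 'w, 'w) left_bialgebroid" where
  "beta_l W = (let X = bgd_bimod (walg W) id (wtgt W) in
     \<lparr>talg = walg W, balg = wleft W, src = id, tgt = wtgt W,
      comul = (\<lambda>w. tensor_lift (tensor (wleft W) X X) (tens (wleft W) X X) (wcomul W w)),
      counit = wpiL W\<rparr>)"

definition weak_left_morphism ::
  "('k, 'q) ring_scheme \<Rightarrow> ('k, 'w) weak_bialgebra \<Rightarrow> ('k, 'v) weak_bialgebra \<Rightarrow> ('w \<Rightarrow> 'v) \<Rightarrow> bool" where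
  "weak_left_morphism K W V f \<longleftrightarrow> bialgebroid_map K (beta_l W) (beta_l V) f"

text \<open>
  \<open>\<beta>\<^sub>l(W)\<close> is the left bialgebroid \<open>B\<close> when the base of \<open>B\<close> is identified with its image \<open>W\<^sup>L\<close> under
  the source map.  The last clause identifies the tensor squares over the two base algebras.
\<close>

definition has_underlying_bialgebroid ::
  "('k, 'b) weak_bialgebra \<Rightarrow> ('k, 's, 'b) left_bialgebroid \<Rightarrow> bool" where
  "has_underlying_bialgebroid W B \<longleftrightarrow>
     (let L = beta_l W in
      talg L = talg B \<and>
      bij_betw (src B) (carrier (balg B)) (carrier (balg L)) \<and>
      (\<forall>r\<in>carrier (balg B). tgt L (src B r) = tgt B r) \<and>
      (\<forall>b\<in>carrier (talg B). counit L b = src B (counit B b) \<and>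
         comul L b =
           tensor_lift (tensor (balg L) (bim L) (bim L)) (tens (balg L) (bim L) (bim L)) (comul B b)))"

definition wba_module_action ::
  "('k, 'q) ring_scheme \<Rightarrow> ('k, 'w) weak_bialgebra \<Rightarrow> ('k, 'm) module \<Rightarrow> ('w \<Rightarrow> 'm \<Rightarrow> 'm) \<Rightarrow> bool" where
  "wba_module_action K W M act \<longleftrightarrow>
     left_module_action K (walg W) M act \<and>
     (\<forall>w\<in>carrier (walg W). \<forall>m\<in>carrier M. \<forall>m'\<in>carrier M.
        act w (m \<otimes>\<^bsub>M\<^esub> m') = tensor_lift M (\<lambda>x y. act x m \<otimes>\<^bsub>M\<^esub> act y m') (wcomul W w)) \<and>
     (\<forall>w\<in>carrier (walg W). act w \<one>\<^bsub>M\<^esub> = act (wpiL W w) \<one>\<^bsub>M\<^esub>)"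

definition wba_invariants ::
  "('k, 'w) weak_bialgebra \<Rightarrow> ('k, 'm) module \<Rightarrow> ('w \<Rightarrow> 'm \<Rightarrow> 'm) \<Rightarrow> 'm set" where
  "wba_invariants W M act =
     {m \<in> carrier M. \<forall>w\<in>carrier (walg W). act w m = act (wpiL W w) m}"

end

theory Submission
  imports Defs
begin

text \<open>
  The elements of \<open>A = End(\<^sub>NM\<^sub>N)\<close> are functions on \<open>M\<close>.  A map \<open>f\<close> to \<open>A\<close> with
  \<open>f(b)(m) = b \<triangleright> m\<close> is therefore unique, and it exists if every \<open>b\<close> acts by an \<open>N\<close>-\<open>N\<close>-bimodule
  map and \<open>f\<close> respects the bialgebroid structures.

  Let a bialgebroid \<open>B\<close> over \<open>S\<close> act on \<open>M\<close> with \<open>N \<subseteq> M\<^sup>B\<close>, and put \<open>\<omega>(r) = s(r) \<triangleright> 1\<close>.  As the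
  multiplication of \<open>M\<close> is balanced over \<open>S\<close>, \<open>s(r)\<close> and \<open>t(r)\<close> act as the left and the right
  multiplication by \<open>\<omega>(r)\<close>.  On \<open>N\<close> these agree, so \<open>\<omega>\<close> has values in \<open>R\<close>, and the counit laws
  of \<open>B\<close> give the \<open>N\<close>-linearity (\<open>Aut_object_arrow\<close>).  Compatibility with the comultiplications
  holds because \<open>A \<otimes>\<^sub>R A \<rightarrow> Hom(M \<otimes>\<^sub>N M, M)\<close> is injective and sends \<open>\<gamma>(f(b))\<close> and
  \<open>f(b\<^sub>1) \<otimes> f(b\<^sub>2)\<close> to the two sides of \<open>b \<triangleright> (m m') = (b\<^sub>1 \<triangleright> m)(b\<^sub>2 \<triangleright> m')\<close>
  (\<open>action_map_bialgebroid_map\<close>).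

  The structure of \<open>A\<close> rests on quasi-bases.  Depth two means that
  \<open>m \<otimes> 1 = \<Sum>\<^sub>i b\<^sub>i \<beta>\<^sub>i(m)\<close> and \<open>1 \<otimes> m = \<Sum>\<^sub>j \<gamma>\<^sub>j(m) c\<^sub>j\<close> with \<open>N\<close>-central \<open>b\<^sub>i, c\<^sub>j \<in> M \<otimes>\<^sub>N M\<close> and
  \<open>\<beta>\<^sub>i, \<gamma>\<^sub>j \<in> A\<close>.  They yield dual bases of \<open>\<^sub>RA\<close> and \<open>A\<^sub>R\<close> (\<open>left_dual_basis\<close>,
  \<open>right_dual_basis\<close>), so \<open>A\<close> is finite; the latter also gives the injectivity of
  \<open>A \<otimes>\<^sub>R A \<rightarrow> Hom(M \<otimes>\<^sub>N M, M)\<close> and of its analogue for three factors (\<open>separated_tensor\<close>), the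
  former a preimage \<open>\<gamma>(a)\<close> of \<open>m \<otimes> m' \<mapsto> a(m m')\<close> (\<open>coproduct_exists\<close>).  Every axiom of a
  bialgebroid then becomes an identity between functions of elements of \<open>M\<close>.

  For a weak bialgebra \<open>W\<close> the facts about \<open>s\<close> and \<open>t\<close> have to be derived: that \<open>l \<in> W\<^sup>L\<close> and
  \<open>t(l)\<close> act as the left and the right multiplication by \<open>l \<triangleright> 1\<close> follows by evaluating the axioms
  for \<open>(\<Delta> \<otimes> id)\<Delta>(1)\<close> on \<open>M\<close> (\<open>wba_action_base\<close>), and the counit laws come from
  \<open>\<Delta>(w) = \<Delta>(1)\<Delta>(w)\<close> (\<open>pi_comul\<close>, \<open>tgt_comul\<close>).  The argument above then gives a map from
  \<open>\<beta>\<^sub>l(W)\<close> to \<open>A\<close>, and the identification of \<open>R\<close> with \<open>s(R)\<close> turns it into one to \<open>\<beta>\<^sub>l\<close> of any weak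
  bialgebra with underlying left bialgebroid \<open>A\<close>.
\<close>


section \<open>Additive maps and groups with operators\<close>

text \<open>
  The abelian groups are part of the predicate, so that a single hypothesis supports calculations
  with zero, negatives and finite sums.
\<close>

definition additive ::
  "('x, 'p) ring_scheme \<Rightarrow> ('y, 'q) ring_scheme \<Rightarrow> ('x \<Rightarrow> 'y) \<Rightarrow> bool" where
  "additive X Y h \<longleftrightarrow> abelian_group X \<and> abelian_group Y \<and> h \<in> carrier X \<rightarrow> carrier Y \<and>
     (\<forall>x\<in>carrier X. \<forall>x'\<in>carrier X. h (x \<oplus>\<^bsub>X\<^esub> x') = h x \<oplus>\<^bsub>Y\<^esub> h x')"

lemma additiveI:
  assumes "abelian_group X" "abelian_group Y" "\<And>x. x \<in> carrier X \<Longrightarrow> h x \<in> carrier Y"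
    "\<And>x x'. x \<in> carrier X \<Longrightarrow> x' \<in> carrier X \<Longrightarrow> h (x \<oplus>\<^bsub>X\<^esub> x') = h x \<oplus>\<^bsub>Y\<^esub> h x'"
  shows "additive X Y h"
  using assms by (auto simp: additive_def)

lemma additive_closed: "additive X Y h \<Longrightarrow> x \<in> carrier X \<Longrightarrow> h x \<in> carrier Y"
  by (auto simp: additive_def)

lemma additive_add:
  "additive X Y h \<Longrightarrow> x \<in> carrier X \<Longrightarrow> x' \<in> carrier X \<Longrightarrow> h (x \<oplus>\<^bsub>X\<^esub> x') = h x \<oplus>\<^bsub>Y\<^esub> h x'"
  by (auto simp: additive_def)

lemma additive_domain: "additive X Y h \<Longrightarrow> abelian_group X"
  and additive_range: "additive X Y h \<Longrightarrow> abelian_group Y"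
  by (auto simp: additive_def)

lemma additive_zero:
  assumes "additive X Y h" shows "h \<zero>\<^bsub>X\<^esub> = \<zero>\<^bsub>Y\<^esub>"
proof -
  interpret X: abelian_group X by (rule additive_domain[OF assms])
  interpret Y: abelian_group Y by (rule additive_range[OF assms])
  have "h \<zero>\<^bsub>X\<^esub> \<oplus>\<^bsub>Y\<^esub> h \<zero>\<^bsub>X\<^esub> = h \<zero>\<^bsub>X\<^esub> \<oplus>\<^bsub>Y\<^esub> \<zero>\<^bsub>Y\<^esub>"
    using additive_add[OF assms X.zero_closed X.zero_closed] additive_closed[OF assms X.zero_closed]
    by simp
  then show ?thesis using additive_closed[OF assms X.zero_closed] by (simp add: Y.add.l_cancel_one)
qed

lemma additive_neg:
  assumes "additive X Y h" "x \<in> carrier X" shows "h (\<ominus>\<^bsub>X\<^esub> x) = \<ominus>\<^bsub>Y\<^esub> h x"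
proof -
  interpret X: abelian_group X by (rule additive_domain[OF assms(1)])
  interpret Y: abelian_group Y by (rule additive_range[OF assms(1)])
  have "h (\<ominus>\<^bsub>X\<^esub> x) \<oplus>\<^bsub>Y\<^esub> h x = \<zero>\<^bsub>Y\<^esub>"
    using additive_add[OF assms(1), of "\<ominus>\<^bsub>X\<^esub> x" x] assms(2) additive_zero[OF assms(1)]
    by (simp add: X.l_neg)
  then show ?thesis
    using Y.minus_equality additive_closed[OF assms(1)] assms(2) by (metis X.a_inv_closed)
qed

lemma additive_sum:
  assumes h: "additive X Y h" and f: "f \<in> I \<rightarrow> carrier X"
  shows "h (\<Oplus>\<^bsub>X\<^esub>i\<in>I. f i) = (\<Oplus>\<^bsub>Y\<^esub>i\<in>I. h (f i))"
proof -
  interpret X: abelian_group X by (rule additive_domain[OF h])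
  interpret Y: abelian_group Y by (rule additive_range[OF h])
  show ?thesis using f
  proof (induction I rule: infinite_finite_induct)
    case (insert i I)
    then have "f i \<in> carrier X" "f \<in> I \<rightarrow> carrier X" "(\<lambda>i. h (f i)) \<in> I \<rightarrow> carrier Y" "h (f i) \<in> carrier Y"
      using additive_closed[OF h] by auto
    with insert show ?case by (simp add: additive_add[OF h])
  qed (simp_all add: additive_zero[OF h])
qed

lemma additive_comp: "additive X Y g \<Longrightarrow> additive Y Z h \<Longrightarrow> additive X Z (\<lambda>x. h (g x))"
  by (auto simp: additive_def Pi_iff)

lemma additive_ident: "abelian_group X \<Longrightarrow> additive X X (\<lambda>x. x)"
  by (auto simp: additive_def)

lemma additive_plus:
  assumes "additive X Y g" "additive X Y h"
  shows "additive X Y (\<lambda>x. g x \<oplus>\<^bsub>Y\<^esub> h x)"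
proof -
  interpret Y: abelian_group Y by (rule additive_range[OF assms(1)])
  show ?thesis
    using assms by (auto simp: additive_def Pi_iff Y.a_assoc Y.a_lcomm)
qed

lemma additive_finsum:
  assumes Y: "abelian_group Y" "abelian_group X" and h: "\<And>i. i \<in> I \<Longrightarrow> additive X Y (h i)"
  shows "additive X Y (\<lambda>x. \<Oplus>\<^bsub>Y\<^esub>i\<in>I. h i x)"
proof -
  interpret Y: abelian_group Y by fact
  interpret X: abelian_group X by fact
  show ?thesis
  proof (rule additiveI)
    fix x x' assume x: "x \<in> carrier X" "x' \<in> carrier X"
    have "(\<Oplus>\<^bsub>Y\<^esub>i\<in>I. h i (x \<oplus>\<^bsub>X\<^esub> x')) = (\<Oplus>\<^bsub>Y\<^esub>i\<in>I. h i x \<oplus>\<^bsub>Y\<^esub> h i x')"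
      by (rule Y.finsum_cong') (use x in \<open>simp_all add: Pi_iff additive_add[OF h] additive_closed[OF h]\<close>)
    also have "\<dots> = (\<Oplus>\<^bsub>Y\<^esub>i\<in>I. h i x) \<oplus>\<^bsub>Y\<^esub> (\<Oplus>\<^bsub>Y\<^esub>i\<in>I. h i x')"
      by (rule Y.finsum_addf) (use x in \<open>simp_all add: Pi_iff additive_closed[OF h]\<close>)
    finally show "(\<Oplus>\<^bsub>Y\<^esub>i\<in>I. h i (x \<oplus>\<^bsub>X\<^esub> x')) = (\<Oplus>\<^bsub>Y\<^esub>i\<in>I. h i x) \<oplus>\<^bsub>Y\<^esub> (\<Oplus>\<^bsub>Y\<^esub>i\<in>I. h i x')" .
  next
    show "(\<Oplus>\<^bsub>Y\<^esub>i\<in>I. h i x) \<in> carrier Y" if "x \<in> carrier X" for x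
      using additive_closed[OF h that] by (intro Y.finsum_closed) auto
  qed (fact Y)+
qed

lemma bimod_hom_additive:
  assumes "bimod_hom L P X Y f" "abelian_group X" "abelian_group Y"
  shows "additive X Y f"
  using assms by (auto simp: bimod_hom_def additive_def)

text \<open>
  A tensor product depends only on the additive groups and on how the scalars operate on them; so
  the scalars are mere sets of commuting additive operators.  This covers bimodules restricted
  along maps, and a weak bialgebra \<open>W\<close> as a bimodule over \<open>W\<^sup>L\<close>, alike.
\<close>

definition bi_operators :: "'l set \<Rightarrow> 'r set \<Rightarrow> ('l, 'r, 'x) bimod \<Rightarrow> bool" where
  "bi_operators L P X \<longleftrightarrow> abelian_group X \<and>
     (\<forall>l\<in>L. additive X X (lact X l)) \<and> (\<forall>r\<in>P. additive X X (\<lambda>x. ract X x r)) \<and>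
     (\<forall>l\<in>L. \<forall>r\<in>P. \<forall>x\<in>carrier X. ract X (lact X l x) r = lact X l (ract X x r))"

lemma bi_operators_lact: "bi_operators L P X \<Longrightarrow> l \<in> L \<Longrightarrow> additive X X (lact X l)"
  and bi_operators_ract: "bi_operators L P X \<Longrightarrow> r \<in> P \<Longrightarrow> additive X X (\<lambda>x. ract X x r)"
  and bi_operators_group: "bi_operators L P X \<Longrightarrow> abelian_group X"
  and bi_operators_commute: "bi_operators L P X \<Longrightarrow> l \<in> L \<Longrightarrow> r \<in> P \<Longrightarrow> x \<in> carrier X \<Longrightarrow>
     ract X (lact X l x) r = lact X l (ract X x r)"
  and bi_operators_left: "bi_operators L P X \<Longrightarrow> bi_operators L {} X"
  and bi_operators_right: "bi_operators L P X \<Longrightarrow> bi_operators {} P X"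
  by (auto simp: bi_operators_def)

lemma bi_operators_subset:
  "bi_operators L P X \<Longrightarrow> L' \<subseteq> L \<Longrightarrow> P' \<subseteq> P \<Longrightarrow> bi_operators L' P' X"
  unfolding bi_operators_def by blast

lemma as_bimod_simps [simp]:
  "carrier (as_bimod A l r) = carrier A" "add (as_bimod A l r) = add A"
  "ring.zero (as_bimod A l r) = \<zero>\<^bsub>A\<^esub>" "lact (as_bimod A l r) = l" "ract (as_bimod A l r) = r"
  by (simp_all add: as_bimod_def)


text \<open>
  Algebras, bimodules and rings are different record types over the same additive group.  Additivity
  and the maps induced on tensor products depend on that group only.
\<close>

definition same_group :: "('x, 'p) ring_scheme \<Rightarrow> ('x, 'q) ring_scheme \<Rightarrow> bool" where
  "same_group A B \<longleftrightarrow> carrier A = carrier B \<and> add A = add B \<and> \<zero>\<^bsub>A\<^esub> = \<zero>\<^bsub>B\<^esub>"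

lemma abelian_group_transfer: "same_group A B \<Longrightarrow> abelian_group A \<longleftrightarrow> abelian_group B"
  by (simp add: same_group_def abelian_group_def abelian_group_axioms_def abelian_monoid_def
    comm_group_def comm_monoid_def comm_monoid_axioms_def group_def group_axioms_def monoid_def Units_def)

lemma reg_bimod_simps [simp]:
  "carrier (reg_bimod A) = carrier A" "add (reg_bimod A) = add A"
  "ring.zero (reg_bimod A) = \<zero>\<^bsub>A\<^esub>" "lact (reg_bimod A) = mult A" "ract (reg_bimod A) = mult A"
  by (simp_all add: reg_bimod_def)

lemma bgd_bimod_simps [simp]:
  "carrier (bgd_bimod A s t) = carrier A" "add (bgd_bimod A s t) = add A"
  "ring.zero (bgd_bimod A s t) = \<zero>\<^bsub>A\<^esub>"
  "lact (bgd_bimod A s t) r b = s r \<otimes>\<^bsub>A\<^esub> b" "ract (bgd_bimod A s t) b r = t r \<otimes>\<^bsub>A\<^esub> b"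
  by (simp_all add: bgd_bimod_def)

lemma sym_bimod_simps [simp]:
  "carrier (sym_bimod A) = carrier A" "add (sym_bimod A) = add A"
  "ring.zero (sym_bimod A) = \<zero>\<^bsub>A\<^esub>"
  "lact (sym_bimod A) c b = c \<odot>\<^bsub>A\<^esub> b" "ract (sym_bimod A) b c = c \<odot>\<^bsub>A\<^esub> b"
  by (simp_all add: sym_bimod_def)

lemma additive_transfer_range: "same_group A B \<Longrightarrow> additive X A h \<longleftrightarrow> additive X B h"
  using abelian_group_transfer[of A B] by (auto simp: additive_def same_group_def)

lemma additive_transfer_domain: "same_group A B \<Longrightarrow> additive A X h \<longleftrightarrow> additive B X h"
  using abelian_group_transfer[of A B] by (auto simp: additive_def same_group_def)

lemma tensor_lift_transfer:
  fixes f :: "'x \<Rightarrow> 'y \<Rightarrow> 'z"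
  assumes "same_group A B"
  shows "tensor_lift A f = tensor_lift B f"
proof -
  have "finsum A g I = finsum B g I" for g :: "'x \<times> 'y \<Rightarrow> 'z" and I
    using assms by (simp add: same_group_def finsum_def finprod_def)
  moreover have "[k] \<cdot>\<^bsub>A\<^esub> z = [k] \<cdot>\<^bsub>B\<^esub> z" for k :: int and z
    using assms by (simp add: same_group_def add_pow_def int_pow_def nat_pow_def m_inv_def Let_def)
  ultimately show ?thesis by (simp add: tensor_lift_def tensor_eval_def fun_eq_iff)
qed

lemma same_group_bimod:
  "same_group (as_bimod A l r) A" "same_group (reg_bimod A) A"
  "same_group (bgd_bimod B s t) B" "same_group (sym_bimod B) B"
  by (simp_all add: same_group_def)

lemmas abelian_group_bimod [simp] = same_group_bimod[THEN abelian_group_transfer]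
lemmas additive_bimod [simp] = same_group_bimod[THEN additive_transfer_range]
  same_group_bimod[THEN additive_transfer_domain]
lemmas tensor_lift_bimod [simp] = same_group_bimod[THEN tensor_lift_transfer]


section \<open>Tensor products\<close>

definition balanced_map ::
  "('s, 'q) ring_scheme \<Rightarrow> ('l, 's, 'x) bimod \<Rightarrow> ('s, 'r, 'y) bimod \<Rightarrow> ('z, 'p) ring_scheme
    \<Rightarrow> ('x \<Rightarrow> 'y \<Rightarrow> 'z) \<Rightarrow> bool" where
  "balanced_map S X Y Z f \<longleftrightarrow>
     (\<forall>x\<in>carrier X. additive Y Z (f x)) \<and> (\<forall>y\<in>carrier Y. additive X Z (\<lambda>x. f x y)) \<and>
     (\<forall>x\<in>carrier X. \<forall>s\<in>carrier S. \<forall>y\<in>carrier Y. f (ract X x s) y = f x (lact Y s y))"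

lemma balanced_mapI:
  assumes "\<And>x. x \<in> carrier X \<Longrightarrow> additive Y Z (f x)"
    and "\<And>y. y \<in> carrier Y \<Longrightarrow> additive X Z (\<lambda>x. f x y)"
    and "\<And>x s y. x \<in> carrier X \<Longrightarrow> s \<in> carrier S \<Longrightarrow> y \<in> carrier Y \<Longrightarrow>
      f (ract X x s) y = f x (lact Y s y)"
  shows "balanced_map S X Y Z f"
  using assms by (auto simp: balanced_map_def)

lemma balanced_map_comp:
  assumes "balanced_map S X Y Z f" "additive Z Z' h"
  shows "balanced_map S X Y Z' (\<lambda>x y. h (f x y))"
  using assms unfolding balanced_map_def by (auto intro: additive_comp)

locale tensor_product =
  fixes S :: "('s, 'q) ring_scheme" and X :: "('l, 's, 'x) bimod" and Y :: "('s, 'r, 'y) bimod"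
  assumes left_factor: "bi_operators {} (carrier S) X"
    and right_factor: "bi_operators (carrier S) {} Y"
begin

sublocale X: abelian_group X by (rule bi_operators_group[OF left_factor])
sublocale Y: abelian_group Y by (rule bi_operators_group[OF right_factor])

lemma ract_closed: "x \<in> carrier X \<Longrightarrow> s \<in> carrier S \<Longrightarrow> ract X x s \<in> carrier X"
  using additive_closed[OF bi_operators_ract[OF left_factor]] .

lemma lact_closed: "s \<in> carrier S \<Longrightarrow> y \<in> carrier Y \<Longrightarrow> lact Y s y \<in> carrier Y"
  using additive_closed[OF bi_operators_lact[OF right_factor]] .

abbreviation G where "G \<equiv> pair_group X Y"
abbreviation H where "H \<equiv> tensor_null S X Y"

sublocale G: comm_group G by (rule abelian_free_Abelian_group)
sublocale H: normal H G
  by (rule tensor_null_normal(1)[OF X.abelian_group_axioms Y.abelian_group_axioms ract_closed lact_closed])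

lemma tensor_quotient:
  "carrier (tensor S X Y) = rcosets\<^bsub>G\<^esub> H" "add (tensor S X Y) = set_mult G" "\<zero>\<^bsub>tensor S X Y\<^esub> = H"
  by (simp_all add: tensor_def as_bimod_def tensor_group_def FactGroup_def Let_def)

lemma tensor_group_same_group: "same_group (tensor_group S X Y) (tensor S X Y)"
  by (simp add: tensor_def same_group_def)

sublocale tensor: abelian_group "tensor S X Y"
proof -
  interpret Q: comm_group "G Mod H" by (rule G.abelian_FactGroup[OF H.is_subgroup])
  have Q: "carrier (G Mod H) = carrier (tensor S X Y)" "mult (G Mod H) = add (tensor S X Y)"
    "\<one>\<^bsub>G Mod H\<^esub> = \<zero>\<^bsub>tensor S X Y\<^esub>"
    by (simp_all add: tensor_quotient FactGroup_def)
  show "abelian_group (tensor S X Y)"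
    by (rule abelian_groupI)
      (use Q.m_closed Q.one_closed Q.m_assoc Q.m_comm Q.l_one Q.l_inv_ex in \<open>simp_all only: Q\<close>)
qed

lemma tensor_abelian_group: "abelian_group (tensor S X Y)" ..

lemma coset_closed: "c \<in> carrier G \<Longrightarrow> H #>\<^bsub>G\<^esub> c \<in> carrier (tensor S X Y)"
  unfolding tensor_quotient(1) RCOSETS_def by blast

lemma coset_add:
  assumes "c \<in> carrier G" "d \<in> carrier G"
  shows "(H #>\<^bsub>G\<^esub> c) \<oplus>\<^bsub>tensor S X Y\<^esub> (H #>\<^bsub>G\<^esub> d) = H #>\<^bsub>G\<^esub> (c + d)"
  using H.rcos_sum[OF assms] by (simp add: tensor_quotient(2))

lemma frag_closed: "x \<in> carrier X \<Longrightarrow> y \<in> carrier Y \<Longrightarrow> frag_of (x, y) \<in> carrier G"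
  by simp

lemma tens_closed: "x \<in> carrier X \<Longrightarrow> y \<in> carrier Y \<Longrightarrow> tens S X Y x y \<in> carrier (tensor S X Y)"
  unfolding tens_def by (rule coset_closed[OF frag_closed])

lemma rels_subset: "tensor_rels S X Y \<subseteq> H"
  unfolding tensor_null_def by (auto intro: generate.incl)

lemma coset_eqI:
  assumes "c \<in> carrier G" "d \<in> carrier G" "c - d \<in> tensor_rels S X Y"
  shows "H #>\<^bsub>G\<^esub> c = H #>\<^bsub>G\<^esub> d"
proof -
  have h: "c - d \<in> H" using assms(3) rels_subset by blast
  have "H #>\<^bsub>G\<^esub> c = H #>\<^bsub>G\<^esub> ((c - d) \<otimes>\<^bsub>G\<^esub> d)" by simp
  also have "\<dots> = H #>\<^bsub>G\<^esub> (c - d) #>\<^bsub>G\<^esub> d"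
    using G.coset_mult_assoc[OF H.subset _ assms(2)] H.mem_carrier[OF h] by metis
  also have "\<dots> = H #>\<^bsub>G\<^esub> d" by (simp only: H.rcos_const[OF G.is_group h])
  finally show ?thesis .
qed

lemma tens_add_left:
  assumes "x \<in> carrier X" "x' \<in> carrier X" "y \<in> carrier Y"
  shows "tens S X Y (x \<oplus>\<^bsub>X\<^esub> x') y = tens S X Y x y \<oplus>\<^bsub>tensor S X Y\<^esub> tens S X Y x' y"
proof -
  have "frag_of (x \<oplus>\<^bsub>X\<^esub> x', y) - (frag_of (x, y) + frag_of (x', y)) \<in> tensor_rels S X Y"
    unfolding tensor_rels_def diff_add_eq_diff_diff_swap[symmetric] using assms
    by (auto simp: algebra_simps)
  then show ?thesis unfolding tens_def coset_add[OF frag_closed[OF assms(1,3)] frag_closed[OF assms(2,3)]]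
    by (intro coset_eqI)
      (use assms G.m_closed[OF frag_closed[OF assms(1,3)] frag_closed[OF assms(2,3)]] in simp_all)
qed

lemma tens_add_right:
  assumes "x \<in> carrier X" "y \<in> carrier Y" "y' \<in> carrier Y"
  shows "tens S X Y x (y \<oplus>\<^bsub>Y\<^esub> y') = tens S X Y x y \<oplus>\<^bsub>tensor S X Y\<^esub> tens S X Y x y'"
proof -
  have "frag_of (x, y \<oplus>\<^bsub>Y\<^esub> y') - (frag_of (x, y) + frag_of (x, y')) \<in> tensor_rels S X Y"
    unfolding tensor_rels_def diff_add_eq_diff_diff_swap[symmetric] using assms
    by (auto simp: algebra_simps)
  then show ?thesis unfolding tens_def coset_add[OF frag_closed[OF assms(1,2)] frag_closed[OF assms(1,3)]]
    by (intro coset_eqI)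
      (use assms G.m_closed[OF frag_closed[OF assms(1,2)] frag_closed[OF assms(1,3)]] in simp_all)
qed

lemma tens_balanced:
  assumes "x \<in> carrier X" "s \<in> carrier S" "y \<in> carrier Y"
  shows "tens S X Y (ract X x s) y = tens S X Y x (lact Y s y)"
  unfolding tens_def
  by (rule coset_eqI) (use assms ract_closed lact_closed in \<open>auto simp: tensor_rels_def\<close>)

lemma tens_balanced_map: "balanced_map S X Y (tensor S X Y) (tens S X Y)"
  by (intro balanced_mapI additiveI X.abelian_group_axioms Y.abelian_group_axioms
    tensor_abelian_group tens_closed tens_add_left tens_add_right tens_balanced)

text \<open>
  An element is the class of an integral combination of pairs.  Negative coefficients are absorbed
  into the first factor, \<open>- (x \<otimes> y) = (- x) \<otimes> y\<close>, so that sums of pure tensors suffice.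
\<close>

lemma tensor_induct [consumes 1, case_names tens add]:
  assumes z: "z \<in> carrier (tensor S X Y)"
    and tens: "\<And>x y. x \<in> carrier X \<Longrightarrow> y \<in> carrier Y \<Longrightarrow> P (tens S X Y x y)"
    and add: "\<And>z w. z \<in> carrier (tensor S X Y) \<Longrightarrow> w \<in> carrier (tensor S X Y) \<Longrightarrow> P z \<Longrightarrow> P w \<Longrightarrow>
      P (z \<oplus>\<^bsub>tensor S X Y\<^esub> w)"
  shows "P z"
proof -
  have zero: "tens S X Y \<zero>\<^bsub>X\<^esub> \<zero>\<^bsub>Y\<^esub> = H #>\<^bsub>G\<^esub> 0"
  proof -
    have "additive X (tensor S X Y) (\<lambda>x. tens S X Y x \<zero>\<^bsub>Y\<^esub>)"
      using tens_balanced_map Y.zero_closed unfolding balanced_map_def by blast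
    then have "tens S X Y \<zero>\<^bsub>X\<^esub> \<zero>\<^bsub>Y\<^esub> = \<zero>\<^bsub>tensor S X Y\<^esub>" by (rule additive_zero)
    also have "\<dots> = H" by (rule tensor_quotient(3))
    also have "\<dots> = H #>\<^bsub>G\<^esub> 0" using G.coset_mult_one[OF H.subset] by simp
    finally show ?thesis .
  qed
  have neg: "H #>\<^bsub>G\<^esub> (- frag_of (x, y)) = tens S X Y (\<ominus>\<^bsub>X\<^esub> x) y" if xy: "x \<in> carrier X" "y \<in> carrier Y" for x y
  proof -
    have a: "additive X (tensor S X Y) (\<lambda>x. tens S X Y x y)"
      using tens_balanced_map xy unfolding balanced_map_def by blast
    have c: "- frag_of (x, y) \<in> carrier G" using G.inv_closed[OF frag_closed[OF xy]] xy by simp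
    have "(H #>\<^bsub>G\<^esub> (- frag_of (x, y))) \<oplus>\<^bsub>tensor S X Y\<^esub> tens S X Y x y = \<zero>\<^bsub>tensor S X Y\<^esub>"
      unfolding tens_def coset_add[OF c frag_closed[OF xy]]
      using G.coset_mult_one[OF H.subset] by (simp add: tensor_quotient(3))
    then have "H #>\<^bsub>G\<^esub> (- frag_of (x, y)) = \<ominus>\<^bsub>tensor S X Y\<^esub> tens S X Y x y"
      by (intro tensor.minus_equality[symmetric] tens_closed coset_closed[OF c] xy)
    then show ?thesis by (simp add: additive_neg[OF a xy(1)])
  qed
  \<comment> \<open>The free abelian group is generated under differences; hence the claim is carried for \<open>c\<close> and \<open>- c\<close>.\<close>
  define Q where "Q c \<longleftrightarrow> c \<in> carrier G \<and> - c \<in> carrier G \<and> P (H #>\<^bsub>G\<^esub> c) \<and> P (H #>\<^bsub>G\<^esub> (- c))" for c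
  obtain c where c: "c \<in> carrier G" "z = H #>\<^bsub>G\<^esub> c"
    using z unfolding tensor_quotient(1) RCOSETS_def by blast
  have "Poly_Mapping.keys c \<subseteq> carrier X \<times> carrier Y" using c by simp
  then have "Q c"
  proof (rule free_Abelian_group_induct)
    show "Q 0" unfolding Q_def using tens[OF X.zero_closed Y.zero_closed] by (simp add: zero)
  next
    fix c d assume "Poly_Mapping.keys c \<subseteq> carrier X \<times> carrier Y" "Poly_Mapping.keys d \<subseteq> carrier X \<times> carrier Y"
      and "Q c" "Q d"
    then have cd: "c \<in> carrier G" "- c \<in> carrier G" "d \<in> carrier G" "- d \<in> carrier G"
      and P: "P (H #>\<^bsub>G\<^esub> c)" "P (H #>\<^bsub>G\<^esub> (- c))" "P (H #>\<^bsub>G\<^esub> d)" "P (H #>\<^bsub>G\<^esub> (- d))"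
      unfolding Q_def by blast+
    have "c + - d \<in> carrier G" "- c + d \<in> carrier G"
      using G.m_closed[OF cd(1,4)] G.m_closed[OF cd(2,3)] by (simp_all del: carrier_free_Abelian_group_iff)
    moreover have "P (H #>\<^bsub>G\<^esub> (c + - d))" "P (H #>\<^bsub>G\<^esub> (- c + d))"
      using add[OF coset_closed coset_closed, OF cd(1,4) P(1,4)] add[OF coset_closed coset_closed, OF cd(2,3) P(2,3)]
      by (simp_all only: coset_add[OF cd(1,4)] coset_add[OF cd(2,3)])
    ultimately show "Q (c - d)" unfolding Q_def by (simp add: algebra_simps del: carrier_free_Abelian_group_iff)
  next
    fix p assume p: "p \<in> carrier X \<times> carrier Y"
    obtain x y where xy: "p = (x, y)" "x \<in> carrier X" "y \<in> carrier Y" using p by blast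
    show "Q (frag_of p)" unfolding Q_def xy(1) neg[OF xy(2,3)]
      using tens[OF xy(2,3)] tens[OF X.a_inv_closed[OF xy(2)] xy(3)] xy(2,3)
      by (simp add: tens_def)
  qed
  then show ?thesis unfolding Q_def c(2) by blast
qed

lemma additive_eq_on_tens:
  assumes "additive (tensor S X Y) Z g" "additive (tensor S X Y) Z h"
    and "\<And>x y. x \<in> carrier X \<Longrightarrow> y \<in> carrier Y \<Longrightarrow> g (tens S X Y x y) = h (tens S X Y x y)"
    and "z \<in> carrier (tensor S X Y)"
  shows "g z = h z"
  using assms(4)
  by (induction rule: tensor_induct) (simp_all add: assms(3) additive_add[OF assms(1)] additive_add[OF assms(2)])

lemma lift_additive:
  assumes f: "balanced_map S X Y Z f"
  shows "additive (tensor S X Y) Z (tensor_lift Z f)"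
    and "\<And>x y. x \<in> carrier X \<Longrightarrow> y \<in> carrier Y \<Longrightarrow> tensor_lift Z f (tens S X Y x y) = f x y"
proof -
  have Z: "abelian_group Z"
    using f X.zero_closed additive_range unfolding balanced_map_def by blast
  note U = tensor_lift_universal[OF X.abelian_group_axioms Y.abelian_group_axioms Z
      ract_closed lact_closed, where f = f]
  have f': "\<And>x. x \<in> carrier X \<Longrightarrow> additive Y Z (f x)"
    "\<And>y. y \<in> carrier Y \<Longrightarrow> additive X Z (\<lambda>x. f x y)"
    "\<And>x s y. x \<in> carrier X \<Longrightarrow> s \<in> carrier S \<Longrightarrow> y \<in> carrier Y \<Longrightarrow> f (ract X x s) y = f x (lact Y s y)"
    using f unfolding balanced_map_def by blast+
  have "tensor_lift Z f \<in> hom (add_monoid (tensor S X Y)) (add_monoid Z)"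
    by (rule U(1)) (simp_all add: f'(3) additive_closed[OF f'(1)] additive_add[OF f'(1)] additive_add[OF f'(2)])
  then show "additive (tensor S X Y) Z (tensor_lift Z f)"
    using Z tensor_abelian_group by (auto simp: additive_def hom_def)
  show "tensor_lift Z f (tens S X Y x y) = f x y" if "x \<in> carrier X" "y \<in> carrier Y" for x y
    by (rule U(2)) (simp_all add: that f'(3) additive_closed[OF f'(1)] additive_add[OF f'(1)] additive_add[OF f'(2)])
qed

lemmas lift_tens = lift_additive(2)
lemmas lift_closed = additive_closed[OF lift_additive(1)]

text \<open>Uniqueness in the universal property of the tensor product.\<close>

lemma lift_eqI:
  assumes "balanced_map S X Y Z f" "additive (tensor S X Y) Z h"
    and "\<And>x y. x \<in> carrier X \<Longrightarrow> y \<in> carrier Y \<Longrightarrow> h (tens S X Y x y) = f x y"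
    and "z \<in> carrier (tensor S X Y)"
  shows "h z = tensor_lift Z f z"
  by (rule additive_eq_on_tens[OF assms(2) lift_additive(1)[OF assms(1)] _ assms(4)])
    (simp add: assms(3) lift_tens[OF assms(1)])

text \<open>
  If \<open>z = \<Sum> x\<^sub>1 \<otimes> x\<^sub>2\<close> then \<open>tensor_lift Z f z\<close> is \<open>\<Sum> f x\<^sub>1 x\<^sub>2\<close>.  Calculations with such sums
  consist in moving additive maps into the sum, by the next lemma, and in rewriting the summand,
  by \<open>lift_cong\<close>.
\<close>

lemma lift_comp:
  assumes f: "balanced_map S X Y Z f" and h: "additive Z Z' h" and z: "z \<in> carrier (tensor S X Y)"
  shows "h (tensor_lift Z f z) = tensor_lift Z' (\<lambda>x y. h (f x y)) z"
  by (rule lift_eqI[OF balanced_map_comp[OF f h] additive_comp[OF lift_additive(1)[OF f] h] _ z])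
    (simp add: lift_tens[OF f])

lemma lift_cong:
  assumes f: "balanced_map S X Y Z f"
    and eq: "\<And>x y. x \<in> carrier X \<Longrightarrow> y \<in> carrier Y \<Longrightarrow> f x y = g x y"
    and z: "z \<in> carrier (tensor S X Y)"
  shows "tensor_lift Z f z = tensor_lift Z g z"
proof -
  have "balanced_map S X Y Z g"
    using f ract_closed lact_closed X.a_closed Y.a_closed unfolding balanced_map_def additive_def Pi_iff
    by (simp add: eq[symmetric])
  then show ?thesis
    by (rule lift_eqI[OF _ lift_additive(1)[OF f] _ z]) (simp add: lift_tens[OF f] eq)
qed

text \<open>
  In iterated sums the inner one has to be additive in the variables of the outer one.
\<close>

lemma lift_param_additive:
  assumes P: "abelian_group P" and f: "\<And>p. p \<in> carrier P \<Longrightarrow> balanced_map S X Y Z (f p)"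
    and add: "\<And>x y. x \<in> carrier X \<Longrightarrow> y \<in> carrier Y \<Longrightarrow> additive P Z (\<lambda>p. f p x y)"
    and z: "z \<in> carrier (tensor S X Y)"
  shows "additive P Z (\<lambda>p. tensor_lift Z (f p) z)"
proof (rule additiveI)
  interpret P: abelian_group P by fact
  show "abelian_group P" by fact
  show "abelian_group Z" by (rule additive_range[OF lift_additive(1)[OF f[OF P.zero_closed]]])
  fix p p' assume p: "p \<in> carrier P" "p' \<in> carrier P"
  show "tensor_lift Z (f p) z \<in> carrier Z" by (rule lift_closed[OF f[OF p(1)] z])
  show "tensor_lift Z (f (p \<oplus>\<^bsub>P\<^esub> p')) z = tensor_lift Z (f p) z \<oplus>\<^bsub>Z\<^esub> tensor_lift Z (f p') z"
    by (rule lift_eqI[OF f[OF P.a_closed[OF p]] additive_plus[OF lift_additive(1)[OF f[OF p(1)]]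
          lift_additive(1)[OF f[OF p(2)]]] _ z, symmetric])
      (simp add: lift_tens f p additive_add[OF add])
qed

lemma tensor_map_balanced:
  assumes f: "additive X' X f" and g: "additive Y' Y g"
    and fs: "\<And>x s. x \<in> carrier X' \<Longrightarrow> s \<in> carrier S \<Longrightarrow> f (ract X' x s) = ract X (f x) s"
    and gs: "\<And>s y. s \<in> carrier S \<Longrightarrow> y \<in> carrier Y' \<Longrightarrow> g (lact Y' s y) = lact Y s (g y)"
  shows "balanced_map S X' Y' (tensor S X Y) (\<lambda>u v. tens S X Y (f u) (g v))"
proof (rule balanced_mapI)
  note t = tens_balanced_map[unfolded balanced_map_def]
  show "additive Y' (tensor S X Y) (\<lambda>v. tens S X Y (f x) (g v))" if "x \<in> carrier X'" for x
    using t additive_closed[OF f that] by (blast intro: additive_comp[OF g])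
  show "additive X' (tensor S X Y) (\<lambda>u. tens S X Y (f u) (g y))" if "y \<in> carrier Y'" for y
    using t additive_closed[OF g that] by (intro additive_comp[OF f, of _ "\<lambda>x. tens S X Y x (g y)"]) blast
qed (simp add: fs gs tens_balanced additive_closed[OF f] additive_closed[OF g])

end

text \<open>
  The outer actions on \<open>X \<otimes>\<^sub>S Y\<close> are well defined since on each factor the outer operators commute
  with those of \<open>S\<close>.
\<close>

lemma tensor_bi_operators:
  assumes X: "bi_operators L (carrier S) X" and Y: "bi_operators (carrier S) P Y"
  shows "bi_operators L P (tensor S X Y)"
    and "\<And>l x y. l \<in> L \<Longrightarrow> x \<in> carrier X \<Longrightarrow> y \<in> carrier Y \<Longrightarrow>
       lact (tensor S X Y) l (tens S X Y x y) = tens S X Y (lact X l x) y"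
    and "\<And>r x y. r \<in> P \<Longrightarrow> x \<in> carrier X \<Longrightarrow> y \<in> carrier Y \<Longrightarrow>
       ract (tensor S X Y) (tens S X Y x y) r = tens S X Y x (ract Y y r)"
proof -
  interpret tensor_product S X Y
    by (rule tensor_product.intro[OF bi_operators_right[OF X] bi_operators_left[OF Y]])
  let ?T = "tensor S X Y"
  have T: "tensor_lift (tensor_group S X Y) = tensor_lift ?T"
    by (intro ext, rule fun_cong[OF tensor_lift_transfer[OF tensor_group_same_group]])
  have l: "lact ?T l = tensor_lift ?T (\<lambda>x y. tens S X Y (lact X l x) y)" for l
    unfolding T[symmetric] by (simp add: tensor_def)
  have r: "(\<lambda>z. ract ?T z r) = tensor_lift ?T (\<lambda>x y. tens S X Y x (ract Y y r))" for r
    unfolding T[symmetric] by (simp add: tensor_def)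
  have tens: "additive Y ?T (tens S X Y x)" if "x \<in> carrier X" for x
    using tens_balanced_map that unfolding balanced_map_def by blast
  have tens': "additive X ?T (\<lambda>x. tens S X Y x y)" if "y \<in> carrier Y" for y
    using tens_balanced_map that unfolding balanced_map_def by blast
  have bl: "balanced_map S X Y ?T (\<lambda>x y. tens S X Y (lact X l x) y)" if "l \<in> L" for l
    by (intro balanced_mapI tens additive_comp[OF bi_operators_lact[OF X that] tens'])
      (simp_all add: bi_operators_commute[OF X that, symmetric] additive_closed[OF bi_operators_lact[OF X that]] tens_balanced)
  have br: "balanced_map S X Y ?T (\<lambda>x y. tens S X Y x (ract Y y r))" if "r \<in> P" for r
    by (intro balanced_mapI tens' additive_comp[OF bi_operators_ract[OF Y that] tens])
      (simp_all add: bi_operators_commute[OF Y _ that] additive_closed[OF bi_operators_ract[OF Y that]] tens_balanced)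
  show lt: "lact ?T l (tens S X Y x y) = tens S X Y (lact X l x) y"
    if "l \<in> L" "x \<in> carrier X" "y \<in> carrier Y" for l x y
    unfolding l by (rule lift_tens[OF bl that(2,3)]) fact
  show rt: "ract ?T (tens S X Y x y) r = tens S X Y x (ract Y y r)"
    if "r \<in> P" "x \<in> carrier X" "y \<in> carrier Y" for r x y
    using fun_cong[OF r, of "tens S X Y x y" r] lift_tens[OF br that(2,3)] that by simp
  have la: "additive ?T ?T (lact ?T l)" if "l \<in> L" for l
    unfolding l by (rule lift_additive(1)[OF bl[OF that]])
  have ra: "additive ?T ?T (\<lambda>z. ract ?T z r)" if "r \<in> P" for r
    unfolding r by (rule lift_additive(1)[OF br[OF that]])
  have "ract ?T (lact ?T l z) r = lact ?T l (ract ?T z r)" if "l \<in> L" "r \<in> P" "z \<in> carrier ?T" for l r z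
    by (rule additive_eq_on_tens[where g = "\<lambda>z. ract ?T (lact ?T l z) r" and h = "\<lambda>z. lact ?T l (ract ?T z r)",
          OF additive_comp[OF la[OF that(1)] ra[OF that(2)]] additive_comp[OF ra[OF that(2)] la[OF that(1)]] _ that(3)])
      (simp_all add: that lt rt additive_closed[OF bi_operators_lact[OF X that(1)]]
        additive_closed[OF bi_operators_ract[OF Y that(2)]])
  then show "bi_operators L P ?T"
    by (simp add: bi_operators_def la ra tensor_abelian_group)
qed


text \<open>
  The associator is an iterated lift.  It is balanced in its outer arguments because
  \<open>x \<otimes> (y s \<otimes> z) = x \<otimes> (y \<otimes> s z)\<close>.
\<close>

lemma tensor_assoc_additive:
  assumes X: "bi_operators {} (carrier S) X" and Y: "bi_operators (carrier S) (carrier S) Y"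
    and Z: "bi_operators (carrier S) {} Z"
  defines "T \<equiv> tensor S X (tensor S Y Z)"
  shows "additive (tensor S (tensor S X Y) Z) T (tensor_assoc S X Y Z)"
    and "\<And>z. z \<in> carrier Z \<Longrightarrow> balanced_map S X Y T (\<lambda>x y. tens S X (tensor S Y Z) x (tens S Y Z y z))"
    and "\<And>c z. c \<in> carrier (tensor S X Y) \<Longrightarrow> z \<in> carrier Z \<Longrightarrow>
       tensor_assoc S X Y Z (tens S (tensor S X Y) Z c z) =
       tensor_lift T (\<lambda>x y. tens S X (tensor S Y Z) x (tens S Y Z y z)) c"
proof -
  interpret XY: tensor_product S X Y by (rule tensor_product.intro[OF X bi_operators_left[OF Y]])
  interpret YZ: tensor_product S Y Z by (rule tensor_product.intro[OF bi_operators_right[OF Y] Z])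
  note XYo = tensor_bi_operators[OF X Y] and YZo = tensor_bi_operators[OF Y Z]
  interpret XY_Z: tensor_product S "tensor S X Y" Z by (rule tensor_product.intro[OF XYo(1) Z])
  interpret X_YZ: tensor_product S X "tensor S Y Z" by (rule tensor_product.intro[OF X YZo(1)])
  let ?t = "\<lambda>z x y. tens S X (tensor S Y Z) x (tens S Y Z y z)"
  have yz: "additive Y (tensor S Y Z) (\<lambda>y. tens S Y Z y z)" if "z \<in> carrier Z" for z
    using YZ.tens_balanced_map that unfolding balanced_map_def by blast
  have yz': "additive Z (tensor S Y Z) (tens S Y Z y)" if "y \<in> carrier Y" for y
    using YZ.tens_balanced_map that unfolding balanced_map_def by blast
  have x_yz: "additive (tensor S Y Z) T (tens S X (tensor S Y Z) x)" if "x \<in> carrier X" for x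
    using X_YZ.tens_balanced_map that unfolding balanced_map_def T_def by blast
  show b: "balanced_map S X Y T (?t z)" if z: "z \<in> carrier Z" for z
    unfolding T_def
  proof (rule X_YZ.tensor_map_balanced[OF additive_ident yz[OF z]])
    show "tens S Y Z (lact Y s y) z = lact (tensor S Y Z) s (tens S Y Z y z)"
      if "s \<in> carrier S" "y \<in> carrier Y" for s y by (rule YZo(2)[symmetric]; fact)
  qed (simp_all add: XY.X.abelian_group_axioms)
  have B: "balanced_map S (tensor S X Y) Z T (\<lambda>c z. tensor_lift T (?t z) c)"
  proof (rule balanced_mapI)
    show "additive Z T (\<lambda>z. tensor_lift T (?t z) c)" if c: "c \<in> carrier (tensor S X Y)" for c
      by (rule XY.lift_param_additive[OF YZ.Y.abelian_group_axioms b _ c])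
        (simp_all add: additive_comp[OF yz' x_yz])
    show "additive (tensor S X Y) T (tensor_lift T (?t z))" if "z \<in> carrier Z" for z
      by (rule XY.lift_additive(1)[OF b[OF that]])
    show "tensor_lift T (?t z) (ract (tensor S X Y) c s) = tensor_lift T (?t (lact Z s z)) c"
      if c: "c \<in> carrier (tensor S X Y)" and s: "s \<in> carrier S" and z: "z \<in> carrier Z" for c s z
      by (rule XY.lift_eqI[OF b[OF YZ.lact_closed[OF s z]] additive_comp[OF bi_operators_ract[OF XYo(1) s]
              XY.lift_additive(1)[OF b[OF z]]] _ c])
        (simp add: XYo(3) s z XY.lift_tens[OF b[OF z]] YZ.ract_closed YZ.tens_balanced)
  qed
  have assoc: "tensor_assoc S X Y Z = tensor_lift T (\<lambda>c z. tensor_lift T (?t z) c)"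
    by (simp add: tensor_assoc_def T_def Let_def)
  show "additive (tensor S (tensor S X Y) Z) T (tensor_assoc S X Y Z)"
    unfolding assoc by (rule XY_Z.lift_additive(1)[OF B])
  show "tensor_assoc S X Y Z (tens S (tensor S X Y) Z c z) = tensor_lift T (?t z) c"
    if "c \<in> carrier (tensor S X Y)" "z \<in> carrier Z" for c z
    unfolding assoc by (rule XY_Z.lift_tens[OF B that])
qed


section \<open>Direct sums, direct summands and groups of homomorphisms\<close>

lemma bimod_homD:
  assumes "bimod_hom L P X Y f"
  shows "\<And>x. x \<in> carrier X \<Longrightarrow> f x \<in> carrier Y"
    and "\<And>x x'. x \<in> carrier X \<Longrightarrow> x' \<in> carrier X \<Longrightarrow> f (x \<oplus>\<^bsub>X\<^esub> x') = f x \<oplus>\<^bsub>Y\<^esub> f x'"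
    and "\<And>l x. l \<in> L \<Longrightarrow> x \<in> carrier X \<Longrightarrow> f (lact X l x) = lact Y l (f x)"
    and "\<And>r x. r \<in> P \<Longrightarrow> x \<in> carrier X \<Longrightarrow> f (ract X x r) = ract Y (f x) r"
  using assms by (auto simp: bimod_hom_def)

lemma pow_bimod_simps [simp]:
  "carrier (pow_bimod n X) = {..<n} \<rightarrow>\<^sub>E carrier X"
  "v \<oplus>\<^bsub>pow_bimod n X\<^esub> w = (\<lambda>i\<in>{..<n}. v i \<oplus>\<^bsub>X\<^esub> w i)"
  "\<zero>\<^bsub>pow_bimod n X\<^esub> = (\<lambda>i\<in>{..<n}. \<zero>\<^bsub>X\<^esub>)"
  "lact (pow_bimod n X) l v = (\<lambda>i\<in>{..<n}. lact X l (v i))"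
  "ract (pow_bimod n X) v r = (\<lambda>i\<in>{..<n}. ract X (v i) r)"
  by (simp_all add: pow_bimod_def)

lemma pow_bimod_component: "v \<in> {..<n} \<rightarrow>\<^sub>E carrier X \<Longrightarrow> i < n \<Longrightarrow> v i \<in> carrier X"
  by auto

lemma abelian_group_pow_bimod:
  assumes "abelian_group X" shows "abelian_group (pow_bimod n X)"
proof -
  interpret abelian_group X by fact
  show ?thesis
  proof (rule abelian_groupI)
    fix v assume "v \<in> carrier (pow_bimod n X)"
    then have "(\<lambda>i\<in>{..<n}. \<ominus>\<^bsub>X\<^esub> v i) \<in> carrier (pow_bimod n X)"
      "(\<lambda>i\<in>{..<n}. \<ominus>\<^bsub>X\<^esub> v i) \<oplus>\<^bsub>pow_bimod n X\<^esub> v = \<zero>\<^bsub>pow_bimod n X\<^esub>"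
      by (simp_all add: l_neg pow_bimod_component cong: restrict_cong)
    then show "\<exists>w\<in>carrier (pow_bimod n X). w \<oplus>\<^bsub>pow_bimod n X\<^esub> v = \<zero>\<^bsub>pow_bimod n X\<^esub>" by blast
  next
    show "\<zero>\<^bsub>pow_bimod n X\<^esub> \<oplus>\<^bsub>pow_bimod n X\<^esub> v = v" if "v \<in> carrier (pow_bimod n X)" for v
      using that by (intro extensionalityI[of _ "{..<n}"]) (simp_all add: pow_bimod_component PiE_iff)
  next
    show "v \<oplus>\<^bsub>pow_bimod n X\<^esub> w = w \<oplus>\<^bsub>pow_bimod n X\<^esub> v"
      if "v \<in> carrier (pow_bimod n X)" "w \<in> carrier (pow_bimod n X)" for v w
      using that unfolding pow_bimod_simps by (intro restrict_ext a_comm) (simp_all add: pow_bimod_component)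
  qed (simp_all add: pow_bimod_component a_assoc cong: restrict_cong)
qed

lemma pow_bimod_operators:
  assumes X: "bi_operators L P X" shows "bi_operators L P (pow_bimod n X)"
proof -
  have g: "abelian_group (pow_bimod n X)"
    by (rule abelian_group_pow_bimod[OF bi_operators_group[OF X]])
  have l: "additive X X (lact X l)" if "l \<in> L" for l by (rule bi_operators_lact[OF X that])
  have r: "additive X X (\<lambda>x. ract X x r)" if "r \<in> P" for r by (rule bi_operators_ract[OF X that])
  have "additive (pow_bimod n X) (pow_bimod n X) (lact (pow_bimod n X) q)" if "q \<in> L" for q
    by (rule additiveI[OF g g])
      (simp_all add: pow_bimod_component additive_closed[OF l[OF that]] additive_add[OF l[OF that]] cong: restrict_cong)
  moreover have "additive (pow_bimod n X) (pow_bimod n X) (\<lambda>v. ract (pow_bimod n X) v q)" if "q \<in> P" for q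
    by (rule additiveI[OF g g])
      (simp_all add: pow_bimod_component additive_closed[OF r[OF that]] additive_add[OF r[OF that]] cong: restrict_cong)
  ultimately show ?thesis unfolding bi_operators_def
    using g by (simp add: pow_bimod_component bi_operators_commute[OF X] cong: restrict_cong)
qed

definition unit_vec :: "nat \<Rightarrow> ('l, 'r, 'x) bimod \<Rightarrow> nat \<Rightarrow> 'x \<Rightarrow> nat \<Rightarrow> 'x" where
  "unit_vec n X i x = (\<lambda>j\<in>{..<n}. if j = i then x else \<zero>\<^bsub>X\<^esub>)"

lemma unit_vec_closed:
  assumes "abelian_group X" "x \<in> carrier X" shows "unit_vec n X i x \<in> carrier (pow_bimod n X)"
proof -
  interpret abelian_group X by fact
  show ?thesis using assms(2) by (auto simp: unit_vec_def)
qed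

lemma additive_pow_bimod_sum:
  assumes p: "additive (pow_bimod n X) Z p" and X: "abelian_group X" and v: "v \<in> carrier (pow_bimod n X)"
  shows "p v = (\<Oplus>\<^bsub>Z\<^esub>i\<in>{..<n}. p (unit_vec n X i (v i)))"
proof -
  interpret X: abelian_group X by fact
  interpret Z: abelian_group Z by (rule additive_range[OF p])
  have vi: "v i \<in> carrier X" if "i < n" for i using v that by auto
  \<comment> \<open>Truncate \<open>v\<close> to its first \<open>k\<close> coordinates.\<close>
  have "p (\<lambda>j\<in>{..<n}. if j < k then v j else \<zero>\<^bsub>X\<^esub>) = (\<Oplus>\<^bsub>Z\<^esub>i\<in>{..<k}. p (unit_vec n X i (v i)))" if "k \<le> n" for k
    using that
  proof (induction k)
    case 0
    show ?case using additive_zero[OF p] by (simp add: restrict_def)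
  next
    case (Suc k)
    let ?w = "\<lambda>k. \<lambda>j\<in>{..<n}. if j < k then v j else \<zero>\<^bsub>X\<^esub>"
    have w: "?w k \<in> carrier (pow_bimod n X)" using vi by auto
    have u: "unit_vec n X i (v i) \<in> carrier (pow_bimod n X)" if "i < n" for i
      by (rule unit_vec_closed[OF X vi[OF that]])
    have "?w (Suc k) = unit_vec n X k (v k) \<oplus>\<^bsub>pow_bimod n X\<^esub> ?w k"
      using Suc.prems vi by (auto simp: unit_vec_def fun_eq_iff less_Suc_eq)
    then have "p (?w (Suc k)) = p (unit_vec n X k (v k)) \<oplus>\<^bsub>Z\<^esub> p (?w k)"
      using additive_add[OF p u w, of k] Suc.prems by simp
    then show ?case using Suc additive_closed[OF p u] by (simp add: lessThan_Suc Pi_iff restrict_def)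
  qed
  from this[of n] have "p (\<lambda>j\<in>{..<n}. if j < n then v j else \<zero>\<^bsub>X\<^esub>) = (\<Oplus>\<^bsub>Z\<^esub>i\<in>{..<n}. p (unit_vec n X i (v i)))"
    by simp
  moreover have "(\<lambda>j\<in>{..<n}. if j < n then v j else \<zero>\<^bsub>X\<^esub>) = v"
    using v by (intro extensionalityI[of _ "{..<n}"]) (simp_all add: PiE_iff)
  ultimately show ?thesis by simp
qed

text \<open>
  The retraction sends \<open>\<phi>(x) + v\<close>, where \<open>v\<close> lies in the complement \<open>V\<close>, to \<open>x\<close>.  This \<open>x\<close> is
  unique as \<open>\<phi>(X)\<close> meets \<open>V\<close> only in zero.
\<close>

lemma direct_summand_retraction:
  assumes X: "bi_operators L P X" and Y: "bi_operators L P Y" and ds: "direct_summand L P X Y"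
  obtains \<phi> p where "bimod_hom L P X Y \<phi>" "bimod_hom L P Y X p" "\<And>x. x \<in> carrier X \<Longrightarrow> p (\<phi> x) = x"
proof -
  interpret X: abelian_group X by (rule bi_operators_group[OF X])
  interpret Y: abelian_group Y by (rule bi_operators_group[OF Y])
  obtain U V \<phi> where U: "sub_bimod L P U Y" and V: "sub_bimod L P V Y"
    and UV: "U \<inter> V = {\<zero>\<^bsub>Y\<^esub>}" "U <+>\<^bsub>Y\<^esub> V = carrier Y"
    and \<phi>: "bimod_hom L P X Y \<phi>" "bij_betw \<phi> (carrier X) U"
    using ds unfolding direct_summand_def by auto
  interpret U: subgroup U "add_monoid Y" using U by (simp add: sub_bimod_def)
  interpret V: subgroup V "add_monoid Y" using V by (simp add: sub_bimod_def)
  note h = bimod_homD[OF \<phi>(1)]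
  have a\<phi>: "additive X Y \<phi>" by (rule bimod_hom_additive[OF \<phi>(1)]) unfold_locales
  have \<phi>U: "\<phi> x \<in> U" if "x \<in> carrier X" for x using \<phi>(2) that by (auto simp: bij_betw_def)
  have Vc: "v \<in> carrier Y" if "v \<in> V" for v using V.mem_carrier[OF that] by simp
  define p where "p y = (THE x. x \<in> carrier X \<and> (\<exists>v\<in>V. y = \<phi> x \<oplus>\<^bsub>Y\<^esub> v))" for y
  have p: "p (\<phi> x \<oplus>\<^bsub>Y\<^esub> v) = x" if x: "x \<in> carrier X" and v: "v \<in> V" for x v
    unfolding p_def
  proof (rule the_equality)
    fix x' assume x': "x' \<in> carrier X \<and> (\<exists>v'\<in>V. \<phi> x \<oplus>\<^bsub>Y\<^esub> v = \<phi> x' \<oplus>\<^bsub>Y\<^esub> v')"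
    then obtain v' where v': "v' \<in> V" "\<phi> x \<oplus>\<^bsub>Y\<^esub> v = \<phi> x' \<oplus>\<^bsub>Y\<^esub> v'" by blast
    have c: "\<phi> x \<in> carrier Y" "\<phi> x' \<in> carrier Y" "v \<in> carrier Y" "v' \<in> carrier Y" using h(1) x x' Vc v v' by auto
    have "\<phi> (x \<oplus>\<^bsub>X\<^esub> \<ominus>\<^bsub>X\<^esub> x') = \<phi> x \<oplus>\<^bsub>Y\<^esub> \<ominus>\<^bsub>Y\<^esub> \<phi> x'"
      using x x' by (simp add: h(2) additive_neg[OF a\<phi>])
    also have "\<dots> = v' \<oplus>\<^bsub>Y\<^esub> \<ominus>\<^bsub>Y\<^esub> v"
    proof -
      have "\<phi> x = \<phi> x \<oplus>\<^bsub>Y\<^esub> v \<oplus>\<^bsub>Y\<^esub> \<ominus>\<^bsub>Y\<^esub> v" using c by (simp add: Y.a_assoc Y.r_neg)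
      also have "\<dots> = \<phi> x' \<oplus>\<^bsub>Y\<^esub> (v' \<oplus>\<^bsub>Y\<^esub> \<ominus>\<^bsub>Y\<^esub> v)" using v'(2) c by (simp add: Y.a_assoc)
      finally have "\<phi> x \<oplus>\<^bsub>Y\<^esub> \<ominus>\<^bsub>Y\<^esub> \<phi> x' = \<ominus>\<^bsub>Y\<^esub> \<phi> x' \<oplus>\<^bsub>Y\<^esub> (\<phi> x' \<oplus>\<^bsub>Y\<^esub> (v' \<oplus>\<^bsub>Y\<^esub> \<ominus>\<^bsub>Y\<^esub> v))"
        using c Y.a_comm[of "\<phi> x" "\<ominus>\<^bsub>Y\<^esub> \<phi> x'"] by simp
      then show ?thesis using c by (simp add: Y.r_neg1)
    qed
    also have "\<dots> \<in> V" using V.m_closed[OF v'(1) V.m_inv_closed[OF v]] by (simp add: a_inv_def)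
    finally have "\<phi> (x \<oplus>\<^bsub>X\<^esub> \<ominus>\<^bsub>X\<^esub> x') \<in> U \<inter> V" using \<phi>U x x' by simp
    then have "\<phi> (x \<oplus>\<^bsub>X\<^esub> \<ominus>\<^bsub>X\<^esub> x') = \<phi> \<zero>\<^bsub>X\<^esub>" using UV additive_zero[OF a\<phi>] by simp
    then have "x \<oplus>\<^bsub>X\<^esub> \<ominus>\<^bsub>X\<^esub> x' = \<zero>\<^bsub>X\<^esub>" using \<phi>(2) x x' by (auto simp: bij_betw_def inj_on_def)
    then show "x' = x" using x x' by (metis X.a_inv_closed X.minus_equality X.minus_minus)
  qed (use that in blast)
  have dec: "\<exists>x\<in>carrier X. \<exists>v\<in>V. y = \<phi> x \<oplus>\<^bsub>Y\<^esub> v" if "y \<in> carrier Y" for y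
  proof -
    have "y \<in> U <+>\<^bsub>Y\<^esub> V" using UV that by simp
    then obtain u v where "u \<in> U" "v \<in> V" "y = u \<oplus>\<^bsub>Y\<^esub> v" unfolding set_add_def' by blast
    then show ?thesis using \<phi>(2) by (auto simp: bij_betw_def)
  qed
  have "bimod_hom L P Y X p"
    unfolding bimod_hom_def
  proof (intro conjI ballI Pi_I)
    fix y assume "y \<in> carrier Y"
    then obtain x v where y: "x \<in> carrier X" "v \<in> V" "y = \<phi> x \<oplus>\<^bsub>Y\<^esub> v" using dec by blast
    show "p y \<in> carrier X" using y p by simp
    show "p (lact Y l y) = lact X l (p y)" if l: "l \<in> L" for l
    proof -
      have "lact Y l y = \<phi> (lact X l x) \<oplus>\<^bsub>Y\<^esub> lact Y l v"
        using y l h Vc by (simp add: additive_add[OF bi_operators_lact[OF Y l]])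
      moreover have "lact Y l v \<in> V" using V y l by (simp add: sub_bimod_def)
      ultimately show ?thesis using p y additive_closed[OF bi_operators_lact[OF X l]] by simp
    qed
    show "p (ract Y y r) = ract X (p y) r" if r: "r \<in> P" for r
    proof -
      have "ract Y y r = \<phi> (ract X x r) \<oplus>\<^bsub>Y\<^esub> ract Y v r"
        using y r h Vc by (simp add: additive_add[OF bi_operators_ract[OF Y r]])
      moreover have "ract Y v r \<in> V" using V y r by (simp add: sub_bimod_def)
      ultimately show ?thesis using p y additive_closed[OF bi_operators_ract[OF X r]] by simp
    qed
    fix y' assume "y' \<in> carrier Y"
    then obtain x' v' where y': "x' \<in> carrier X" "v' \<in> V" "y' = \<phi> x' \<oplus>\<^bsub>Y\<^esub> v'" using dec by blast
    have "y \<oplus>\<^bsub>Y\<^esub> y' = \<phi> (x \<oplus>\<^bsub>X\<^esub> x') \<oplus>\<^bsub>Y\<^esub> (v \<oplus>\<^bsub>Y\<^esub> v')"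
      using y y' h Vc by (simp add: Y.a_assoc Y.a_lcomm)
    moreover have "v \<oplus>\<^bsub>Y\<^esub> v' \<in> V" using V.m_closed[of v v'] y y' by simp
    ultimately show "p (y \<oplus>\<^bsub>Y\<^esub> y') = p y \<oplus>\<^bsub>X\<^esub> p y'" using p y y' by simp
  qed
  moreover have "p (\<phi> x) = x" if "x \<in> carrier X" for x
    using p[OF that V.one_closed] h(1)[OF that] by simp
  ultimately show ?thesis using that \<phi>(1) by blast
qed

text \<open>
  The kernel of \<open>p\<close> is a complement of \<open>\<phi>(X)\<close>, by \<open>y = \<phi>(p y) + (y - \<phi>(p y))\<close>.
\<close>

lemma retraction_direct_summand:
  assumes X: "bi_operators L P X" and Y: "bi_operators L P Y"
    and \<phi>: "bimod_hom L P X Y \<phi>" and p: "bimod_hom L P Y X p"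
    and p\<phi>: "\<And>x. x \<in> carrier X \<Longrightarrow> p (\<phi> x) = x"
  shows "direct_summand L P X Y"
proof -
  interpret X: abelian_group X by (rule bi_operators_group[OF X])
  interpret Y: abelian_group Y by (rule bi_operators_group[OF Y])
  note h = bimod_homD[OF \<phi>] and k = bimod_homD[OF p]
  have a\<phi>: "additive X Y \<phi>" by (rule bimod_hom_additive[OF \<phi>]) unfold_locales
  have ap: "additive Y X p" by (rule bimod_hom_additive[OF p]) unfold_locales
  let ?U = "\<phi> ` carrier X" and ?V = "{y \<in> carrier Y. p y = \<zero>\<^bsub>X\<^esub>}"
  have sub: "subgroup W (add_monoid Y)" if W: "W \<subseteq> carrier Y" "\<zero>\<^bsub>Y\<^esub> \<in> W"
    "\<And>x y. x \<in> W \<Longrightarrow> y \<in> W \<Longrightarrow> x \<oplus>\<^bsub>Y\<^esub> y \<in> W" "\<And>x. x \<in> W \<Longrightarrow> \<ominus>\<^bsub>Y\<^esub> x \<in> W" for W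
    using W by (intro subgroup.intro) (auto simp: a_inv_def)
  have "subgroup ?U (add_monoid Y)"
  proof (rule sub)
    show "\<zero>\<^bsub>Y\<^esub> \<in> ?U" using additive_zero[OF a\<phi>] X.zero_closed by (metis imageI)
  qed (auto simp: h(1) h(2)[symmetric] additive_neg[OF a\<phi>, symmetric])
  then have U: "sub_bimod L P ?U Y"
    using additive_closed[OF bi_operators_lact[OF X]] additive_closed[OF bi_operators_ract[OF X]]
    by (auto simp: sub_bimod_def h(3)[symmetric] h(4)[symmetric])
  have "subgroup ?V (add_monoid Y)"
    by (rule sub) (auto simp: k(2) additive_neg[OF ap] additive_zero[OF ap])
  then have V: "sub_bimod L P ?V Y"
    using additive_closed[OF bi_operators_lact[OF Y]] additive_closed[OF bi_operators_ract[OF Y]]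
      additive_zero[OF bi_operators_lact[OF X]] additive_zero[OF bi_operators_ract[OF X]]
    by (auto simp: sub_bimod_def k(3) k(4))
  have "y \<in> ?U <+>\<^bsub>Y\<^esub> ?V" if y: "y \<in> carrier Y" for y
  proof -
    have "y = \<phi> (p y) \<oplus>\<^bsub>Y\<^esub> (y \<oplus>\<^bsub>Y\<^esub> \<ominus>\<^bsub>Y\<^esub> \<phi> (p y))"
      using y h(1) k(1) by (simp add: Y.a_lcomm[of "\<phi> (p y)"] Y.r_neg)
    moreover have "p (y \<oplus>\<^bsub>Y\<^esub> \<ominus>\<^bsub>Y\<^esub> \<phi> (p y)) = \<zero>\<^bsub>X\<^esub>"
      using y h(1) k(1) by (simp add: k(2) additive_neg[OF ap] p\<phi> X.r_neg)
    moreover have "\<phi> (p y) \<in> ?U" "y \<oplus>\<^bsub>Y\<^esub> \<ominus>\<^bsub>Y\<^esub> \<phi> (p y) \<in> carrier Y"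
      using y h(1) k(1) by simp_all
    ultimately show ?thesis unfolding set_add_def' by (intro UN_I[of "\<phi> (p y)"] UN_I[of "y \<oplus>\<^bsub>Y\<^esub> \<ominus>\<^bsub>Y\<^esub> \<phi> (p y)"]) auto
  qed
  moreover have "?U <+>\<^bsub>Y\<^esub> ?V \<subseteq> carrier Y" unfolding set_add_def' by (auto simp: h(1))
  ultimately have UV: "?U <+>\<^bsub>Y\<^esub> ?V = carrier Y" by blast
  have inj: "inj_on \<phi> (carrier X)" by (rule inj_on_inverseI[of _ p]) (rule p\<phi>)
  have "?U \<inter> ?V = {\<zero>\<^bsub>Y\<^esub>}"
    using additive_zero[OF a\<phi>] additive_zero[OF ap] image_eqI[of "\<zero>\<^bsub>Y\<^esub>" \<phi> "\<zero>\<^bsub>X\<^esub>"]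
    by (auto simp: p\<phi>)
  then show ?thesis
    unfolding direct_summand_def
    by (intro exI[of _ ?U] exI[of _ ?V] exI[of _ \<phi>] conjI U V UV \<phi> bij_betw_imageI[OF inj refl])
qed

lemma hom_group_simps [simp]:
  "carrier (hom_group L P X Y) = {f \<in> extensional (carrier X). bimod_hom L P X Y f}"
  "add (hom_group L P X Y) f g = (\<lambda>x\<in>carrier X. f x \<oplus>\<^bsub>Y\<^esub> g x)"
  "\<zero>\<^bsub>hom_group L P X Y\<^esub> = (\<lambda>x\<in>carrier X. \<zero>\<^bsub>Y\<^esub>)"
  by (simp_all add: hom_group_def)

lemma bimod_hom_restrict:
  assumes "bi_operators L P X" "bimod_hom L P X Y f"
  shows "bimod_hom L P X Y (restrict f (carrier X))"
proof -
  interpret abelian_group X by (rule bi_operators_group[OF assms(1)])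
  show ?thesis
    using bimod_homD[OF assms(2)] additive_closed[OF bi_operators_lact[OF assms(1)]]
      additive_closed[OF bi_operators_ract[OF assms(1)]] by (simp add: bimod_hom_def)
qed

lemma abelian_group_hom_group:
  assumes X: "bi_operators L P X" and Y: "bi_operators L P Y"
  shows "abelian_group (hom_group L P X Y)"
proof -
  interpret X: abelian_group X by (rule bi_operators_group[OF X])
  interpret Y: abelian_group Y by (rule bi_operators_group[OF Y])
  note l = bi_operators_lact[OF Y] and r = bi_operators_ract[OF Y]
  have zero: "bimod_hom L P X Y (\<lambda>x. \<zero>\<^bsub>Y\<^esub>)"
    by (simp add: bimod_hom_def additive_zero[OF l] additive_zero[OF r])
  have add: "bimod_hom L P X Y (\<lambda>x. f x \<oplus>\<^bsub>Y\<^esub> g x)" if f: "bimod_hom L P X Y f" and g: "bimod_hom L P X Y g" for f g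
    using bimod_homD[OF f] bimod_homD[OF g]
    by (simp add: bimod_hom_def additive_add[OF l] additive_add[OF r] Y.a_assoc Y.a_lcomm)
  have neg: "bimod_hom L P X Y (\<lambda>x. \<ominus>\<^bsub>Y\<^esub> f x)" if f: "bimod_hom L P X Y f" for f
    using bimod_homD[OF f]
    by (simp add: bimod_hom_def additive_neg[OF l] additive_neg[OF r] Y.minus_add)
  show ?thesis
  proof (rule abelian_groupI)
    fix f assume f: "f \<in> carrier (hom_group L P X Y)"
    then have "restrict (\<lambda>x. \<ominus>\<^bsub>Y\<^esub> f x) (carrier X) \<in> carrier (hom_group L P X Y)"
      "restrict (\<lambda>x. \<ominus>\<^bsub>Y\<^esub> f x) (carrier X) \<oplus>\<^bsub>hom_group L P X Y\<^esub> f = \<zero>\<^bsub>hom_group L P X Y\<^esub>"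
      using bimod_homD(1)[of L P X Y f] by (simp_all add: bimod_hom_restrict[OF X neg] Y.l_neg cong: restrict_cong)
    then show "\<exists>g\<in>carrier (hom_group L P X Y). g \<oplus>\<^bsub>hom_group L P X Y\<^esub> f = \<zero>\<^bsub>hom_group L P X Y\<^esub>" by blast
  next
    fix f g k assume "f \<in> carrier (hom_group L P X Y)" "g \<in> carrier (hom_group L P X Y)"
      and k: "k \<in> carrier (hom_group L P X Y)"
    then have fg: "bimod_hom L P X Y f" "bimod_hom L P X Y g" "f \<in> extensional (carrier X)"
      by simp_all
    have c: "f x \<in> carrier Y" "g x \<in> carrier Y" "k x \<in> carrier Y" if "x \<in> carrier X" for x
      using fg k that by (auto intro: bimod_homD(1))
    show "f \<oplus>\<^bsub>hom_group L P X Y\<^esub> g \<in> carrier (hom_group L P X Y)"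
      using bimod_hom_restrict[OF X add[OF fg(1,2)]] by simp
    show "f \<oplus>\<^bsub>hom_group L P X Y\<^esub> g \<oplus>\<^bsub>hom_group L P X Y\<^esub> k =
        f \<oplus>\<^bsub>hom_group L P X Y\<^esub> (g \<oplus>\<^bsub>hom_group L P X Y\<^esub> k)"
      by (simp add: c Y.a_assoc cong: restrict_cong)
    show "f \<oplus>\<^bsub>hom_group L P X Y\<^esub> g = g \<oplus>\<^bsub>hom_group L P X Y\<^esub> f"
      unfolding hom_group_simps by (intro restrict_ext Y.a_comm c)
    show "\<zero>\<^bsub>hom_group L P X Y\<^esub> \<oplus>\<^bsub>hom_group L P X Y\<^esub> f = f"
      using fg(3) by (intro extensionalityI[of _ "carrier X"]) (simp_all add: c)
  next
    show "\<zero>\<^bsub>hom_group L P X Y\<^esub> \<in> carrier (hom_group L P X Y)"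
      using bimod_hom_restrict[OF X zero] by simp
  qed
qed


section \<open>Algebra extensions and their bimodule endomorphisms\<close>

locale assoc_algebra =
  fixes K :: "('k, 'q) ring_scheme" and A :: "('k, 'a) module" (structure)
  assumes k_algebra: "k_algebra K A"
begin

sublocale A: ring A using k_algebra by (simp add: k_algebra_def)
sublocale V: module K A using k_algebra by (simp add: k_algebra_def)

lemma smult_mult:
  "c \<in> carrier K \<Longrightarrow> x \<in> carrier A \<Longrightarrow> y \<in> carrier A \<Longrightarrow> (c \<odot> x) \<otimes> y = c \<odot> (x \<otimes> y)"
  "c \<in> carrier K \<Longrightarrow> x \<in> carrier A \<Longrightarrow> y \<in> carrier A \<Longrightarrow> x \<otimes> (c \<odot> y) = c \<odot> (x \<otimes> y)"
  using k_algebra by (simp_all add: k_algebra_def)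

lemma additive_left_mult: "x \<in> carrier A \<Longrightarrow> additive A A (\<lambda>y. x \<otimes> y)"
  by (intro additiveI A.abelian_group_axioms) (simp_all add: A.r_distr)

lemma additive_right_mult: "y \<in> carrier A \<Longrightarrow> additive A A (\<lambda>x. x \<otimes> y)"
  by (intro additiveI A.abelian_group_axioms) (simp_all add: A.l_distr)

lemma additive_smult: "c \<in> carrier K \<Longrightarrow> additive A A (\<lambda>x. c \<odot> x)"
  by (intro additiveI A.abelian_group_axioms) (simp_all add: V.smult_r_distr)

lemma reg_bimod_operators:
  assumes "L \<subseteq> carrier A" "P \<subseteq> carrier A" shows "bi_operators L P (reg_bimod A)"
  using assms A.abelian_group_axioms additive_left_mult additive_right_mult
  by (auto simp: bi_operators_def subset_iff A.m_assoc)

lemma subalgebra_k_algebra: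
  assumes "subalgebra_of K N A" shows "k_algebra K (A\<lparr>carrier := N\<rparr>)"
proof -
  have N: "subring N A" "\<And>c n. c \<in> carrier K \<Longrightarrow> n \<in> N \<Longrightarrow> c \<odot> n \<in> N"
    using assms by (auto simp: subalgebra_of_def)
  interpret N: ring "A\<lparr>carrier := N\<rparr>" by (rule A.subring_is_ring[OF N(1)])
  have sub: "n \<in> N \<Longrightarrow> n \<in> carrier A" for n using subringE(1)[OF N(1)] by blast
  have "module K (A\<lparr>carrier := N\<rparr>)"
    by (rule moduleI) (simp_all add: N sub V.smult_l_distr V.smult_r_distr V.smult_assoc1
        V.R.cring_axioms N.abelian_group_axioms)
  then show ?thesis
    using N.ring_axioms by (simp add: k_algebra_def smult_mult sub)
qed

end

locale algebra_extension = assoc_algebra K M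
  for K :: "('k, 'q) ring_scheme" and M :: "('k, 'm) module" (structure) +
  fixes N :: "'m set"
  assumes subalgebra: "subalgebra_of K N M"
begin

abbreviation R where "R \<equiv> cent_alg M N"
abbreviation E where "E \<equiv> bimod_End M N"
abbreviation Mreg where "Mreg \<equiv> reg_bimod M"
abbreviation MM where "MM \<equiv> MtensM M N"

lemma N_subring: "subring N M" and N_smult: "c \<in> carrier K \<Longrightarrow> n \<in> N \<Longrightarrow> c \<odot> n \<in> N"
  using subalgebra by (auto simp: subalgebra_of_def)

lemma N_carrier: "N \<subseteq> carrier M" by (rule subringE(1)[OF N_subring])
lemma N_closed [simp]: "n \<in> N \<Longrightarrow> n \<in> carrier M" using N_carrier by blast

lemma Mreg_operators: "L \<subseteq> carrier M \<Longrightarrow> P \<subseteq> carrier M \<Longrightarrow> bi_operators L P Mreg"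
  by (rule reg_bimod_operators)

sublocale MM: tensor_product "M\<lparr>carrier := N\<rparr>" Mreg Mreg
  by (intro tensor_product.intro) (simp_all add: Mreg_operators N_carrier)

lemmas MM_operators_tens = tensor_bi_operators[where S = "M\<lparr>carrier := N\<rparr>" and X = Mreg and Y = Mreg
    and L = "carrier M" and P = "carrier M", simplified, OF Mreg_operators Mreg_operators,
    OF subset_refl N_carrier N_carrier subset_refl, folded MtensM_def]

lemma MM_operators: "bi_operators (carrier M) (carrier M) MM"
  and MM_lact: "l \<in> carrier M \<Longrightarrow> x \<in> carrier M \<Longrightarrow> y \<in> carrier M \<Longrightarrow>
    lact MM l (tens (M\<lparr>carrier := N\<rparr>) Mreg Mreg x y) = tens (M\<lparr>carrier := N\<rparr>) Mreg Mreg (l \<otimes> x) y"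
  and MM_ract: "r \<in> carrier M \<Longrightarrow> x \<in> carrier M \<Longrightarrow> y \<in> carrier M \<Longrightarrow>
    ract MM (tens (M\<lparr>carrier := N\<rparr>) Mreg Mreg x y) r = tens (M\<lparr>carrier := N\<rparr>) Mreg Mreg x (y \<otimes> r)"
  using MM_operators_tens by simp_all

lemma centralizer_iff: "r \<in> carrier R \<longleftrightarrow> r \<in> carrier M \<and> (\<forall>n\<in>N. r \<otimes> n = n \<otimes> r)"
  by (simp add: cent_alg_def centralizer_of_def)

lemma R_simps [simp]: "mult R = mult M" "\<one>\<^bsub>R\<^esub> = \<one>" "add R = add M" "\<zero>\<^bsub>R\<^esub> = \<zero>" "smult R = smult M"
  by (simp_all add: cent_alg_def)

lemma R_closed [simp]: "r \<in> carrier R \<Longrightarrow> r \<in> carrier M"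
  by (simp add: centralizer_iff)

lemma R_commute: "r \<in> carrier R \<Longrightarrow> n \<in> N \<Longrightarrow> r \<otimes> n = n \<otimes> r"
  by (simp add: centralizer_iff)

lemma centralizer_subalgebra: "subalgebra_of K (centralizer_of M N) M"
  unfolding subalgebra_of_def
proof (intro conjI ballI A.subringI)
  fix h assume "h \<in> centralizer_of M N"
  then show "\<ominus> h \<in> centralizer_of M N"
    by (simp add: centralizer_of_def A.l_minus A.r_minus)
next
  fix h k assume "h \<in> centralizer_of M N" "k \<in> centralizer_of M N"
  then have hk: "h \<in> carrier M" "k \<in> carrier M" "\<And>n. n \<in> N \<Longrightarrow> h \<otimes> n = n \<otimes> h"
    "\<And>n. n \<in> N \<Longrightarrow> k \<otimes> n = n \<otimes> k" by (simp_all add: centralizer_of_def)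
  have "h \<otimes> k \<otimes> n = n \<otimes> (h \<otimes> k)" if "n \<in> N" for n
  proof -
    have "h \<otimes> k \<otimes> n = h \<otimes> n \<otimes> k" using hk(1,2) that by (simp add: A.m_assoc hk(4))
    then show ?thesis using hk(1,2) that by (simp add: A.m_assoc hk(3))
  qed
  then show "h \<otimes> k \<in> centralizer_of M N" using hk by (simp add: centralizer_of_def)
  show "h \<oplus> k \<in> centralizer_of M N"
    using hk by (simp add: centralizer_of_def A.l_distr A.r_distr)
qed (auto simp: centralizer_of_def smult_mult)

lemma R_k_algebra: "k_algebra K R"
  unfolding cent_alg_def by (rule subalgebra_k_algebra[OF centralizer_subalgebra])

sublocale R: assoc_algebra K R by (rule assoc_algebra.intro[OF R_k_algebra])

lemma E_carrier: "f \<in> carrier E \<longleftrightarrow> f \<in> extensional (carrier M) \<and> additive M M f \<and>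
    (\<forall>n\<in>N. \<forall>m\<in>carrier M. f (n \<otimes> m) = n \<otimes> f m \<and> f (m \<otimes> n) = f m \<otimes> n)"
  using A.abelian_group_axioms
  by (auto simp: bimod_End_def Let_def bimod_hom_def additive_def)

lemma E_simps:
  "\<zero>\<^bsub>E\<^esub> = (\<lambda>m\<in>carrier M. \<zero>)" "f \<oplus>\<^bsub>E\<^esub> g = (\<lambda>m\<in>carrier M. f m \<oplus> g m)"
  "\<one>\<^bsub>E\<^esub> = (\<lambda>m\<in>carrier M. m)" "f \<otimes>\<^bsub>E\<^esub> g = compose (carrier M) f g"
  "c \<odot>\<^bsub>E\<^esub> f = (\<lambda>m\<in>carrier M. c \<odot> f m)"
  by (simp_all add: bimod_End_def Let_def)

lemma E_apply [simp]:
  "m \<in> carrier M \<Longrightarrow> \<zero>\<^bsub>E\<^esub> m = \<zero>"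
  "m \<in> carrier M \<Longrightarrow> (f \<oplus>\<^bsub>E\<^esub> g) m = f m \<oplus> g m"
  "m \<in> carrier M \<Longrightarrow> \<one>\<^bsub>E\<^esub> m = m"
  "m \<in> carrier M \<Longrightarrow> (f \<otimes>\<^bsub>E\<^esub> g) m = f (g m)"
  "m \<in> carrier M \<Longrightarrow> (c \<odot>\<^bsub>E\<^esub> f) m = c \<odot> f m"
  by (simp_all add: E_simps compose_def)

lemma E_additive: "f \<in> carrier E \<Longrightarrow> additive M M f"
  and E_extensional: "f \<in> carrier E \<Longrightarrow> f \<in> extensional (carrier M)"
  and E_left_N: "f \<in> carrier E \<Longrightarrow> n \<in> N \<Longrightarrow> m \<in> carrier M \<Longrightarrow> f (n \<otimes> m) = n \<otimes> f m"
  and E_right_N: "f \<in> carrier E \<Longrightarrow> n \<in> N \<Longrightarrow> m \<in> carrier M \<Longrightarrow> f (m \<otimes> n) = f m \<otimes> n"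
  by (simp_all add: E_carrier)

lemma E_closed [simp]: "f \<in> carrier E \<Longrightarrow> m \<in> carrier M \<Longrightarrow> f m \<in> carrier M"
  by (rule additive_closed[OF E_additive])

lemma E_eqI: "f \<in> carrier E \<Longrightarrow> g \<in> carrier E \<Longrightarrow> (\<And>m. m \<in> carrier M \<Longrightarrow> f m = g m) \<Longrightarrow> f = g"
  by (rule extensionalityI[OF E_extensional E_extensional])

lemma E_restrictI:
  assumes "additive M M f"
    and "\<And>n m. n \<in> N \<Longrightarrow> m \<in> carrier M \<Longrightarrow> f (n \<otimes> m) = n \<otimes> f m"
    and "\<And>n m. n \<in> N \<Longrightarrow> m \<in> carrier M \<Longrightarrow> f (m \<otimes> n) = f m \<otimes> n"
  shows "(\<lambda>m\<in>carrier M. f m) \<in> carrier E"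
  unfolding E_carrier using assms
  by (auto simp: additive_add intro!: additiveI A.abelian_group_axioms additive_closed[OF assms(1)])

lemma E_k_algebra: "k_algebra K E"
proof -
  have "abelian_group (hom_group N N Mreg Mreg)"
    by (intro abelian_group_hom_group Mreg_operators N_carrier)
  then have E: "abelian_group E"
    by (rule iffD1[OF abelian_group_transfer, rotated]) (simp add: same_group_def bimod_End_def Let_def)
  interpret abelian_group E by (rule E)
  have one: "\<one>\<^bsub>E\<^esub> \<in> carrier E"
    unfolding E_simps by (rule E_restrictI) (simp_all add: additive_ident A.abelian_group_axioms)
  have mult: "f \<otimes>\<^bsub>E\<^esub> g \<in> carrier E" if "f \<in> carrier E" "g \<in> carrier E" for f g
    unfolding E_simps compose_def
    by (rule E_restrictI) (simp_all add: additive_comp[OF E_additive E_additive] E_left_N E_right_N that)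
  have smult: "c \<odot>\<^bsub>E\<^esub> f \<in> carrier E" if "c \<in> carrier K" "f \<in> carrier E" for c f
    unfolding E_simps
    by (rule E_restrictI) (simp_all add: additive_comp[OF E_additive additive_smult] E_left_N E_right_N that smult_mult)
  have ring: "ring E"
  proof (rule ringI[OF E])
    show "monoid E"
      by (rule monoidI) (auto simp: one mult intro!: E_eqI[OF _ _])
  qed (auto simp: mult additive_add[OF E_additive] intro!: E_eqI)
  have "module K E"
    by (rule moduleI[OF V.R.cring_axioms E])
      (auto simp: smult V.smult_l_distr V.smult_r_distr V.smult_assoc1 intro!: E_eqI)
  moreover have "(c \<odot>\<^bsub>E\<^esub> f) \<otimes>\<^bsub>E\<^esub> g = c \<odot>\<^bsub>E\<^esub> (f \<otimes>\<^bsub>E\<^esub> g)" 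
    if "c \<in> carrier K" "f \<in> carrier E" "g \<in> carrier E" for c f g
    by (rule E_eqI) (simp_all add: that smult mult)
  \<comment> \<open>Bimodule endomorphisms are \<open>K\<close>-linear because \<open>N\<close> contains \<open>K 1\<close>.\<close>
  moreover have "f (c \<odot> m) = c \<odot> f m" if "c \<in> carrier K" "f \<in> carrier E" "m \<in> carrier M" for c f m
  proof -
    have c: "c \<odot> \<one> \<in> N" using N_smult[OF that(1) subringE(3)[OF N_subring]] .
    have "f (c \<odot> m) = f ((c \<odot> \<one>) \<otimes> m)" using that by (simp add: smult_mult)
    also have "\<dots> = (c \<odot> \<one>) \<otimes> f m" by (rule E_left_N[OF that(2) c that(3)])
    also have "\<dots> = c \<odot> f m" using that by (simp add: smult_mult)
    finally show ?thesis .
  qed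
  then have "f \<otimes>\<^bsub>E\<^esub> (c \<odot>\<^bsub>E\<^esub> g) = c \<odot>\<^bsub>E\<^esub> (f \<otimes>\<^bsub>E\<^esub> g)" 
    if "c \<in> carrier K" "f \<in> carrier E" "g \<in> carrier E" for c f g
    by (intro E_eqI) (simp_all add: that smult mult)
  ultimately show ?thesis using ring by (simp add: k_algebra_def)
qed

sublocale E: assoc_algebra K E by (rule assoc_algebra.intro[OF E_k_algebra])

lemma E_sum_apply: 
  assumes "f \<in> I \<rightarrow> carrier E" "m \<in> carrier M"
  shows "(\<Oplus>\<^bsub>E\<^esub>i\<in>I. f i) m = (\<Oplus>i\<in>I. f i m)"
  using additive_sum[of E M "\<lambda>f. f m", OF _ assms(1)] assms(2) E.A.abelian_group_axioms A.abelian_group_axioms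
  by (simp add: additive_def)

lemma E_apply_additive: "m \<in> carrier M \<Longrightarrow> additive E M (\<lambda>f. f m)"
  using E.A.abelian_group_axioms A.abelian_group_axioms by (simp add: additive_def)

lemma E_smult: 
  assumes "f \<in> carrier E" "c \<in> carrier K" "m \<in> carrier M" shows "f (c \<odot> m) = c \<odot> f m"
  using fun_cong[OF E.smult_mult(2)[OF assms(2,1) E.A.one_closed], of m] assms by simp

lemma src_closed [simp]: "r \<in> carrier R \<Longrightarrow> End_src M r \<in> carrier E"
  unfolding End_src_def
proof (rule E_restrictI)
  fix n m assume r: "r \<in> carrier R" and n: "n \<in> N" and m: "m \<in> carrier M"
  have "r \<otimes> (n \<otimes> m) = (r \<otimes> n) \<otimes> m" using r n m by (simp add: A.m_assoc)
  also have "\<dots> = n \<otimes> (r \<otimes> m)" using r n m by (simp add: R_commute A.m_assoc)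
  finally show "r \<otimes> (n \<otimes> m) = n \<otimes> (r \<otimes> m)" .
qed (simp_all add: additive_left_mult A.m_assoc)

lemma tgt_closed [simp]: "r \<in> carrier R \<Longrightarrow> End_tgt M r \<in> carrier E"
  unfolding End_tgt_def
  by (rule E_restrictI) (simp_all add: additive_right_mult A.m_assoc R_commute)

lemma src_apply [simp]: "m \<in> carrier M \<Longrightarrow> End_src M r m = r \<otimes> m"
  and tgt_apply [simp]: "m \<in> carrier M \<Longrightarrow> End_tgt M r m = m \<otimes> r"
  by (simp_all add: End_src_def End_tgt_def)

lemma src_alg_hom: "alg_hom K R E (End_src M)"
  unfolding alg_hom_def
  by (intro conjI ballI ring_hom_memI E_eqI)
    (simp_all add: A.m_assoc A.l_distr smult_mult R.A.m_closed[simplified] R.A.a_closed[simplified]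
      R.V.smult_closed[simplified] R.A.one_closed[simplified])

lemma tgt_alg_hom: "alg_hom K (op_alg R) E (End_tgt M)"
  unfolding alg_hom_def
  by (intro conjI ballI ring_hom_memI E_eqI)
    (simp_all add: op_alg_def A.m_assoc A.r_distr smult_mult R.A.m_closed[simplified] R.A.a_closed[simplified]
      R.V.smult_closed[simplified] R.A.one_closed[simplified])

lemma src_tgt_commute:
  assumes "r \<in> carrier R" "r' \<in> carrier R"
  shows "End_src M r \<otimes>\<^bsub>E\<^esub> End_tgt M r' = End_tgt M r' \<otimes>\<^bsub>E\<^esub> End_src M r"
  by (rule E_eqI) (simp_all add: assms A.m_assoc)

end


section \<open>Quasi-bases of a depth two extension\<close>

lemma (in assoc_algebra) bgd_left_operators:
  "(\<And>r. r \<in> L \<Longrightarrow> s r \<in> carrier A) \<Longrightarrow> bi_operators L {} (bgd_bimod A s t)"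
  by (simp add: bi_operators_def bgd_bimod_def A.abelian_group_axioms additive_left_mult)

lemma (in assoc_algebra) bgd_right_operators:
  "(\<And>r. r \<in> P \<Longrightarrow> t r \<in> carrier A) \<Longrightarrow> bi_operators {} P (bgd_bimod A s t)"
  by (simp add: bi_operators_def bgd_bimod_def A.abelian_group_axioms additive_left_mult)

lemma (in assoc_algebra) bgd_operators:
  assumes "\<And>r. r \<in> L \<Longrightarrow> s r \<in> carrier A" "\<And>r. r \<in> P \<Longrightarrow> t r \<in> carrier A"
    and "\<And>r r'. r \<in> L \<Longrightarrow> r' \<in> P \<Longrightarrow> s r \<otimes> t r' = t r' \<otimes> s r"
  shows "bi_operators L P (bgd_bimod A s t)"
  using assms by (simp add: bi_operators_def bgd_bimod_def A.abelian_group_axioms additive_left_mult A.m_assoc[symmetric])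

context algebra_extension
begin

abbreviation tensM where "tensM \<equiv> tens (M\<lparr>carrier := N\<rparr>) Mreg Mreg"
abbreviation N_balanced where "N_balanced \<equiv> balanced_map (M\<lparr>carrier := N\<rparr>) Mreg Mreg M"

text \<open>
  The images of \<open>1\<close> under the \<open>N\<close>-\<open>N\<close>-bimodule maps \<open>M \<rightarrow> M \<otimes>\<^sub>N M\<close>.
\<close>

definition central :: "('m \<times> 'm \<Rightarrow>\<^sub>0 int) set \<Rightarrow> bool" where
  "central b \<longleftrightarrow> b \<in> carrier MM \<and> (\<forall>n\<in>N. lact MM n b = ract MM b n)"

lemma central_closed [simp]: "central b \<Longrightarrow> b \<in> carrier MM"
  by (simp add: central_def)

text \<open>
  Multiplying by \<open>m'\<close> from the right, respectively from the left, gives expansions of all elements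
  \<open>m \<otimes> m'\<close> and \<open>m' \<otimes> m\<close>.
\<close>

definition left_quasibasis ::
  "nat \<Rightarrow> (nat \<Rightarrow> ('m \<times> 'm \<Rightarrow>\<^sub>0 int) set) \<Rightarrow> (nat \<Rightarrow> 'm \<Rightarrow> 'm) \<Rightarrow> bool" where
  "left_quasibasis n b \<beta> \<longleftrightarrow> (\<forall>i<n. central (b i) \<and> \<beta> i \<in> carrier E) \<and>
     (\<forall>m\<in>carrier M. tensM m \<one> = (\<Oplus>\<^bsub>MM\<^esub>i\<in>{..<n}. ract MM (b i) (\<beta> i m)))"

definition right_quasibasis ::
  "nat \<Rightarrow> (nat \<Rightarrow> ('m \<times> 'm \<Rightarrow>\<^sub>0 int) set) \<Rightarrow> (nat \<Rightarrow> 'm \<Rightarrow> 'm) \<Rightarrow> bool" where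
  "right_quasibasis n c \<gamma> \<longleftrightarrow> (\<forall>i<n. central (c i) \<and> \<gamma> i \<in> carrier E) \<and>
     (\<forall>m\<in>carrier M. tensM \<one> m = (\<Oplus>\<^bsub>MM\<^esub>i\<in>{..<n}. lact MM (\<gamma> i m) (c i)))"

lemma MM_group: "abelian_group MM"
  unfolding MtensM_def by (rule MM.tensor_abelian_group)

lemma tensM_closed: "x \<in> carrier M \<Longrightarrow> y \<in> carrier M \<Longrightarrow> tensM x y \<in> carrier MM"
  unfolding MtensM_def using MM.tens_closed by simp

lemma tensM_additive:
  "y \<in> carrier M \<Longrightarrow> additive M MM (\<lambda>x. tensM x y)" "x \<in> carrier M \<Longrightarrow> additive M MM (tensM x)"
  using MM.tens_balanced_map by (simp_all add: balanced_map_def MtensM_def)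

lemma tensM_balanced: "x \<in> carrier M \<Longrightarrow> n \<in> N \<Longrightarrow> y \<in> carrier M \<Longrightarrow> tensM (x \<otimes> n) y = tensM x (n \<otimes> y)"
  using MM.tens_balanced by simp

text \<open>
  A split monomorphism \<open>M \<otimes>\<^sub>N M \<rightarrow> M\<^sup>n\<close> of \<open>N\<close>-\<open>M\<close>-bimodules has coordinates
  \<open>m \<otimes> m' \<mapsto> \<beta>\<^sub>i(m) m'\<close>, and its retraction is determined by the images \<open>b\<^sub>i\<close> of the standard
  basis vectors, which are \<open>N\<close>-central.
\<close>

lemma left_quasibasis_exists:
  assumes ds: "direct_summand N (carrier M) MM (pow_bimod n Mreg)"
  obtains b \<beta> where "left_quasibasis n b \<beta>"
proof -
  note Mr = Mreg_operators[OF N_carrier subset_refl]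
  note MMo = bi_operators_subset[OF MM_operators N_carrier subset_refl]
  obtain \<phi> p where \<phi>: "bimod_hom N (carrier M) MM (pow_bimod n Mreg) \<phi>"
    and p: "bimod_hom N (carrier M) (pow_bimod n Mreg) MM p"
    and p\<phi>: "\<And>z. z \<in> carrier MM \<Longrightarrow> p (\<phi> z) = z"
    by (rule direct_summand_retraction[OF MMo pow_bimod_operators[OF Mr] ds]) blast
  note h = bimod_homD[OF \<phi>, unfolded pow_bimod_simps] and k = bimod_homD[OF p]
  have add: "additive (pow_bimod n Mreg) MM p"
    using bimod_hom_additive[OF p abelian_group_pow_bimod MM_group] A.abelian_group_axioms by simp
  define b where "b i = p (unit_vec n Mreg i \<one>)" for i
  define \<beta> where "\<beta> i = (\<lambda>m\<in>carrier M. \<phi> (tensM m \<one>) i)" for i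
  have u: "unit_vec n Mreg i x \<in> carrier (pow_bimod n Mreg)" if "x \<in> carrier M" for i x
    by (rule unit_vec_closed) (simp_all add: that A.abelian_group_axioms)
  have ub: "p (unit_vec n Mreg i x) = ract MM (b i) x" if x: "x \<in> carrier M" for i x
  proof -
    have "unit_vec n Mreg i x = ract (pow_bimod n Mreg) (unit_vec n Mreg i \<one>) x"
      using x by (auto simp: unit_vec_def intro!: restrict_ext)
    then show ?thesis using k(4)[OF x u[OF A.one_closed]] by (simp add: b_def)
  qed
  have bc: "central (b i)" for i
    unfolding central_def
  proof (intro conjI ballI)
    show "b i \<in> carrier MM" unfolding b_def by (rule k(1)[OF u[OF A.one_closed]])
    fix m assume m: "m \<in> N"
    have "lact (pow_bimod n Mreg) m (unit_vec n Mreg i \<one>) = unit_vec n Mreg i m"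
      using m by (auto simp: unit_vec_def intro!: restrict_ext)
    then show "lact MM m (b i) = ract MM (b i) m"
      using k(3)[OF m u[OF A.one_closed], of i] ub[of m i] m by (simp add: b_def)
  qed
  have \<phi>i: "\<phi> z i \<in> carrier M" if "z \<in> carrier MM" "i < n" for z i
    using h(1)[OF that(1)] that(2) pow_bimod_component[of "\<phi> z" n Mreg i] by simp
  have \<beta>: "\<beta> i \<in> carrier E" if i: "i < n" for i
    unfolding \<beta>_def
  proof (rule E_restrictI)
    show "additive M M (\<lambda>m. \<phi> (tensM m \<one>) i)"
    proof (rule additiveI)
      fix x x' assume x: "x \<in> carrier M" "x' \<in> carrier M"
      show "\<phi> (tensM (x \<oplus> x') \<one>) i = \<phi> (tensM x \<one>) i \<oplus> \<phi> (tensM x' \<one>) i"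
        using x i by (simp add: additive_add[OF tensM_additive(1)] h(2) tensM_closed)
    qed (simp_all add: \<phi>i i tensM_closed A.abelian_group_axioms)
  next
    fix m' m assume mm: "m' \<in> N" "m \<in> carrier M"
    have "tensM (m' \<otimes> m) \<one> = lact MM m' (tensM m \<one>)" using mm by (simp add: MM_lact)
    then show "\<phi> (tensM (m' \<otimes> m) \<one>) i = m' \<otimes> \<phi> (tensM m \<one>) i"
      using mm i by (simp add: h(3) tensM_closed)
    have "tensM (m \<otimes> m') \<one> = ract MM (tensM m \<one>) m'"
      using mm by (simp add: MM_ract tensM_balanced)
    then show "\<phi> (tensM (m \<otimes> m') \<one>) i = \<phi> (tensM m \<one>) i \<otimes> m'"
      using mm i by (simp add: h(4) tensM_closed)
  qed
  have "tensM m \<one> = (\<Oplus>\<^bsub>MM\<^esub>i\<in>{..<n}. ract MM (b i) (\<beta> i m))" if m: "m \<in> carrier M" for m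
  proof -
    interpret MMg: abelian_group MM by (rule MM_group)
    have t: "tensM m \<one> \<in> carrier MM" using m by (simp add: tensM_closed)
    have "tensM m \<one> = p (\<phi> (tensM m \<one>))" by (rule p\<phi>[OF t, symmetric])
    also have "\<dots> = (\<Oplus>\<^bsub>MM\<^esub>i\<in>{..<n}. p (unit_vec n Mreg i (\<phi> (tensM m \<one>) i)))"
      by (rule additive_pow_bimod_sum[OF add]) (use h(1)[OF t] A.abelian_group_axioms in simp_all)
    also have "\<dots> = (\<Oplus>\<^bsub>MM\<^esub>i\<in>{..<n}. ract MM (b i) (\<beta> i m))"
      by (rule MMg.finsum_cong')
        (use m bc in \<open>simp_all add: ub \<phi>i t \<beta>_def Pi_iff central_def additive_closed[OF bi_operators_ract[OF MM_operators]]\<close>)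
    finally show ?thesis .
  qed
  then show ?thesis
    using that[of b \<beta>] bc \<beta> by (simp add: left_quasibasis_def)
qed

text \<open>
  The mirror image of the preceding argument; here the coordinates are \<open>m \<otimes> m' \<mapsto> m \<gamma>\<^sub>i(m')\<close>.
\<close>

lemma right_quasibasis_exists:
  assumes ds: "direct_summand (carrier M) N MM (pow_bimod n Mreg)"
  obtains c \<gamma> where "right_quasibasis n c \<gamma>"
proof -
  note Mr = Mreg_operators[OF subset_refl N_carrier]
  note MMo = bi_operators_subset[OF MM_operators subset_refl N_carrier]
  obtain \<phi> p where \<phi>: "bimod_hom (carrier M) N MM (pow_bimod n Mreg) \<phi>"
    and p: "bimod_hom (carrier M) N (pow_bimod n Mreg) MM p"
    and p\<phi>: "\<And>z. z \<in> carrier MM \<Longrightarrow> p (\<phi> z) = z"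
    by (rule direct_summand_retraction[OF MMo pow_bimod_operators[OF Mr] ds]) blast
  note h = bimod_homD[OF \<phi>, unfolded pow_bimod_simps] and k = bimod_homD[OF p]
  have add: "additive (pow_bimod n Mreg) MM p"
    using bimod_hom_additive[OF p abelian_group_pow_bimod MM_group] A.abelian_group_axioms by simp
  define c where "c i = p (unit_vec n Mreg i \<one>)" for i
  define \<gamma> where "\<gamma> i = (\<lambda>m\<in>carrier M. \<phi> (tensM \<one> m) i)" for i
  have u: "unit_vec n Mreg i x \<in> carrier (pow_bimod n Mreg)" if "x \<in> carrier M" for i x
    by (rule unit_vec_closed) (simp_all add: that A.abelian_group_axioms)
  have uc: "p (unit_vec n Mreg i x) = lact MM x (c i)" if x: "x \<in> carrier M" for i x
  proof -
    have "unit_vec n Mreg i x = lact (pow_bimod n Mreg) x (unit_vec n Mreg i \<one>)"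
      using x by (auto simp: unit_vec_def intro!: restrict_ext)
    then show ?thesis using k(3)[OF x u[OF A.one_closed]] by (simp add: c_def)
  qed
  have cc: "central (c i)" for i
    unfolding central_def
  proof (intro conjI ballI)
    show "c i \<in> carrier MM" unfolding c_def by (rule k(1)[OF u[OF A.one_closed]])
    fix m assume m: "m \<in> N"
    have "ract (pow_bimod n Mreg) (unit_vec n Mreg i \<one>) m = unit_vec n Mreg i m"
      using m by (auto simp: unit_vec_def intro!: restrict_ext)
    then show "lact MM m (c i) = ract MM (c i) m"
      using k(4)[OF m u[OF A.one_closed], of i] uc[of m i] m by (simp add: c_def)
  qed
  have \<phi>i: "\<phi> z i \<in> carrier M" if "z \<in> carrier MM" "i < n" for z i
    using h(1)[OF that(1)] that(2) pow_bimod_component[of "\<phi> z" n Mreg i] by simp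
  have \<gamma>: "\<gamma> i \<in> carrier E" if i: "i < n" for i
    unfolding \<gamma>_def
  proof (rule E_restrictI)
    show "additive M M (\<lambda>m. \<phi> (tensM \<one> m) i)"
    proof (rule additiveI)
      fix x x' assume x: "x \<in> carrier M" "x' \<in> carrier M"
      show "\<phi> (tensM \<one> (x \<oplus> x')) i = \<phi> (tensM \<one> x) i \<oplus> \<phi> (tensM \<one> x') i"
        using x i by (simp add: additive_add[OF tensM_additive(2)] h(2) tensM_closed)
    qed (simp_all add: \<phi>i i tensM_closed A.abelian_group_axioms)
  next
    fix m' m assume mm: "m' \<in> N" "m \<in> carrier M"
    have "tensM \<one> (m \<otimes> m') = ract MM (tensM \<one> m) m'" using mm by (simp add: MM_ract)
    then show "\<phi> (tensM \<one> (m \<otimes> m')) i = \<phi> (tensM \<one> m) i \<otimes> m'"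
      using mm i by (simp add: h(4) tensM_closed)
    have "tensM \<one> (m' \<otimes> m) = lact MM m' (tensM \<one> m)"
      using mm tensM_balanced[of "\<one>" m' m] by (simp add: MM_lact)
    then show "\<phi> (tensM \<one> (m' \<otimes> m)) i = m' \<otimes> \<phi> (tensM \<one> m) i"
      using mm i by (simp add: h(3) tensM_closed)
  qed
  have "tensM \<one> m = (\<Oplus>\<^bsub>MM\<^esub>i\<in>{..<n}. lact MM (\<gamma> i m) (c i))" if m: "m \<in> carrier M" for m
  proof -
    interpret MMg: abelian_group MM by (rule MM_group)
    have t: "tensM \<one> m \<in> carrier MM" using m by (simp add: tensM_closed)
    have "tensM \<one> m = p (\<phi> (tensM \<one> m))" by (rule p\<phi>[OF t, symmetric])
    also have "\<dots> = (\<Oplus>\<^bsub>MM\<^esub>i\<in>{..<n}. p (unit_vec n Mreg i (\<phi> (tensM \<one> m) i)))"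
      by (rule additive_pow_bimod_sum[OF add]) (use h(1)[OF t] A.abelian_group_axioms in simp_all)
    also have "\<dots> = (\<Oplus>\<^bsub>MM\<^esub>i\<in>{..<n}. lact MM (\<gamma> i m) (c i))"
      by (rule MMg.finsum_cong')
        (use m cc in \<open>simp_all add: uc \<phi>i t \<gamma>_def Pi_iff central_def additive_closed[OF bi_operators_lact[OF MM_operators]]\<close>)
    finally show ?thesis .
  qed
  then show ?thesis
    using that[of c \<gamma>] cc \<gamma> by (simp add: right_quasibasis_def)
qed

lemma N_balancedI:
  assumes "\<And>x. x \<in> carrier M \<Longrightarrow> additive M M (f x)" "\<And>y. y \<in> carrier M \<Longrightarrow> additive M M (\<lambda>x. f x y)"
    and "\<And>x n y. x \<in> carrier M \<Longrightarrow> n \<in> N \<Longrightarrow> y \<in> carrier M \<Longrightarrow> f (x \<otimes> n) y = f x (n \<otimes> y)"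
  shows "N_balanced f"
  using assms by (simp add: balanced_map_def)

lemma N_lift_additive: "N_balanced f \<Longrightarrow> additive MM M (tensor_lift M f)"
  unfolding MtensM_def by (rule MM.lift_additive)

lemma N_lift_tens: "N_balanced f \<Longrightarrow> x \<in> carrier M \<Longrightarrow> y \<in> carrier M \<Longrightarrow> tensor_lift M f (tensM x y) = f x y"
  using MM.lift_tens[of M f x y] by simp

lemma N_eq_on_tens:
  assumes "additive MM Z g" "additive MM Z h"
    "\<And>x y. x \<in> carrier M \<Longrightarrow> y \<in> carrier M \<Longrightarrow> g (tensM x y) = h (tensM x y)" "z \<in> carrier MM"
  shows "g z = h z"
  using MM.additive_eq_on_tens[of Z g h z] assms unfolding MtensM_def by simp

lemma N_lift_eq:
  assumes "N_balanced f" "additive MM M h" "\<And>x y. x \<in> carrier M \<Longrightarrow> y \<in> carrier M \<Longrightarrow> h (tensM x y) = f x y"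
    and "z \<in> carrier MM"
  shows "h z = tensor_lift M f z"
  by (rule N_eq_on_tens[OF assms(2) N_lift_additive[OF assms(1)] _ assms(4)]) (simp add: assms(3) N_lift_tens[OF assms(1)])

lemma N_lift_ract:
  assumes f: "N_balanced f" and r: "r \<in> carrier M"
    and fr: "\<And>x y. x \<in> carrier M \<Longrightarrow> y \<in> carrier M \<Longrightarrow> f x (y \<otimes> r) = f x y \<otimes> r"
    and z: "z \<in> carrier MM"
  shows "tensor_lift M f (ract MM z r) = tensor_lift M f z \<otimes> r"
  by (rule N_eq_on_tens[where g = "\<lambda>z. tensor_lift M f (ract MM z r)" and h = "\<lambda>z. tensor_lift M f z \<otimes> r",
        OF additive_comp[OF bi_operators_ract[OF MM_operators r] N_lift_additive[OF f]]
          additive_comp[OF N_lift_additive[OF f] additive_right_mult[OF r]] _ z])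
    (simp add: r MM_ract N_lift_tens[OF f] fr)

lemma N_lift_lact:
  assumes f: "N_balanced f" and g: "N_balanced g" and l: "l \<in> carrier M"
    and fl: "\<And>x y. x \<in> carrier M \<Longrightarrow> y \<in> carrier M \<Longrightarrow> f (l \<otimes> x) y = g x y"
    and z: "z \<in> carrier MM"
  shows "tensor_lift M f (lact MM l z) = tensor_lift M g z"
  by (rule N_lift_eq[OF g additive_comp[OF bi_operators_lact[OF MM_operators l] N_lift_additive[OF f]] _ z])
    (simp add: l MM_lact N_lift_tens[OF f] fl)

lemma N_lift_cong_additive:
  assumes f: "N_balanced f" and g: "N_balanced g" and h: "additive M M h"
    and fg: "\<And>x y. x \<in> carrier M \<Longrightarrow> y \<in> carrier M \<Longrightarrow> g x y = h (f x y)"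
    and z: "z \<in> carrier MM"
  shows "h (tensor_lift M f z) = tensor_lift M g z"
  by (rule N_lift_eq[OF g additive_comp[OF N_lift_additive[OF f] h] _ z])
    (simp add: N_lift_tens[OF f] fg)

text \<open>
  The left-hand side is the value of the map induced by \<open>f\<close> at \<open>n b\<close>, and \<open>n b = b n\<close>.
\<close>

lemma central_lift:
  assumes f: "N_balanced f" and g: "N_balanced g" and b: "central b" and n: "n \<in> N"
    and fg: "\<And>x y. x \<in> carrier M \<Longrightarrow> y \<in> carrier M \<Longrightarrow> f (n \<otimes> x) y = g x y"
    and fr: "\<And>x y. x \<in> carrier M \<Longrightarrow> y \<in> carrier M \<Longrightarrow> f x (y \<otimes> n) = f x y \<otimes> n"
  shows "tensor_lift M g b = tensor_lift M f b \<otimes> n"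
proof -
  have b': "b \<in> carrier MM" "lact MM n b = ract MM b n" using b n by (simp_all add: central_def)
  have "tensor_lift M g b = tensor_lift M f (lact MM n b)"
    by (rule N_lift_lact[OF f g _ fg b'(1), symmetric]) (simp_all add: n)
  also have "\<dots> = tensor_lift M f b \<otimes> n"
    unfolding b'(2) by (rule N_lift_ract[OF f _ fr b'(1)]) (simp_all add: n)
  finally show ?thesis .
qed

lemma central_lift_R:
  assumes f: "N_balanced f" and b: "central b"
    and fl: "\<And>n x y. n \<in> N \<Longrightarrow> x \<in> carrier M \<Longrightarrow> y \<in> carrier M \<Longrightarrow> f (n \<otimes> x) y = n \<otimes> f x y"
    and fr: "\<And>n x y. n \<in> N \<Longrightarrow> x \<in> carrier M \<Longrightarrow> y \<in> carrier M \<Longrightarrow> f x (y \<otimes> n) = f x y \<otimes> n"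
  shows "tensor_lift M f b \<in> carrier R"
  unfolding centralizer_iff
proof (intro conjI ballI)
  have b': "b \<in> carrier MM" using b by (simp add: central_def)
  show "tensor_lift M f b \<in> carrier M" by (rule additive_closed[OF N_lift_additive[OF f] b'])
  fix n assume n: "n \<in> N"
  have add: "additive M M (\<lambda>y. n \<otimes> y)" using n by (simp add: additive_left_mult)
  have g: "N_balanced (\<lambda>x y. n \<otimes> f x y)"
    using f unfolding balanced_map_def by (auto intro: additive_comp[OF _ add])
  have "n \<otimes> tensor_lift M f b = tensor_lift M (\<lambda>x y. n \<otimes> f x y) b"
    by (rule N_lift_cong_additive[OF f g add refl b'])
  also have "\<dots> = tensor_lift M f b \<otimes> n"
    by (rule central_lift[OF f g b n]) (simp_all add: n fl fr)
  finally show "tensor_lift M f b \<otimes> n = n \<otimes> tensor_lift M f b" ..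
qed

text \<open>
  Apply the map induced by \<open>f\<close> to the expansion of \<open>m \<otimes> 1\<close>; being linear for \<open>M\<close> on the right, it
  commutes with the multiplication by \<open>\<beta>\<^sub>i(m)\<close>.
\<close>

lemma left_quasibasis_expand:
  assumes q: "left_quasibasis n b \<beta>" and f: "N_balanced f" and m: "m \<in> carrier M"
    and fr: "\<And>x y r. x \<in> carrier M \<Longrightarrow> y \<in> carrier M \<Longrightarrow> r \<in> carrier M \<Longrightarrow> f x (y \<otimes> r) = f x y \<otimes> r"
  shows "f m \<one> = (\<Oplus>i\<in>{..<n}. tensor_lift M f (b i) \<otimes> \<beta> i m)"
proof -
  have q': "b i \<in> carrier MM" "\<beta> i m \<in> carrier M" if "i < n" for i
    using q m that by (simp_all add: left_quasibasis_def central_def)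
  note la = additive_closed[OF N_lift_additive[OF f]]
  have "f m \<one> = tensor_lift M f (tensM m \<one>)" by (simp add: N_lift_tens[OF f] m)
  also have "\<dots> = tensor_lift M f (\<Oplus>\<^bsub>MM\<^esub>i\<in>{..<n}. ract MM (b i) (\<beta> i m))"
    using q m by (simp add: left_quasibasis_def)
  also have "\<dots> = (\<Oplus>i\<in>{..<n}. tensor_lift M f (ract MM (b i) (\<beta> i m)))"
    by (rule additive_sum[OF N_lift_additive[OF f]])
      (simp add: Pi_iff q' additive_closed[OF bi_operators_ract[OF MM_operators]])
  also have "\<dots> = (\<Oplus>i\<in>{..<n}. tensor_lift M f (b i) \<otimes> \<beta> i m)"
    by (rule A.finsum_cong') (simp_all add: Pi_iff q' la N_lift_ract[OF f _ fr])
  finally show ?thesis .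
qed

lemma right_quasibasis_expand:
  assumes q: "right_quasibasis n c \<gamma>" and f: "N_balanced f" and m: "m \<in> carrier M"
    and fl: "\<And>x y r. x \<in> carrier M \<Longrightarrow> y \<in> carrier M \<Longrightarrow> r \<in> carrier M \<Longrightarrow> f (r \<otimes> x) y = r \<otimes> f x y"
  shows "f \<one> m = (\<Oplus>i\<in>{..<n}. \<gamma> i m \<otimes> tensor_lift M f (c i))"
proof -
  have q': "c i \<in> carrier MM" "\<gamma> i m \<in> carrier M" if "i < n" for i
    using q m that by (simp_all add: right_quasibasis_def central_def)
  note la = additive_closed[OF N_lift_additive[OF f]]
  have lact: "tensor_lift M f (lact MM r z) = r \<otimes> tensor_lift M f z"
    if "r \<in> carrier M" "z \<in> carrier MM" for r z
  proof -
    have g: "N_balanced (\<lambda>x y. r \<otimes> f x y)"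
      using f that unfolding balanced_map_def by (auto intro: additive_comp additive_left_mult)
    have "tensor_lift M f (lact MM r z) = tensor_lift M (\<lambda>x y. r \<otimes> f x y) z"
      by (rule N_lift_lact[OF f g that(1) _ that(2)]) (simp add: fl that)
    also have "\<dots> = r \<otimes> tensor_lift M f z"
      by (rule N_lift_cong_additive[OF f g additive_left_mult[OF that(1)] refl that(2), symmetric])
    finally show ?thesis .
  qed
  have "f \<one> m = tensor_lift M f (tensM \<one> m)" by (simp add: N_lift_tens[OF f] m)
  also have "\<dots> = tensor_lift M f (\<Oplus>\<^bsub>MM\<^esub>i\<in>{..<n}. lact MM (\<gamma> i m) (c i))"
    using q m by (simp add: right_quasibasis_def)
  also have "\<dots> = (\<Oplus>i\<in>{..<n}. tensor_lift M f (lact MM (\<gamma> i m) (c i)))"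
    by (rule additive_sum[OF N_lift_additive[OF f]])
      (simp add: Pi_iff q' additive_closed[OF bi_operators_lact[OF MM_operators]])
  also have "\<dots> = (\<Oplus>i\<in>{..<n}. \<gamma> i m \<otimes> tensor_lift M f (c i))"
    by (rule A.finsum_cong') (simp_all add: Pi_iff q' la lact)
  finally show ?thesis .
qed

text \<open>
  For a central \<open>b = \<Sum> b\<^sup>1 \<otimes> b\<^sup>2\<close> these are the functionals \<open>a \<mapsto> \<Sum> a(b\<^sup>1) b\<^sup>2\<close> and
  \<open>a \<mapsto> \<Sum> b\<^sup>1 a(b\<^sup>2)\<close> on \<open>A\<close>, which serve as coordinates.
\<close>

definition left_coef :: "('m \<times> 'm \<Rightarrow>\<^sub>0 int) set \<Rightarrow> ('m \<Rightarrow> 'm) \<Rightarrow> 'm" where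
  "left_coef b a = tensor_lift M (\<lambda>x y. a x \<otimes> y) b"

definition right_coef :: "('m \<times> 'm \<Rightarrow>\<^sub>0 int) set \<Rightarrow> ('m \<Rightarrow> 'm) \<Rightarrow> 'm" where
  "right_coef c a = tensor_lift M (\<lambda>x y. x \<otimes> a y) c"

lemma coef_balanced:
  assumes "a \<in> carrier E"
  shows "N_balanced (\<lambda>x y. a x \<otimes> y)" "N_balanced (\<lambda>x y. x \<otimes> a y)"
proof -
  show "N_balanced (\<lambda>x y. a x \<otimes> y)"
    by (rule N_balancedI) (simp_all add: assms additive_left_mult additive_comp[OF E_additive additive_right_mult]
        E_right_N A.m_assoc)
  show "N_balanced (\<lambda>x y. x \<otimes> a y)"
    by (rule N_balancedI) (simp_all add: assms additive_right_mult additive_comp[OF E_additive additive_left_mult]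
        E_left_N A.m_assoc)
qed

lemma coef_closed:
  assumes "central b" "a \<in> carrier E" shows "left_coef b a \<in> carrier R" "right_coef b a \<in> carrier R"
  unfolding left_coef_def right_coef_def
  by (rule central_lift_R[OF coef_balanced(1) assms(1)] central_lift_R[OF coef_balanced(2) assms(1)];
      simp add: assms E_left_N E_right_N A.m_assoc)+

lemma coef_add:
  assumes b': "b \<in> carrier MM" and a: "a \<in> carrier E" "a' \<in> carrier E"
  shows "left_coef b (a \<oplus>\<^bsub>E\<^esub> a') = left_coef b a \<oplus> left_coef b a'"
    "right_coef b (a \<oplus>\<^bsub>E\<^esub> a') = right_coef b a \<oplus> right_coef b a'"
proof -
  note s = E.A.a_closed[OF a]
  show "left_coef b (a \<oplus>\<^bsub>E\<^esub> a') = left_coef b a \<oplus> left_coef b a'"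
    unfolding left_coef_def
    by (rule N_lift_eq[OF coef_balanced(1)[OF s] additive_plus[OF N_lift_additive[OF coef_balanced(1)[OF a(1)]]
          N_lift_additive[OF coef_balanced(1)[OF a(2)]]] _ b', symmetric])
      (simp add: N_lift_tens coef_balanced a A.l_distr)
  show "right_coef b (a \<oplus>\<^bsub>E\<^esub> a') = right_coef b a \<oplus> right_coef b a'"
    unfolding right_coef_def
    by (rule N_lift_eq[OF coef_balanced(2)[OF s] additive_plus[OF N_lift_additive[OF coef_balanced(2)[OF a(1)]]
          N_lift_additive[OF coef_balanced(2)[OF a(2)]]] _ b', symmetric])
      (simp add: N_lift_tens coef_balanced a A.r_distr)
qed

lemma coef_additive:
  assumes "central b" shows "additive E R (left_coef b)" "additive E R (right_coef b)"
  using E.A.abelian_group_axioms R.A.abelian_group_axioms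
  by (auto intro!: additiveI simp: coef_closed[OF assms] coef_add[OF central_closed[OF assms]])

lemma left_coef_src:
  assumes b': "b \<in> carrier MM" and a: "a \<in> carrier E" and r: "r \<in> carrier R"
  shows "left_coef b (End_src M r \<otimes>\<^bsub>E\<^esub> a) = r \<otimes> left_coef b a"
proof -
  show ?thesis unfolding left_coef_def
    by (rule N_lift_cong_additive[OF coef_balanced(1)[OF a]
          coef_balanced(1)[OF E.A.m_closed[OF src_closed[OF r] a]] additive_left_mult[OF R_closed[OF r]] _ b', symmetric])
      (simp add: a r A.m_assoc)
qed

lemma right_coef_tgt:
  assumes b': "b \<in> carrier MM" and a: "a \<in> carrier E" and r: "r \<in> carrier R"
  shows "right_coef b (End_tgt M r \<otimes>\<^bsub>E\<^esub> a) = right_coef b a \<otimes> r"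
proof -
  show ?thesis unfolding right_coef_def
    by (rule N_lift_cong_additive[OF coef_balanced(2)[OF a]
          coef_balanced(2)[OF E.A.m_closed[OF tgt_closed[OF r] a]] additive_right_mult[OF R_closed[OF r]] _ b', symmetric])
      (simp add: a r A.m_assoc)
qed

text \<open>
  Expanding \<open>m \<otimes> 1\<close> in \<open>a(m) 1\<close>, and \<open>1 \<otimes> m\<close> in \<open>1 a(m)\<close>, gives dual bases of \<open>A\<close> as a left and as
  a right \<open>R\<close>-module.
\<close>

lemma left_dual_basis:
  assumes q: "left_quasibasis n b \<beta>" and a: "a \<in> carrier E"
  shows "a = (\<Oplus>\<^bsub>E\<^esub>i\<in>{..<n}. End_src M (left_coef (b i) a) \<otimes>\<^bsub>E\<^esub> \<beta> i)"
proof (rule E_eqI)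
  have q': "central (b i)" "\<beta> i \<in> carrier E" if "i < n" for i using q that by (simp_all add: left_quasibasis_def)
  have c: "(\<lambda>i. End_src M (left_coef (b i) a) \<otimes>\<^bsub>E\<^esub> \<beta> i) \<in> {..<n} \<rightarrow> carrier E"
    using a by (simp add: Pi_iff q' coef_closed)
  show "a \<in> carrier E" "(\<Oplus>\<^bsub>E\<^esub>i\<in>{..<n}. End_src M (left_coef (b i) a) \<otimes>\<^bsub>E\<^esub> \<beta> i) \<in> carrier E"
    using a c by simp_all
  fix m assume m: "m \<in> carrier M"
  have "a m = (\<Oplus>i\<in>{..<n}. left_coef (b i) a \<otimes> \<beta> i m)"
    unfolding left_coef_def using left_quasibasis_expand[OF q coef_balanced(1)[OF a] m] a m by (simp add: A.m_assoc)
  also have "\<dots> = (\<Oplus>i\<in>{..<n}. (End_src M (left_coef (b i) a) \<otimes>\<^bsub>E\<^esub> \<beta> i) m)"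
    by (rule A.finsum_cong') (use a m in \<open>simp_all add: Pi_iff q' coef_closed[OF q'(1)]\<close>)
  finally show "a m = (\<Oplus>\<^bsub>E\<^esub>i\<in>{..<n}. End_src M (left_coef (b i) a) \<otimes>\<^bsub>E\<^esub> \<beta> i) m"
    by (simp add: E_sum_apply[OF c m])
qed

lemma right_dual_basis:
  assumes q: "right_quasibasis n c \<gamma>" and a: "a \<in> carrier E"
  shows "a = (\<Oplus>\<^bsub>E\<^esub>i\<in>{..<n}. End_tgt M (right_coef (c i) a) \<otimes>\<^bsub>E\<^esub> \<gamma> i)"
proof (rule E_eqI)
  have q': "central (c i)" "\<gamma> i \<in> carrier E" if "i < n" for i using q that by (simp_all add: right_quasibasis_def)
  have c: "(\<lambda>i. End_tgt M (right_coef (c i) a) \<otimes>\<^bsub>E\<^esub> \<gamma> i) \<in> {..<n} \<rightarrow> carrier E"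
    using a by (simp add: Pi_iff q' coef_closed)
  show "a \<in> carrier E" "(\<Oplus>\<^bsub>E\<^esub>i\<in>{..<n}. End_tgt M (right_coef (c i) a) \<otimes>\<^bsub>E\<^esub> \<gamma> i) \<in> carrier E"
    using a c by simp_all
  fix m assume m: "m \<in> carrier M"
  have "a m = (\<Oplus>i\<in>{..<n}. \<gamma> i m \<otimes> right_coef (c i) a)"
    unfolding right_coef_def using right_quasibasis_expand[OF q coef_balanced(2)[OF a] m] a m by (simp add: A.m_assoc)
  also have "\<dots> = (\<Oplus>i\<in>{..<n}. (End_tgt M (right_coef (c i) a) \<otimes>\<^bsub>E\<^esub> \<gamma> i) m)"
    by (rule A.finsum_cong') (use a m in \<open>simp_all add: Pi_iff q' coef_closed[OF q'(1)]\<close>)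
  finally show "a m = (\<Oplus>\<^bsub>E\<^esub>i\<in>{..<n}. End_tgt M (right_coef (c i) a) \<otimes>\<^bsub>E\<^esub> \<gamma> i) m"
    by (simp add: E_sum_apply[OF c m])
qed

abbreviation X where "X \<equiv> bgd_bimod E (End_src M) (End_tgt M)"

lemma X_operators: "bi_operators (carrier R) (carrier R) X"
  by (rule E.bgd_operators) (simp_all add: src_tgt_commute)

lemma src_additive: "additive R E (End_src M)"
  using src_alg_hom E.A.abelian_group_axioms R.A.abelian_group_axioms
  by (auto simp: alg_hom_def ring_hom_def additive_def)

lemma tgt_additive: "additive R E (End_tgt M)"
  using tgt_alg_hom E.A.abelian_group_axioms R.A.abelian_group_axioms
  by (auto simp: alg_hom_def ring_hom_def additive_def op_alg_def)

text \<open>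
  A dual basis exhibits \<open>A\<close> as a retract of \<open>R\<^sup>n\<close>.
\<close>

lemma fg_projective_left_E:
  assumes q: "left_quasibasis n b \<beta>" shows "fg_projective_left R X"
  unfolding fg_projective_left_def
proof (intro exI retraction_direct_summand)
  have q': "central (b i)" "\<beta> i \<in> carrier E" if "i < n" for i using q that by (simp_all add: left_quasibasis_def)
  let ?\<phi> = "\<lambda>a. \<lambda>i\<in>{..<n}. left_coef (b i) a" and ?Y = "pow_bimod n (reg_bimod R)"
  let ?p = "\<lambda>v. \<Oplus>\<^bsub>E\<^esub>i\<in>{..<n}. End_src M (v i) \<otimes>\<^bsub>E\<^esub> \<beta> i"
  show "bi_operators (carrier R) {} X" by (rule bi_operators_left[OF X_operators])
  have Ro: "bi_operators (carrier R) {} (reg_bimod R)" by (rule R.reg_bimod_operators) simp_all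
  then show "bi_operators (carrier R) {} ?Y" by (rule pow_bimod_operators)
  show "bimod_hom (carrier R) {} X ?Y ?\<phi>"
    by (simp add: bimod_hom_def q' coef_closed coef_add left_coef_src cong: restrict_cong)
  have comp: "additive ?Y R (\<lambda>v. v i)" if "i < n" for i
    by (rule additiveI[OF abelian_group_pow_bimod])
      (use that pow_bimod_component[of _ n "reg_bimod R" i] in \<open>simp_all add: R.A.abelian_group_axioms\<close>)
  have summand: "additive ?Y E (\<lambda>v. End_src M (v i) \<otimes>\<^bsub>E\<^esub> \<beta> i)" if "i < n" for i
    by (rule additive_comp[OF additive_comp[OF comp[OF that] src_additive] E.additive_right_mult[OF q'(2)[OF that]]])
  have p: "additive ?Y E ?p"
    by (rule additive_finsum[OF E.A.abelian_group_axioms abelian_group_pow_bimod])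
      (simp_all add: summand R.A.abelian_group_axioms)
  have pl: "?p (lact ?Y r v) = End_src M r \<otimes>\<^bsub>E\<^esub> ?p v" if r: "r \<in> carrier R" and v: "v \<in> carrier ?Y" for r v
  proof -
    have vi: "v i \<in> carrier R" if "i < n" for i using additive_closed[OF comp[OF that] v] .
    have s: "End_src M (r \<otimes> v i) = End_src M r \<otimes>\<^bsub>E\<^esub> End_src M (v i)" if "i < n" for i
      using src_alg_hom r vi[OF that] by (simp add: alg_hom_def ring_hom_def)
    have "?p (lact ?Y r v) = (\<Oplus>\<^bsub>E\<^esub>i\<in>{..<n}. End_src M r \<otimes>\<^bsub>E\<^esub> (End_src M (v i) \<otimes>\<^bsub>E\<^esub> \<beta> i))"
      by (rule E.A.finsum_cong') (simp_all add: Pi_iff r vi q' s E.A.m_assoc)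
    also have "\<dots> = End_src M r \<otimes>\<^bsub>E\<^esub> ?p v"
      by (rule additive_sum[OF E.additive_left_mult, symmetric]) (simp_all add: Pi_iff r vi q')
    finally show ?thesis .
  qed
  show "bimod_hom (carrier R) {} ?Y X ?p"
    unfolding bimod_hom_def using additive_closed[OF p] additive_add[OF p] pl by (simp add: Pi_iff del: pow_bimod_simps)
  show "?p (?\<phi> a) = a" if "a \<in> carrier X" for a
  proof -
    have a: "a \<in> carrier E" using that by simp
    have "?p (?\<phi> a) = (\<Oplus>\<^bsub>E\<^esub>i\<in>{..<n}. End_src M (left_coef (b i) a) \<otimes>\<^bsub>E\<^esub> \<beta> i)"
      by (rule E.A.finsum_cong') (simp_all add: Pi_iff a q' coef_closed)
    then show ?thesis by (simp add: left_dual_basis[OF q a, symmetric])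
  qed
qed

lemma fg_projective_right_E:
  assumes q: "right_quasibasis n c \<gamma>" shows "fg_projective_right R X"
  unfolding fg_projective_right_def
proof (intro exI retraction_direct_summand)
  have q': "central (c i)" "\<gamma> i \<in> carrier E" if "i < n" for i using q that by (simp_all add: right_quasibasis_def)
  let ?\<phi> = "\<lambda>a. \<lambda>i\<in>{..<n}. right_coef (c i) a" and ?Y = "pow_bimod n (reg_bimod R)"
  let ?p = "\<lambda>v. \<Oplus>\<^bsub>E\<^esub>i\<in>{..<n}. End_tgt M (v i) \<otimes>\<^bsub>E\<^esub> \<gamma> i"
  show "bi_operators {} (carrier R) X" by (rule bi_operators_right[OF X_operators])
  have Ro: "bi_operators {} (carrier R) (reg_bimod R)" by (rule R.reg_bimod_operators) simp_all
  then show "bi_operators {} (carrier R) ?Y" by (rule pow_bimod_operators)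
  show "bimod_hom {} (carrier R) X ?Y ?\<phi>"
    by (simp add: bimod_hom_def q' coef_closed coef_add right_coef_tgt cong: restrict_cong)
  have comp: "additive ?Y R (\<lambda>v. v i)" if "i < n" for i
    by (rule additiveI[OF abelian_group_pow_bimod])
      (use that pow_bimod_component[of _ n "reg_bimod R" i] in \<open>simp_all add: R.A.abelian_group_axioms\<close>)
  have summand: "additive ?Y E (\<lambda>v. End_tgt M (v i) \<otimes>\<^bsub>E\<^esub> \<gamma> i)" if "i < n" for i
    by (rule additive_comp[OF additive_comp[OF comp[OF that] tgt_additive] E.additive_right_mult[OF q'(2)[OF that]]])
  have p: "additive ?Y E ?p"
    by (rule additive_finsum[OF E.A.abelian_group_axioms abelian_group_pow_bimod])
      (simp_all add: summand R.A.abelian_group_axioms)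
  have pl: "?p (ract ?Y v r) = End_tgt M r \<otimes>\<^bsub>E\<^esub> ?p v" if r: "r \<in> carrier R" and v: "v \<in> carrier ?Y" for r v
  proof -
    have vi: "v i \<in> carrier R" if "i < n" for i using additive_closed[OF comp[OF that] v] .
    have s: "End_tgt M (v i \<otimes> r) = End_tgt M r \<otimes>\<^bsub>E\<^esub> End_tgt M (v i)" if "i < n" for i
      using tgt_alg_hom r vi[OF that] by (simp add: alg_hom_def ring_hom_def op_alg_def)
    have "?p (ract ?Y v r) = (\<Oplus>\<^bsub>E\<^esub>i\<in>{..<n}. End_tgt M r \<otimes>\<^bsub>E\<^esub> (End_tgt M (v i) \<otimes>\<^bsub>E\<^esub> \<gamma> i))"
      by (rule E.A.finsum_cong') (simp_all add: Pi_iff r vi q' s E.A.m_assoc)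
    also have "\<dots> = End_tgt M r \<otimes>\<^bsub>E\<^esub> ?p v"
      by (rule additive_sum[OF E.additive_left_mult, symmetric]) (simp_all add: Pi_iff r vi q')
    finally show ?thesis .
  qed
  show "bimod_hom {} (carrier R) ?Y X ?p"
    unfolding bimod_hom_def using additive_closed[OF p] additive_add[OF p] pl by (simp add: Pi_iff del: pow_bimod_simps)
  show "?p (?\<phi> a) = a" if "a \<in> carrier X" for a
  proof -
    have a: "a \<in> carrier E" using that by simp
    have "?p (?\<phi> a) = (\<Oplus>\<^bsub>E\<^esub>i\<in>{..<n}. End_tgt M (right_coef (c i) a) \<otimes>\<^bsub>E\<^esub> \<gamma> i)"
      by (rule E.A.finsum_cong') (simp_all add: Pi_iff a q' coef_closed)
    then show ?thesis by (simp add: right_dual_basis[OF q a, symmetric])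
  qed
qed

end


section \<open>The left bialgebroid structure on \<open>End(\<^sub>NM\<^sub>N)\<close>\<close>

context algebra_extension
begin

lemma X_left: "bi_operators (carrier R) {} X" and X_right: "bi_operators {} (carrier R) X"
  by (simp_all add: bi_operators_left[OF X_operators] bi_operators_right[OF X_operators])

sublocale XX: tensor_product R X X by (rule tensor_product.intro[OF X_right X_left])

abbreviation X2 where "X2 \<equiv> tensor R X X"
abbreviation tensX where "tensX \<equiv> tens R X X"

lemmas X2_operators_tens = tensor_bi_operators[OF X_operators X_operators]

lemma X2_operators: "bi_operators (carrier R) (carrier R) X2"
  and X2_lact: "r \<in> carrier R \<Longrightarrow> a \<in> carrier E \<Longrightarrow> a' \<in> carrier E \<Longrightarrow>
    lact X2 r (tensX a a') = tensX (End_src M r \<otimes>\<^bsub>E\<^esub> a) a'"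
  and X2_ract: "r \<in> carrier R \<Longrightarrow> a \<in> carrier E \<Longrightarrow> a' \<in> carrier E \<Longrightarrow>
    ract X2 (tensX a a') r = tensX a (End_tgt M r \<otimes>\<^bsub>E\<^esub> a')"
  using X2_operators_tens by simp_all

lemma End_square_eq: "End_square M N = X2"
  by (simp add: End_square_def Let_def)

lemma tensX_closed: "a \<in> carrier E \<Longrightarrow> a' \<in> carrier E \<Longrightarrow> tensX a a' \<in> carrier X2"
  using XX.tens_closed by simp

lemma R_balancedI:
  assumes "\<And>a. a \<in> carrier E \<Longrightarrow> additive E Z (f a)" "\<And>a. a \<in> carrier E \<Longrightarrow> additive E Z (\<lambda>a'. f a' a)"
    and "\<And>a r a'. a \<in> carrier E \<Longrightarrow> r \<in> carrier R \<Longrightarrow> a' \<in> carrier E \<Longrightarrow>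
      f (End_tgt M r \<otimes>\<^bsub>E\<^esub> a) a' = f a (End_src M r \<otimes>\<^bsub>E\<^esub> a')"
  shows "balanced_map R X X Z f"
  by (rule balanced_mapI) (simp_all add: assms)

text \<open>
  The map \<open>a \<otimes> a' \<mapsto> (m \<otimes> m' \<mapsto> a(m) a'(m'))\<close>, as a function of two elements of \<open>M\<close>.  All
  identities in tensor powers of \<open>A\<close> are checked after applying it.
\<close>

definition pairing :: "(('m \<Rightarrow> 'm) \<times> ('m \<Rightarrow> 'm) \<Rightarrow>\<^sub>0 int) set \<Rightarrow> 'm \<Rightarrow> 'm \<Rightarrow> 'm" where
  "pairing z m m' = tensor_lift M (\<lambda>a a'. a m \<otimes> a' m') z"

lemma pairing_balanced:
  assumes "m \<in> carrier M" "m' \<in> carrier M"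
  shows "balanced_map R X X M (\<lambda>a a'. a m \<otimes> a' m')"
proof (rule R_balancedI)
  show "additive E M (\<lambda>a'. a m \<otimes> a' m')" if "a \<in> carrier E" for a
    by (rule additive_comp[OF E_apply_additive additive_left_mult]) (simp_all add: that assms)
  show "additive E M (\<lambda>a'. a' m \<otimes> a m')" if "a \<in> carrier E" for a
    by (rule additive_comp[OF E_apply_additive additive_right_mult]) (simp_all add: that assms)
qed (simp add: assms A.m_assoc)

lemma pairing_additive:
  "m \<in> carrier M \<Longrightarrow> m' \<in> carrier M \<Longrightarrow> additive X2 M (\<lambda>z. pairing z m m')"
  unfolding pairing_def by (rule XX.lift_additive(1)[OF pairing_balanced])

lemma pairing_closed [simp]:
  "z \<in> carrier X2 \<Longrightarrow> m \<in> carrier M \<Longrightarrow> m' \<in> carrier M \<Longrightarrow> pairing z m m' \<in> carrier M"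
  using additive_closed[OF pairing_additive] .

lemma pairing_tens [simp]:
  "a \<in> carrier E \<Longrightarrow> a' \<in> carrier E \<Longrightarrow> m \<in> carrier M \<Longrightarrow> m' \<in> carrier M \<Longrightarrow>
    pairing (tensX a a') m m' = a m \<otimes> a' m'"
  unfolding pairing_def using XX.lift_tens[OF pairing_balanced] by simp

lemma pairing_lact:
  assumes "r \<in> carrier R" "z \<in> carrier X2" "m \<in> carrier M" "m' \<in> carrier M"
  shows "pairing (lact X2 r z) m m' = r \<otimes> pairing z m m'"
  by (rule XX.additive_eq_on_tens[where g = "\<lambda>z. pairing (lact X2 r z) m m'" and h = "\<lambda>z. r \<otimes> pairing z m m'",
        OF additive_comp[OF bi_operators_lact[OF X2_operators assms(1)] pairing_additive[OF assms(3,4)]]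
        additive_comp[OF pairing_additive[OF assms(3,4)] additive_left_mult[OF R_closed[OF assms(1)]]] _ assms(2)])
    (simp add: X2_lact assms A.m_assoc)

lemma pairing_ract:
  assumes "r \<in> carrier R" "z \<in> carrier X2" "m \<in> carrier M" "m' \<in> carrier M"
  shows "pairing (ract X2 z r) m m' = pairing z m m' \<otimes> r"
  by (rule XX.additive_eq_on_tens[where g = "\<lambda>z. pairing (ract X2 z r) m m'" and h = "\<lambda>z. pairing z m m' \<otimes> r",
        OF additive_comp[OF bi_operators_ract[OF X2_operators assms(1)] pairing_additive[OF assms(3,4)]]
        additive_comp[OF pairing_additive[OF assms(3,4)] additive_right_mult[OF R_closed[OF assms(1)]]] _ assms(2)])
    (simp add: X2_ract assms A.m_assoc)

text \<open>
  Let \<open>Y\<close> be a left \<open>R\<close>-module whose elements are separated by \<open>R\<close>-linear maps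
  \<open>ev i : Y \<rightarrow> M\<close>.  Then \<open>A \<otimes>\<^sub>R Y\<close> is separated by the maps \<open>a \<otimes> y \<mapsto> a(m) ev i y\<close>.
  Indeed the dual basis of \<open>A\<^sub>R\<close> gives \<open>z = \<Sum>\<^sub>j \<gamma>\<^sub>j \<otimes> y\<^sub>j\<close> where, for \<open>z = a \<otimes> y\<close>,
  \<open>y\<^sub>j = c\<^sub>j\<^sup>1 a(c\<^sub>j\<^sup>2) y\<close>, and \<open>ev i y\<^sub>j\<close> can be computed from the values \<open>a(c\<^sub>j\<^sup>2) ev i y\<close>.
\<close>

lemma separated_tensor:
  fixes Y :: "('m, 'r, 'y) bimod" and ev :: "'i \<Rightarrow> 'y \<Rightarrow> 'm"
  assumes q: "right_quasibasis n c \<gamma>" and Y: "bi_operators (carrier R) {} Y"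
    and Y_assoc: "\<And>r r' y. r \<in> carrier R \<Longrightarrow> r' \<in> carrier R \<Longrightarrow> y \<in> carrier Y \<Longrightarrow>
      lact Y (r \<otimes> r') y = lact Y r (lact Y r' y)"
    and Y_add: "\<And>y. y \<in> carrier Y \<Longrightarrow> additive R Y (\<lambda>r. lact Y r y)"
    and ev: "\<And>i. i \<in> I \<Longrightarrow> additive Y M (ev i)"
    and ev_lact: "\<And>i r y. i \<in> I \<Longrightarrow> r \<in> carrier R \<Longrightarrow> y \<in> carrier Y \<Longrightarrow> ev i (lact Y r y) = r \<otimes> ev i y"
    and ev_inj: "\<And>y y'. y \<in> carrier Y \<Longrightarrow> y' \<in> carrier Y \<Longrightarrow> (\<And>i. i \<in> I \<Longrightarrow> ev i y = ev i y') \<Longrightarrow> y = y'"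
    and z: "z \<in> carrier (tensor R X Y)" "z' \<in> carrier (tensor R X Y)"
    and eq: "\<And>m i. m \<in> carrier M \<Longrightarrow> i \<in> I \<Longrightarrow>
      tensor_lift M (\<lambda>a y. a m \<otimes> ev i y) z = tensor_lift M (\<lambda>a y. a m \<otimes> ev i y) z'"
  shows "z = z'"
proof -
  interpret XY: tensor_product R X Y by (rule tensor_product.intro[OF X_right Y])
  let ?T = "tensor R X Y"
  have q': "central (c j)" "\<gamma> j \<in> carrier E" if "j < n" for j
    using q that by (simp_all add: right_quasibasis_def)
  have Yr: "additive Y Y (lact Y r)" if "r \<in> carrier R" for r by (rule bi_operators_lact[OF Y that])
  define g where "g j a y = lact Y (right_coef (c j) a) y" for j a y
  have g: "balanced_map R X Y Y (g j)" if j: "j < n" for j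
    unfolding g_def
  proof (rule balanced_mapI)
    show "additive Y Y (lact Y (right_coef (c j) a))" if "a \<in> carrier X" for a
      using that by (simp add: Yr coef_closed q'[OF j])
    show "additive X Y (\<lambda>a. lact Y (right_coef (c j) a) y)" if "y \<in> carrier Y" for y
      using additive_comp[OF coef_additive(2)[OF q'(1)[OF j]] Y_add[OF that]] by simp
  qed (simp add: right_coef_tgt q'[OF j] coef_closed Y_assoc)
  define y where "y j w = tensor_lift Y (g j) w" for j w
  have y_add: "additive ?T Y (y j)" if "j < n" for j
    unfolding y_def by (rule XY.lift_additive(1)[OF g[OF that]])
  have ev_bal: "balanced_map R X Y M (\<lambda>a y. a m \<otimes> ev i y)" if "m \<in> carrier M" "i \<in> I" for m i
  proof (rule balanced_mapI)
    show "additive Y M (\<lambda>y. a m \<otimes> ev i y)" if "a \<in> carrier X" for a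
      using that \<open>m \<in> carrier M\<close> by (intro additive_comp[OF ev[OF \<open>i \<in> I\<close>] additive_left_mult]) simp
    show "additive X M (\<lambda>a. a m \<otimes> ev i y)" if "y \<in> carrier Y" for y
      using additive_comp[OF E_apply_additive[OF \<open>m \<in> carrier M\<close>] additive_right_mult[OF additive_closed[OF ev[OF \<open>i \<in> I\<close>] that]]]
      by simp
  qed (simp add: that ev_lact A.m_assoc additive_closed[OF ev])
  have ev_bal': "balanced_map R X Y M (\<lambda>a y. right_coef w a \<otimes> ev i y)" if w: "w \<in> carrier MM" and i: "i \<in> I" for w i
  proof -
    have "right_coef w a \<in> carrier M" if "a \<in> carrier E" for a
      unfolding right_coef_def by (rule additive_closed[OF N_lift_additive[OF coef_balanced(2)[OF that]] w])
    then have rc: "additive E M (right_coef w)"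
      by (intro additiveI E.A.abelian_group_axioms A.abelian_group_axioms) (simp_all add: coef_add[OF w])
    show ?thesis
    proof (rule balanced_mapI)
      show "additive Y M (\<lambda>y. right_coef w a \<otimes> ev i y)" if "a \<in> carrier X" for a
        using that by (intro additive_comp[OF ev[OF i] additive_left_mult]) (simp add: additive_closed[OF rc])
      show "additive X M (\<lambda>a. right_coef w a \<otimes> ev i y)" if "y \<in> carrier Y" for y
        using additive_comp[OF rc additive_right_mult[OF additive_closed[OF ev[OF i] that]]] by simp
    qed (simp add: i w right_coef_tgt ev_lact A.m_assoc additive_closed[OF ev] additive_closed[OF rc])
  qed
  \<comment> \<open>For a pure tensor \<open>w = x \<otimes> x'\<close> this is the hypothesis at \<open>x'\<close>, multiplied by \<open>x\<close>.\<close>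
  have ev_eq: "tensor_lift M (\<lambda>a y. right_coef w a \<otimes> ev i y) z = tensor_lift M (\<lambda>a y. right_coef w a \<otimes> ev i y) z'"
    if w: "w \<in> carrier MM" and i: "i \<in> I" for w i
  proof -
    have add: "additive MM M (\<lambda>w. tensor_lift M (\<lambda>a y. right_coef w a \<otimes> ev i y) z)" if "z \<in> carrier ?T" for z
    proof (rule XY.lift_param_additive[OF MM_group ev_bal' _ that])
      fix a y assume "a \<in> carrier X" "y \<in> carrier Y"
      then show "additive MM M (\<lambda>w. right_coef w a \<otimes> ev i y)"
        unfolding right_coef_def
        by (intro additive_comp[OF N_lift_additive[OF coef_balanced(2)] additive_right_mult] additive_closed[OF ev[OF i]]) simp_all
    qed (use i in simp_all)
    have pure: "tensor_lift M (\<lambda>a y. right_coef (tensM x x') a \<otimes> ev i y) z =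
        x \<otimes> tensor_lift M (\<lambda>a y. a x' \<otimes> ev i y) z"
      if x: "x \<in> carrier M" "x' \<in> carrier M" and z: "z \<in> carrier ?T" for x x' z
    proof -
      have "x \<otimes> tensor_lift M (\<lambda>a y. a x' \<otimes> ev i y) z = tensor_lift M (\<lambda>a y. x \<otimes> (a x' \<otimes> ev i y)) z"
        by (rule XY.lift_comp[OF ev_bal[OF x(2) i] additive_left_mult[OF x(1)] z])
      also have "\<dots> = tensor_lift M (\<lambda>a y. right_coef (tensM x x') a \<otimes> ev i y) z"
        by (rule XY.lift_cong[OF balanced_map_comp[OF ev_bal[OF x(2) i] additive_left_mult[OF x(1)]] _ z])
          (simp add: x right_coef_def N_lift_tens coef_balanced A.m_assoc additive_closed[OF ev[OF i]])
      finally show ?thesis ..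
    qed
    show ?thesis
      by (rule N_eq_on_tens[OF add[OF z(1)] add[OF z(2)] _ w]) (simp add: pure z eq i)
  qed
  have y_eq: "y j z = y j z'" if j: "j < n" for j
  proof (rule ev_inj)
    show "y j z \<in> carrier Y" "y j z' \<in> carrier Y" using z additive_closed[OF y_add[OF j]] by simp_all
    fix i assume i: "i \<in> I"
    have "ev i (y j w) = tensor_lift M (\<lambda>a y. right_coef (c j) a \<otimes> ev i y) w" if w: "w \<in> carrier ?T" for w
    proof -
      have "ev i (y j w) = tensor_lift M (\<lambda>a y. ev i (g j a y)) w"
        unfolding y_def by (rule XY.lift_comp[OF g[OF j] ev[OF i] w])
      also have "\<dots> = tensor_lift M (\<lambda>a y. right_coef (c j) a \<otimes> ev i y) w"
        by (rule XY.lift_cong[OF balanced_map_comp[OF g[OF j] ev[OF i]] _ w])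
          (simp add: g_def ev_lact i coef_closed q'[OF j])
      finally show ?thesis .
    qed
    then show "ev i (y j z) = ev i (y j z')" using ev_eq[OF _ i] z q'(1)[OF j] by simp
  qed
  have expand: "w = (\<Oplus>\<^bsub>?T\<^esub>j\<in>{..<n}. tens R X Y (\<gamma> j) (y j w))" if w: "w \<in> carrier ?T" for w
  proof -
    have ty: "additive Y ?T (tens R X Y a)" if "a \<in> carrier E" for a
      using XY.tens_balanced_map that unfolding balanced_map_def by simp
    have ta: "additive E ?T (\<lambda>a. tens R X Y a y)" if "y \<in> carrier Y" for y
      using XY.tens_balanced_map that unfolding balanced_map_def by simp
    show ?thesis
    proof (rule XY.additive_eq_on_tens[where g = "\<lambda>w. w" and h = "\<lambda>w. \<Oplus>\<^bsub>?T\<^esub>j\<in>{..<n}. tens R X Y (\<gamma> j) (y j w)", OF _ _ _ w])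
      show "additive ?T ?T (\<lambda>w. w)" by (rule additive_ident[OF XY.tensor_abelian_group])
      show "additive ?T ?T (\<lambda>w. \<Oplus>\<^bsub>?T\<^esub>j\<in>{..<n}. tens R X Y (\<gamma> j) (y j w))"
        by (rule additive_finsum[OF XY.tensor_abelian_group XY.tensor_abelian_group])
          (rule additive_comp[OF y_add ty]; simp add: q')
      fix a v assume av: "a \<in> carrier X" "v \<in> carrier Y"
      then have a: "a \<in> carrier E" by simp
      let ?G = "\<lambda>j. End_tgt M (right_coef (c j) a) \<otimes>\<^bsub>E\<^esub> \<gamma> j"
      have G: "?G j \<in> carrier E" "right_coef (c j) a \<in> carrier R" if "j < n" for j
        using a q'[OF that] by (simp_all add: coef_closed)
      have "tens R X Y a v = tens R X Y (\<Oplus>\<^bsub>E\<^esub>j\<in>{..<n}. ?G j) v"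
        by (simp add: right_dual_basis[OF q a, symmetric])
      also have "\<dots> = (\<Oplus>\<^bsub>?T\<^esub>j\<in>{..<n}. tens R X Y (?G j) v)"
        by (rule additive_sum[OF ta[OF av(2)]]) (simp add: Pi_iff G)
      also have "\<dots> = (\<Oplus>\<^bsub>?T\<^esub>j\<in>{..<n}. tens R X Y (\<gamma> j) (y j (tens R X Y a v)))"
      proof (rule XY.tensor.finsum_cong'[OF refl])
        show "tens R X Y (?G j) v = tens R X Y (\<gamma> j) (y j (tens R X Y a v))" if "j \<in> {..<n}" for j
        proof -
          have j: "j < n" using that by simp
          have "y j (tens R X Y a v) = lact Y (right_coef (c j) a) v"
            unfolding y_def by (simp add: XY.lift_tens[OF g[OF j] av] g_def)
          then show ?thesis using XY.tens_balanced[of "\<gamma> j" "right_coef (c j) a" v] G[OF j] q'[OF j] av by simp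
        qed
        show "(\<lambda>j. tens R X Y (\<gamma> j) (y j (tens R X Y a v))) \<in> {..<n} \<rightarrow> carrier ?T"
          using av by (auto intro!: XY.tens_closed additive_closed[OF y_add] simp: q')
      qed
      finally show "tens R X Y a v = (\<Oplus>\<^bsub>?T\<^esub>j\<in>{..<n}. tens R X Y (\<gamma> j) (y j (tens R X Y a v)))" .
    qed
  qed
  have "z = (\<Oplus>\<^bsub>?T\<^esub>j\<in>{..<n}. tens R X Y (\<gamma> j) (y j z))" by (rule expand[OF z(1)])
  also have "\<dots> = (\<Oplus>\<^bsub>?T\<^esub>j\<in>{..<n}. tens R X Y (\<gamma> j) (y j z'))"
    by (rule XY.tensor.finsum_cong'[OF refl])
      (use z in \<open>simp_all add: Pi_iff y_eq XY.tens_closed additive_closed[OF y_add] q'\<close>)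
  also have "\<dots> = z'" by (rule expand[OF z(2), symmetric])
  finally show ?thesis .
qed

lemma X_assoc: "r \<in> carrier R \<Longrightarrow> r' \<in> carrier R \<Longrightarrow> a \<in> carrier E \<Longrightarrow>
    End_src M (r \<otimes> r') \<otimes>\<^bsub>E\<^esub> a = End_src M r \<otimes>\<^bsub>E\<^esub> (End_src M r' \<otimes>\<^bsub>E\<^esub> a)"
  using R.A.m_closed[of r r'] by (intro E_eqI) (simp_all add: A.m_assoc)

lemma X_add: "a \<in> carrier E \<Longrightarrow> additive R E (\<lambda>r. End_src M r \<otimes>\<^bsub>E\<^esub> a)"
  by (rule additive_comp[OF src_additive E.additive_right_mult])

text \<open>
  \<open>A\<close> itself is separated by the evaluations at the elements of \<open>M\<close>.
\<close>

lemma pairing_inject: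
  assumes q: "right_quasibasis n c \<gamma>" and z: "z \<in> carrier X2" "z' \<in> carrier X2"
    and eq: "\<And>m m'. m \<in> carrier M \<Longrightarrow> m' \<in> carrier M \<Longrightarrow> pairing z m m' = pairing z' m m'"
  shows "z = z'"
proof (rule separated_tensor[OF q X_left, where I = "carrier M" and ev = "\<lambda>m a. a m"])
  show "y = y'" if "y \<in> carrier X" "y' \<in> carrier X" "\<And>i. i \<in> carrier M \<Longrightarrow> y i = y' i" for y y'
    using that by (intro E_eqI) simp_all
qed (use z eq in \<open>simp_all add: X_assoc X_add E_apply_additive pairing_def\<close>)

text \<open>
  The analogous function of three elements of \<open>M\<close> for \<open>A \<otimes>\<^sub>R (A \<otimes>\<^sub>R A)\<close>, where coassociativity is
  tested.
\<close>

definition triple_pairing where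
  "triple_pairing z m m' m'' = tensor_lift M (\<lambda>a y. a m \<otimes> pairing y m' m'') z"

lemma triple_pairing_inject:
  assumes q: "right_quasibasis n c \<gamma>" and z: "z \<in> carrier (tensor R X X2)" "z' \<in> carrier (tensor R X X2)"
    and eq: "\<And>m m' m''. m \<in> carrier M \<Longrightarrow> m' \<in> carrier M \<Longrightarrow> m'' \<in> carrier M \<Longrightarrow>
       triple_pairing z m m' m'' = triple_pairing z' m m' m''"
  shows "z = z'"
proof (rule separated_tensor[OF q bi_operators_left[OF X2_operators], where I = "carrier M \<times> carrier M"
      and ev = "\<lambda>p y. pairing y (fst p) (snd p)"])
  show "lact X2 (r \<otimes> r') y = lact X2 r (lact X2 r' y)"
    if "r \<in> carrier R" "r' \<in> carrier R" "y \<in> carrier X2" for r r' y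
    using that R.A.m_closed[of r r'] additive_closed[OF bi_operators_lact[OF X2_operators]]
    by (intro pairing_inject[OF q]) (simp_all add: pairing_lact A.m_assoc)
  show "additive R X2 (\<lambda>r. lact X2 r y)" if "y \<in> carrier X2" for y
  proof (rule additiveI)
    show "lact X2 (r \<oplus>\<^bsub>R\<^esub> r') y = lact X2 r y \<oplus>\<^bsub>X2\<^esub> lact X2 r' y" if "r \<in> carrier R" "r' \<in> carrier R" for r r'
      using that \<open>y \<in> carrier X2\<close> R.A.a_closed[of r r'] additive_closed[OF bi_operators_lact[OF X2_operators]]
      by (intro pairing_inject[OF q])
        (simp_all add: pairing_lact A.l_distr additive_add[OF pairing_additive] XX.tensor.a_closed)
  qed (use that additive_closed[OF bi_operators_lact[OF X2_operators]] in
      \<open>simp_all add: R.A.abelian_group_axioms XX.tensor_abelian_group\<close>)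
  show "y = y'" if "y \<in> carrier X2" "y' \<in> carrier X2"
    "\<And>i. i \<in> carrier M \<times> carrier M \<Longrightarrow> pairing y (fst i) (snd i) = pairing y' (fst i) (snd i)" for y y'
    using that(3)[of "(m, m')" for m m'] by (intro pairing_inject[OF q that(1,2)]) simp
qed (use z eq in \<open>auto simp: pairing_additive pairing_lact triple_pairing_def\<close>)

text \<open>
  The tensor \<open>d = \<Sum>\<^sub>i a(- b\<^sub>i\<^sup>1) b\<^sub>i\<^sup>2 \<otimes> \<beta>\<^sub>i\<close> is a preimage of \<open>m \<otimes> m' \<mapsto> a(m m')\<close>, because
  \<open>m \<otimes> m' \<otimes> 1 = \<Sum>\<^sub>i m \<otimes> b\<^sub>i \<beta>\<^sub>i(m')\<close>.
\<close>

lemma coproduct_exists: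
  assumes q: "left_quasibasis n b \<beta>" and a: "a \<in> carrier E"
  obtains d where "d \<in> carrier X2" "\<And>m m'. m \<in> carrier M \<Longrightarrow> m' \<in> carrier M \<Longrightarrow> pairing d m m' = a (m \<otimes> m')"
proof -
  have q': "central (b i)" "\<beta> i \<in> carrier E" if "i < n" for i
    using q that by (simp_all add: left_quasibasis_def)
  let ?f = "\<lambda>m x y. a (m \<otimes> x) \<otimes> y"
  have f: "N_balanced (?f m)" if m: "m \<in> carrier M" for m
  proof (rule N_balancedI)
    show "additive M M (\<lambda>x. ?f m x y)" if "y \<in> carrier M" for y
      by (rule additive_comp[OF additive_comp[OF additive_left_mult[OF m] E_additive[OF a]] additive_right_mult[OF that]])
    fix x k y assume x: "x \<in> carrier M" and k: "k \<in> N" and y: "y \<in> carrier M"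
    have "m \<otimes> (x \<otimes> k) = m \<otimes> x \<otimes> k" using m x k by (simp add: A.m_assoc)
    then show "?f m (x \<otimes> k) y = ?f m x (k \<otimes> y)"
      using E_right_N[OF a k A.m_closed[OF m x]] m x k y a by (simp add: A.m_assoc)
  qed (use m a in \<open>simp add: additive_left_mult\<close>)
  define F where "F i = (\<lambda>m\<in>carrier M. tensor_lift M (?f m) (b i))" for i
  have F: "F i \<in> carrier E" if i: "i < n" for i
    unfolding F_def
  proof (rule E_restrictI)
    note b = central_closed[OF q'(1)[OF i]]
    have b': "b i \<in> carrier (tensor (M\<lparr>carrier := N\<rparr>) Mreg Mreg)" using b by (simp add: MtensM_def)
    show "additive M M (\<lambda>m. tensor_lift M (?f m) (b i))"
    proof (rule MM.lift_param_additive[OF A.abelian_group_axioms f _ b'])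
      fix x y assume xy: "x \<in> carrier Mreg" "y \<in> carrier Mreg"
      show "additive M M (\<lambda>m. ?f m x y)"
        using additive_comp[OF additive_comp[OF additive_right_mult[of x] E_additive[OF a]] additive_right_mult[of y]] xy
        by simp
    qed
    fix k m assume k: "k \<in> N" and m: "m \<in> carrier M"
    show "tensor_lift M (?f (k \<otimes> m)) (b i) = k \<otimes> tensor_lift M (?f m) (b i)"
      by (rule N_lift_cong_additive[OF f[OF m] f[OF A.m_closed] additive_left_mult _ b, symmetric])
        (use k m a in \<open>simp_all add: A.m_assoc E_left_N\<close>)
    show "tensor_lift M (?f (m \<otimes> k)) (b i) = tensor_lift M (?f m) (b i) \<otimes> k"
      by (rule central_lift[OF f[OF m] f[OF A.m_closed] q'(1)[OF i] k])
        (use k m a in \<open>simp_all add: A.m_assoc\<close>)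
  qed
  let ?d = "\<Oplus>\<^bsub>X2\<^esub>i\<in>{..<n}. tensX (F i) (\<beta> i)"
  have t: "(\<lambda>i. tensX (F i) (\<beta> i)) \<in> {..<n} \<rightarrow> carrier X2" by (simp add: Pi_iff tensX_closed F q')
  show thesis
  proof (rule that[of ?d])
    show "?d \<in> carrier X2" by (rule XX.tensor.finsum_closed[OF t])
    fix m m' assume m: "m \<in> carrier M" "m' \<in> carrier M"
    have "pairing ?d m m' = (\<Oplus>i\<in>{..<n}. pairing (tensX (F i) (\<beta> i)) m m')"
      by (rule additive_sum[OF pairing_additive[OF m] t])
    also have "\<dots> = (\<Oplus>i\<in>{..<n}. tensor_lift M (?f m) (b i) \<otimes> \<beta> i m')"
      by (rule A.finsum_cong') (use m in \<open>simp_all add: Pi_iff F q' F_def[symmetric] additive_closed[OF N_lift_additive[OF f]],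
          simp add: F F_def q'\<close>)
    also have "\<dots> = ?f m m' \<one>"
      by (rule left_quasibasis_expand[OF q f[OF m(1)] m(2), symmetric]) (use m a in \<open>simp add: A.m_assoc\<close>)
    finally show "pairing ?d m m' = a (m \<otimes> m')" using m a by simp
  qed
qed

text \<open>
  The comultiplication is defined by the inverse of a map with values in \<open>Hom\<^sub>N\<^sub>-\<^sub>N(M \<otimes>\<^sub>N M, M)\<close>; at
  \<open>m \<otimes> m'\<close> its values are those of the pairing.
\<close>

abbreviation H where "H \<equiv> hom_group N N MM Mreg"
abbreviation tens_hom where
  "tens_hom a a' \<equiv> \<lambda>w\<in>carrier MM. tensor_lift M (\<lambda>m m'. a m \<otimes> a' m') w"

lemma product_balanced:
  "a \<in> carrier E \<Longrightarrow> a' \<in> carrier E \<Longrightarrow> N_balanced (\<lambda>m m'. a m \<otimes> a' m')"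
  by (rule N_balancedI) (simp_all add: additive_comp[OF E_additive additive_left_mult]
    additive_comp[OF E_additive additive_right_mult] E_left_N E_right_N A.m_assoc)

lemma H_group: "abelian_group H"
  by (intro abelian_group_hom_group bi_operators_subset[OF MM_operators] Mreg_operators N_carrier)

lemma H_eval_additive: "w \<in> carrier MM \<Longrightarrow> additive H M (\<lambda>h. h w)"
  using H_group A.abelian_group_axioms by (auto intro!: additiveI simp: bimod_hom_def)

lemma tens_hom_closed:
  assumes a: "a \<in> carrier E" "a' \<in> carrier E" shows "tens_hom a a' \<in> carrier H"
proof -
  note f = product_balanced[OF a]
  have "tensor_lift M (\<lambda>m m'. a m \<otimes> a' m') (lact MM k w) = k \<otimes> tensor_lift M (\<lambda>m m'. a m \<otimes> a' m') w"
    if k: "k \<in> N" and w: "w \<in> carrier MM" for k w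
  proof -
    have g: "N_balanced (\<lambda>m m'. k \<otimes> (a m \<otimes> a' m'))"
      by (rule balanced_map_comp[OF f additive_left_mult]) (simp add: k)
    have "tensor_lift M (\<lambda>m m'. a m \<otimes> a' m') (lact MM k w) = tensor_lift M (\<lambda>m m'. k \<otimes> (a m \<otimes> a' m')) w"
      by (rule N_lift_lact[OF f g _ _ w]) (simp_all add: k a E_left_N A.m_assoc)
    also have "\<dots> = k \<otimes> tensor_lift M (\<lambda>m m'. a m \<otimes> a' m') w"
      by (rule N_lift_cong_additive[OF f g additive_left_mult refl w, symmetric]) (simp add: k)
    finally show ?thesis .
  qed
  moreover have "tensor_lift M (\<lambda>m m'. a m \<otimes> a' m') (ract MM w k) = tensor_lift M (\<lambda>m m'. a m \<otimes> a' m') w \<otimes> k"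
    if k: "k \<in> N" and w: "w \<in> carrier MM" for k w
    by (rule N_lift_ract[OF f _ _ w]) (simp_all add: k a E_right_N A.m_assoc)
  ultimately have "bimod_hom N N MM Mreg (tensor_lift M (\<lambda>m m'. a m \<otimes> a' m'))"
    using additive_closed[OF N_lift_additive[OF f]] additive_add[OF N_lift_additive[OF f]]
    by (simp add: bimod_hom_def Pi_iff)
  then show ?thesis
    using bimod_hom_restrict[OF bi_operators_subset[OF MM_operators N_carrier N_carrier]] by simp
qed

lemma H_eqI:
  assumes "h \<in> carrier H" "h' \<in> extensional (carrier MM)" "additive MM M h'"
    and "\<And>m m'. m \<in> carrier M \<Longrightarrow> m' \<in> carrier M \<Longrightarrow> h (tensM m m') = h' (tensM m m')"
  shows "h = h'"
proof (rule extensionalityI)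
  have h: "additive MM M h"
    using assms(1) bimod_hom_additive[of N N MM Mreg h] MM_group A.abelian_group_axioms by simp
  show "h w = h' w" if "w \<in> carrier MM" for w
    by (rule N_eq_on_tens[OF h assms(3) assms(4) that])
qed (use assms in simp_all)

lemma tens_hom_balanced: "balanced_map R X X H tens_hom"
proof (rule R_balancedI)
  have ext: "additive MM M (\<lambda>w\<in>carrier MM. f w)" if "additive MM M f" for f
    using that MM_group by (auto simp: additive_def abelian_group.axioms intro!: additiveI)
      (simp add: abelian_group_def abelian_monoid.a_closed)
  have Ha: "additive MM M h" if "h \<in> carrier H" for h
    using that bimod_hom_additive[of N N MM Mreg h] MM_group A.abelian_group_axioms by simp
  interpret Hg: abelian_group H by (rule H_group)
  fix a assume a: "a \<in> carrier E"
  show "additive E H (tens_hom a)"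
  proof (rule additiveI[OF E.A.abelian_group_axioms H_group])
    fix x y assume xy: "x \<in> carrier E" "y \<in> carrier E"
    show c: "tens_hom a x \<in> carrier H" by (rule tens_hom_closed[OF a xy(1)])
    have "tens_hom a x \<oplus>\<^bsub>H\<^esub> tens_hom a y \<in> carrier H"
      by (rule Hg.a_closed[OF tens_hom_closed[OF a xy(1)] tens_hom_closed[OF a xy(2)]])
    then show "tens_hom a (x \<oplus>\<^bsub>E\<^esub> y) = tens_hom a x \<oplus>\<^bsub>H\<^esub> tens_hom a y"
      using tens_hom_closed[OF a E.A.a_closed[OF xy]]
      by (intro H_eqI[OF _ _ Ha]) (simp_all add: tensM_closed N_lift_tens product_balanced a xy A.r_distr)
  qed
  show "additive E H (\<lambda>a'. tens_hom a' a)"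
  proof (rule additiveI[OF E.A.abelian_group_axioms H_group])
    fix x y assume xy: "x \<in> carrier E" "y \<in> carrier E"
    show c: "tens_hom x a \<in> carrier H" by (rule tens_hom_closed[OF xy(1) a])
    have "tens_hom x a \<oplus>\<^bsub>H\<^esub> tens_hom y a \<in> carrier H"
      by (rule Hg.a_closed[OF tens_hom_closed[OF xy(1) a] tens_hom_closed[OF xy(2) a]])
    then show "tens_hom (x \<oplus>\<^bsub>E\<^esub> y) a = tens_hom x a \<oplus>\<^bsub>H\<^esub> tens_hom y a"
      using tens_hom_closed[OF E.A.a_closed[OF xy] a]
      by (intro H_eqI[OF _ _ Ha]) (simp_all add: tensM_closed N_lift_tens product_balanced a xy A.l_distr)
  qed
  fix r a' assume r: "r \<in> carrier R" and a': "a' \<in> carrier E"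
  have c: "tens_hom (End_tgt M r \<otimes>\<^bsub>E\<^esub> a) a' \<in> carrier H" "tens_hom a (End_src M r \<otimes>\<^bsub>E\<^esub> a') \<in> carrier H"
    by (intro tens_hom_closed E.A.m_closed tgt_closed src_closed a a' r)+
  show "tens_hom (End_tgt M r \<otimes>\<^bsub>E\<^esub> a) a' = tens_hom a (End_src M r \<otimes>\<^bsub>E\<^esub> a')"
    using c(2) by (intro H_eqI[OF c(1) _ Ha[OF c(2)]])
      (simp_all add: tensM_closed N_lift_tens product_balanced a a' r A.m_assoc)
qed

lemma End_square_map_eq: "End_square_map M N = tensor_lift H tens_hom"
  unfolding End_square_map_def ..

lemma End_square_map_tens:
  assumes z: "z \<in> carrier X2" and m: "m \<in> carrier M" "m' \<in> carrier M"
  shows "End_square_map M N z (tensM m m') = pairing z m m'"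
proof -
  have "End_square_map M N z (tensM m m') = tensor_lift M (\<lambda>a a'. tens_hom a a' (tensM m m')) z"
    unfolding End_square_map_eq
    by (rule XX.lift_comp[OF tens_hom_balanced H_eval_additive[OF tensM_closed[OF m]] z])
  also have "\<dots> = pairing z m m'"
    unfolding pairing_def
    by (rule XX.lift_cong[OF balanced_map_comp[OF tens_hom_balanced H_eval_additive[OF tensM_closed[OF m]]] _ z])
      (simp add: tensM_closed m N_lift_tens product_balanced)
  finally show ?thesis .
qed

end

locale depth_two_extension = algebra_extension K M N
  for K :: "('k, 'q) ring_scheme" and M :: "('k, 'm) module" (structure) and N :: "'m set" +
  assumes depth_two: "depth_two M N"
begin

abbreviation \<AA> where "\<AA> \<equiv> End_bialgebroid M N"
abbreviation \<gamma> where "\<gamma> \<equiv> comul \<AA>"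

lemma End_bialgebroid_simps [simp]:
  "talg \<AA> = E" "balg \<AA> = R" "src \<AA> = End_src M" "tgt \<AA> = End_tgt M" "counit \<AA> a = a \<one>"
  by (simp_all add: End_bialgebroid_def)

lemma pairing_eqI:
  assumes "z \<in> carrier X2" "z' \<in> carrier X2"
    and "\<And>m m'. m \<in> carrier M \<Longrightarrow> m' \<in> carrier M \<Longrightarrow> pairing z m m' = pairing z' m m'"
  shows "z = z'"
proof -
  obtain n c g where "right_quasibasis n c g"
    using depth_two right_quasibasis_exists unfolding depth_two_def by metis
  then show ?thesis by (rule pairing_inject[OF _ assms])
qed

lemma triple_pairing_eqI:
  assumes "z \<in> carrier (tensor R X X2)" "z' \<in> carrier (tensor R X X2)"
    and "\<And>m m' m''. m \<in> carrier M \<Longrightarrow> m' \<in> carrier M \<Longrightarrow> m'' \<in> carrier M \<Longrightarrow>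
       triple_pairing z m m' m'' = triple_pairing z' m m' m''"
  shows "z = z'"
proof -
  obtain n c g where "right_quasibasis n c g"
    using depth_two right_quasibasis_exists unfolding depth_two_def by metis
  then show ?thesis by (rule triple_pairing_inject[OF _ assms])
qed

text \<open>
  The inverse of an injective map has a meaning only on the image; here the existence of a preimage
  enters.
\<close>

lemma comul_E:
  assumes a: "a \<in> carrier E"
  shows "\<gamma> a \<in> carrier X2"
    and "\<And>m m'. m \<in> carrier M \<Longrightarrow> m' \<in> carrier M \<Longrightarrow> pairing (\<gamma> a) m m' = a (m \<otimes> m')"
proof -
  obtain n b \<beta> where "left_quasibasis n b \<beta>"
    using depth_two left_quasibasis_exists unfolding depth_two_def by metis
  then obtain d where d: "d \<in> carrier X2"
    "\<And>m m'. m \<in> carrier M \<Longrightarrow> m' \<in> carrier M \<Longrightarrow> pairing d m m' = a (m \<otimes> m')"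
    by (rule coproduct_exists[OF _ a]) blast
  have inj: "inj_on (End_square_map M N) (carrier X2)"
    by (rule inj_onI, rule pairing_eqI) (simp_all flip: End_square_map_tens)
  have f: "N_balanced (\<lambda>m m'. a (m \<otimes> m'))"
    by (rule N_balancedI) (simp_all add: additive_comp[OF additive_left_mult E_additive[OF a]]
        additive_comp[OF additive_right_mult E_additive[OF a]] A.m_assoc)
  let ?f = "\<lambda>z\<in>carrier MM. tensor_lift M (\<lambda>m m'. a (m \<otimes> m')) z"
  have "End_square_map M N d = ?f"
  proof (rule H_eqI)
    show "End_square_map M N d \<in> carrier H"
      unfolding End_square_map_eq by (rule XX.lift_closed[OF tens_hom_balanced d(1)])
    note fa = N_lift_additive[OF f]
    interpret MMg: abelian_group MM by (rule MM_group)
    show "additive MM M ?f"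
      by (rule additiveI) (simp_all add: MM_group A.abelian_group_axioms additive_closed[OF fa] additive_add[OF fa])
  qed (simp_all add: End_square_map_tens d tensM_closed N_lift_tens[OF f])
  then have "\<gamma> a = d"
    unfolding End_bialgebroid_def by (simp add: End_square_eq the_inv_into_f_eq[OF inj _ d(1)])
  then show "\<gamma> a \<in> carrier X2"
    "\<And>m m'. m \<in> carrier M \<Longrightarrow> m' \<in> carrier M \<Longrightarrow> pairing (\<gamma> a) m m' = a (m \<otimes> m')"
    using d by simp_all
qed

end


context depth_two_extension
begin

sublocale XX2: tensor_product R X X2
  by (rule tensor_product.intro[OF X_right bi_operators_left[OF X2_operators]])

sublocale X2X: tensor_product R X2 X
  by (rule tensor_product.intro[OF bi_operators_right[OF X2_operators] X_left])

lemma comul_additive: "additive E X2 \<gamma>"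
proof (rule additiveI)
  fix a a' assume a: "a \<in> carrier E" "a' \<in> carrier E"
  show "\<gamma> (a \<oplus>\<^bsub>E\<^esub> a') = \<gamma> a \<oplus>\<^bsub>X2\<^esub> \<gamma> a'"
    using a by (intro pairing_eqI) (simp_all add: comul_E additive_add[OF pairing_additive] XX.tensor.a_closed)
qed (simp_all add: comul_E E.A.abelian_group_axioms XX.tensor_abelian_group)

lemma comul_src:
  "r \<in> carrier R \<Longrightarrow> a \<in> carrier E \<Longrightarrow> \<gamma> (End_src M r \<otimes>\<^bsub>E\<^esub> a) = lact X2 r (\<gamma> a)"
  by (intro pairing_eqI)
    (simp_all add: comul_E pairing_lact additive_closed[OF bi_operators_lact[OF X2_operators]])

lemma comul_tgt:
  "r \<in> carrier R \<Longrightarrow> a \<in> carrier E \<Longrightarrow> \<gamma> (End_tgt M r \<otimes>\<^bsub>E\<^esub> a) = ract X2 (\<gamma> a) r"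
  by (intro pairing_eqI)
    (simp_all add: comul_E pairing_ract additive_closed[OF bi_operators_ract[OF X2_operators]])

lemma counit_closed: "a \<in> carrier E \<Longrightarrow> a \<one> \<in> carrier R"
  using E_left_N[of a _ "\<one>"] E_right_N[of a _ "\<one>"] by (simp add: centralizer_iff)

lemma triple_pairing_balanced:
  assumes m: "m \<in> carrier M" "m' \<in> carrier M" "m'' \<in> carrier M"
  shows "balanced_map R X X2 M (\<lambda>a y. a m \<otimes> pairing y m' m'')"
proof (rule balanced_mapI)
  show "additive X2 M (\<lambda>y. a m \<otimes> pairing y m' m'')" if "a \<in> carrier X" for a
    using that m by (intro additive_comp[OF pairing_additive additive_left_mult]) simp_all
  show "additive X M (\<lambda>a. a m \<otimes> pairing y m' m'')" if "y \<in> carrier X2" for y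
    using additive_comp[OF E_apply_additive additive_right_mult[OF pairing_closed[OF that]]] m by simp
qed (use m in \<open>simp add: pairing_lact A.m_assoc\<close>)

lemma triple_pairing_tens:
  assumes "a \<in> carrier E" "y \<in> carrier X2" "m \<in> carrier M" "m' \<in> carrier M" "m'' \<in> carrier M"
  shows "triple_pairing (tens R X X2 a y) m m' m'' = a m \<otimes> pairing y m' m''"
  unfolding triple_pairing_def
  using XX2.lift_tens[OF triple_pairing_balanced[OF assms(3-5)], of a y] assms by simp

lemma triple_pairing_additive:
  assumes "m \<in> carrier M" "m' \<in> carrier M" "m'' \<in> carrier M"
  shows "additive (tensor R X X2) M (\<lambda>z. triple_pairing z m m' m'')"
  unfolding triple_pairing_def by (rule XX2.lift_additive(1)[OF triple_pairing_balanced[OF assms]])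

text \<open>
  Both sides correspond to \<open>m \<otimes> m' \<otimes> m'' \<mapsto> x(m m' m'')\<close>.
\<close>

lemma comul_coassoc:
  assumes x: "x \<in> carrier E"
  shows "tensor_assoc R X X X (tensor_map R X2 X \<gamma> id (\<gamma> x)) = tensor_map R X X2 id \<gamma> (\<gamma> x)"
proof (rule triple_pairing_eqI)
  let ?T = "tensor R X X2" and ?T' = "tensor R X2 X"
  note assoc = tensor_assoc_additive[OF X_right X_operators X_left]
  have f: "balanced_map R X X ?T' (\<lambda>u v. tens R X2 X (\<gamma> u) (id v))"
    by (rule X2X.tensor_map_balanced)
      (simp_all add: comul_additive comul_tgt id_def additive_ident E.A.abelian_group_axioms)
  have g: "balanced_map R X X ?T (\<lambda>u v. tens R X X2 (id u) (\<gamma> v))"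
    by (rule XX2.tensor_map_balanced)
      (simp_all add: comul_additive comul_src id_def additive_ident E.A.abelian_group_axioms)
  note \<gamma>x = comul_E(1)[OF x]
  show "tensor_assoc R X X X (tensor_map R X2 X \<gamma> id (\<gamma> x)) \<in> carrier ?T"
    unfolding tensor_map_def by (rule additive_closed[OF assoc(1) XX.lift_closed[OF f \<gamma>x]])
  show "tensor_map R X X2 id \<gamma> (\<gamma> x) \<in> carrier ?T"
    unfolding tensor_map_def by (rule XX.lift_closed[OF g \<gamma>x])
  fix m m' m'' assume m: "m \<in> carrier M" "m' \<in> carrier M" "m'' \<in> carrier M"
  note tp = triple_pairing_additive[OF m]
  have pure: "triple_pairing (tensor_assoc R X X X (tens R X2 X (\<gamma> u) v)) m m' m'' = u (m \<otimes> m') \<otimes> v m''"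
    if u: "u \<in> carrier E" and v: "v \<in> carrier E" for u v
  proof -
    have vX: "v \<in> carrier X" using v by simp
    have h: "additive M M (\<lambda>y. y \<otimes> v m'')" using v m by (simp add: additive_right_mult)
    have "triple_pairing (tensor_assoc R X X X (tens R X2 X (\<gamma> u) v)) m m' m'' =
        triple_pairing (tensor_lift ?T (\<lambda>x y. tens R X X2 x (tensX y v)) (\<gamma> u)) m m' m''"
      by (simp only: assoc(3)[OF comul_E(1)[OF u] vX])
    also have "\<dots> = tensor_lift M (\<lambda>x y. triple_pairing (tens R X X2 x (tensX y v)) m m' m'') (\<gamma> u)"
      by (rule XX.lift_comp[OF assoc(2)[OF vX] tp comul_E(1)[OF u]])
    also have "\<dots> = tensor_lift M (\<lambda>x y. (x m \<otimes> y m') \<otimes> v m'') (\<gamma> u)"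
      by (rule XX.lift_cong[OF balanced_map_comp[OF assoc(2)[OF vX] tp] _ comul_E(1)[OF u]])
        (simp add: triple_pairing_tens tensX_closed m v A.m_assoc)
    also have "\<dots> = pairing (\<gamma> u) m m' \<otimes> v m''"
      unfolding pairing_def
      by (rule XX.lift_comp[OF pairing_balanced[OF m(1,2)] h comul_E(1)[OF u], symmetric])
    finally show ?thesis using u m by (simp add: comul_E)
  qed
  have "triple_pairing (tensor_assoc R X X X (tensor_map R X2 X \<gamma> id (\<gamma> x))) m m' m'' =
      tensor_lift M (\<lambda>u v. triple_pairing (tensor_assoc R X X X (tens R X2 X (\<gamma> u) (id v))) m m' m'') (\<gamma> x)"
    unfolding tensor_map_def by (rule XX.lift_comp[OF f additive_comp[OF assoc(1) tp] \<gamma>x])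
  also have "\<dots> = tensor_lift M (\<lambda>u v. u (m \<otimes> m') \<otimes> v m'') (\<gamma> x)"
    by (rule XX.lift_cong[OF balanced_map_comp[OF f additive_comp[OF assoc(1) tp]] _ \<gamma>x]) (simp add: pure)
  also have "\<dots> = x (m \<otimes> m' \<otimes> m'')"
    using comul_E(2)[OF x A.m_closed[OF m(1,2)] m(3)] unfolding pairing_def .
  finally have l: "triple_pairing (tensor_assoc R X X X (tensor_map R X2 X \<gamma> id (\<gamma> x))) m m' m'' =
      x (m \<otimes> m' \<otimes> m'')" .
  have "triple_pairing (tensor_map R X X2 id \<gamma> (\<gamma> x)) m m' m'' =
      tensor_lift M (\<lambda>u v. triple_pairing (tens R X X2 (id u) (\<gamma> v)) m m' m'') (\<gamma> x)"
    unfolding tensor_map_def by (rule XX.lift_comp[OF g tp \<gamma>x])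
  also have "\<dots> = tensor_lift M (\<lambda>u v. u m \<otimes> v (m' \<otimes> m'')) (\<gamma> x)"
    by (rule XX.lift_cong[OF balanced_map_comp[OF g tp] _ \<gamma>x]) (simp add: triple_pairing_tens comul_E m)
  also have "\<dots> = x (m \<otimes> (m' \<otimes> m''))"
    using comul_E(2)[OF x m(1) A.m_closed[OF m(2,3)]] unfolding pairing_def .
  finally show "triple_pairing (tensor_assoc R X X X (tensor_map R X2 X \<gamma> id (\<gamma> x))) m m' m'' =
      triple_pairing (tensor_map R X X2 id \<gamma> (\<gamma> x)) m m' m''"
    using l m by (simp add: A.m_assoc)
qed

text \<open>
  At \<open>m\<close> the left-hand sides have the values \<open>x(1 m)\<close> and \<open>x(m 1)\<close>.
\<close>

lemma comul_counit:
  assumes x: "x \<in> carrier E"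
  shows "tensor_lift E (\<lambda>u v. End_src M (u \<one>) \<otimes>\<^bsub>E\<^esub> v) (\<gamma> x) = x"
    and "tensor_lift E (\<lambda>u v. End_tgt M (v \<one>) \<otimes>\<^bsub>E\<^esub> u) (\<gamma> x) = x"
proof -
  note \<gamma>x = comul_E(1)[OF x]
  have cu: "additive E R (\<lambda>u. u \<one>)"
    by (intro additiveI) (simp_all add: counit_closed E.A.abelian_group_axioms R.A.abelian_group_axioms)
  have s: "additive E E (\<lambda>u. End_src M (u \<one>))" and t: "additive E E (\<lambda>u. End_tgt M (u \<one>))"
    by (rule additive_comp[OF cu src_additive] additive_comp[OF cu tgt_additive])+
  have R1: "r \<otimes> u \<one> \<in> carrier R" "u \<one> \<otimes> r \<in> carrier R" if "r \<in> carrier R" "u \<in> carrier E" for r u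
    using R.A.m_closed[OF that(1) counit_closed[OF that(2)]] R.A.m_closed[OF counit_closed[OF that(2)] that(1)] by simp_all
  have f: "balanced_map R X X E (\<lambda>u v. End_src M (u \<one>) \<otimes>\<^bsub>E\<^esub> v)"
  proof (rule R_balancedI)
    show "additive E E (\<lambda>v. End_src M (u \<one>) \<otimes>\<^bsub>E\<^esub> v)" if "u \<in> carrier E" for u
      by (rule E.additive_left_mult) (simp add: that counit_closed)
    show "additive E E (\<lambda>u. End_src M (u \<one>) \<otimes>\<^bsub>E\<^esub> v)" if "v \<in> carrier E" for v
      by (rule additive_comp[OF s E.additive_right_mult[OF that]])
    show "End_src M ((End_tgt M r \<otimes>\<^bsub>E\<^esub> u) \<one>) \<otimes>\<^bsub>E\<^esub> v = End_src M (u \<one>) \<otimes>\<^bsub>E\<^esub> (End_src M r \<otimes>\<^bsub>E\<^esub> v)"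
      if "u \<in> carrier E" "r \<in> carrier R" "v \<in> carrier E" for u r v
      by (rule E_eqI) (simp_all add: that counit_closed A.m_assoc R1)
  qed
  have g: "balanced_map R X X E (\<lambda>u v. End_tgt M (v \<one>) \<otimes>\<^bsub>E\<^esub> u)"
  proof (rule R_balancedI)
    show "additive E E (\<lambda>u. End_tgt M (v \<one>) \<otimes>\<^bsub>E\<^esub> u)" if "v \<in> carrier E" for v
      by (rule E.additive_left_mult) (simp add: that counit_closed)
    show "additive E E (\<lambda>v. End_tgt M (v \<one>) \<otimes>\<^bsub>E\<^esub> u)" if "u \<in> carrier E" for u
      by (rule additive_comp[OF t E.additive_right_mult[OF that]])
    show "End_tgt M (v \<one>) \<otimes>\<^bsub>E\<^esub> (End_tgt M r \<otimes>\<^bsub>E\<^esub> u) = End_tgt M ((End_src M r \<otimes>\<^bsub>E\<^esub> v) \<one>) \<otimes>\<^bsub>E\<^esub> u"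
      if "u \<in> carrier E" "r \<in> carrier R" "v \<in> carrier E" for u r v
      by (rule E_eqI) (simp_all add: that counit_closed A.m_assoc R1)
  qed
  show "tensor_lift E (\<lambda>u v. End_src M (u \<one>) \<otimes>\<^bsub>E\<^esub> v) (\<gamma> x) = x"
  proof (rule E_eqI[OF XX.lift_closed[OF f \<gamma>x] x])
    fix m assume m: "m \<in> carrier M"
    have "tensor_lift E (\<lambda>u v. End_src M (u \<one>) \<otimes>\<^bsub>E\<^esub> v) (\<gamma> x) m =
        tensor_lift M (\<lambda>u v. (End_src M (u \<one>) \<otimes>\<^bsub>E\<^esub> v) m) (\<gamma> x)"
      by (rule XX.lift_comp[OF f E_apply_additive[OF m] \<gamma>x])
    also have "\<dots> = pairing (\<gamma> x) \<one> m"
      unfolding pairing_def by (rule XX.lift_cong[OF balanced_map_comp[OF f E_apply_additive[OF m]] _ \<gamma>x]) (simp add: m)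
    finally show "tensor_lift E (\<lambda>u v. End_src M (u \<one>) \<otimes>\<^bsub>E\<^esub> v) (\<gamma> x) m = x m"
      using x m by (simp add: comul_E)
  qed
  show "tensor_lift E (\<lambda>u v. End_tgt M (v \<one>) \<otimes>\<^bsub>E\<^esub> u) (\<gamma> x) = x"
  proof (rule E_eqI[OF XX.lift_closed[OF g \<gamma>x] x])
    fix m assume m: "m \<in> carrier M"
    have "tensor_lift E (\<lambda>u v. End_tgt M (v \<one>) \<otimes>\<^bsub>E\<^esub> u) (\<gamma> x) m =
        tensor_lift M (\<lambda>u v. (End_tgt M (v \<one>) \<otimes>\<^bsub>E\<^esub> u) m) (\<gamma> x)"
      by (rule XX.lift_comp[OF g E_apply_additive[OF m] \<gamma>x])
    also have "\<dots> = pairing (\<gamma> x) m \<one>"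
      unfolding pairing_def by (rule XX.lift_cong[OF balanced_map_comp[OF g E_apply_additive[OF m]] _ \<gamma>x]) (simp add: m)
    finally show "tensor_lift E (\<lambda>u v. End_tgt M (v \<one>) \<otimes>\<^bsub>E\<^esub> u) (\<gamma> x) m = x m"
      using x m by (simp add: comul_E)
  qed
qed

lemma End_comonoid: "comonoid R X \<gamma> (counit \<AA>)"
proof -
  have "bimod_hom (carrier R) (carrier R) X X2 \<gamma>"
    by (simp add: bimod_hom_def comul_E comul_src comul_tgt additive_add[OF comul_additive])
  moreover have "bimod_hom (carrier R) (carrier R) X (reg_bimod R) (counit \<AA>)"
    by (simp add: bimod_hom_def counit_closed)
  ultimately show ?thesis
    by (simp add: comonoid_def comul_coassoc comul_counit)
qed

abbreviation rmult where "rmult \<equiv> tensor_rmult R X X (mult E) (mult E)"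

lemma rmult_balanced:
  assumes u: "u \<in> carrier E" and v: "v \<in> carrier E"
  shows "balanced_map R X X X2 (\<lambda>x y. tensX (x \<otimes>\<^bsub>E\<^esub> u) (y \<otimes>\<^bsub>E\<^esub> v))"
  by (rule XX.tensor_map_balanced) (simp_all add: u v E.additive_right_mult E.A.m_assoc)

lemma rmult_closed: "z \<in> carrier X2 \<Longrightarrow> u \<in> carrier E \<Longrightarrow> v \<in> carrier E \<Longrightarrow> rmult z u v \<in> carrier X2"
  unfolding tensor_rmult_def by (rule XX.lift_closed[OF rmult_balanced])

lemma pairing_rmult:
  assumes z: "z \<in> carrier X2" and u: "u \<in> carrier E" and v: "v \<in> carrier E"
    and m: "m \<in> carrier M" "m' \<in> carrier M"
  shows "pairing (rmult z u v) m m' = pairing z (u m) (v m')"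
proof -
  note b = rmult_balanced[OF u v] and p = pairing_additive[OF m]
  have "pairing (rmult z u v) m m' = tensor_lift M (\<lambda>x y. pairing (tensX (x \<otimes>\<^bsub>E\<^esub> u) (y \<otimes>\<^bsub>E\<^esub> v)) m m') z"
    unfolding tensor_rmult_def by (rule XX.lift_comp[OF b p z])
  also have "\<dots> = pairing z (u m) (v m')"
    unfolding pairing_def[of z] by (rule XX.lift_cong[OF balanced_map_comp[OF b p] _ z]) (simp add: u v m)
  finally show ?thesis .
qed

text \<open>
  The product \<open>\<gamma>(b)(u \<otimes> v)\<close> corresponds to \<open>m \<otimes> m' \<mapsto> b(u(m) v(m'))\<close>.  This is balanced in \<open>u\<close> and
  \<open>v\<close>, and for \<open>\<gamma>(c)\<close> in place of \<open>u \<otimes> v\<close> it becomes \<open>b(c(m m'))\<close>.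
\<close>

lemma comul_multiplicative:
  assumes b: "b \<in> carrier E" and c: "c \<in> carrier E"
  shows "tensor_mult R X X (mult E) (mult E) (\<gamma> b) (\<gamma> c) = \<gamma> (b \<otimes>\<^bsub>E\<^esub> c)"
proof -
  note \<gamma> = comul_E(1)[OF b] comul_E(1)[OF c]
  have p: "pairing (rmult (\<gamma> b) u v) m m' = b (u m \<otimes> v m')"
    if "u \<in> carrier E" "v \<in> carrier E" "m \<in> carrier M" "m' \<in> carrier M" for u v m m'
    by (simp add: pairing_rmult \<gamma> that comul_E b)
  have bal: "balanced_map R X X X2 (rmult (\<gamma> b))"
  proof (rule R_balancedI)
    fix u assume u: "u \<in> carrier E"
    show "additive E X2 (rmult (\<gamma> b) u)"
      by (intro additiveI pairing_eqI)
        (simp_all add: u p rmult_closed \<gamma> additive_add[OF pairing_additive] XX.tensor.a_closed A.r_distr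
          additive_add[OF E_additive[OF b]] E.A.abelian_group_axioms XX.tensor_abelian_group)
    show "additive E X2 (\<lambda>u'. rmult (\<gamma> b) u' u)"
      by (intro additiveI pairing_eqI)
        (simp_all add: u p rmult_closed \<gamma> additive_add[OF pairing_additive] XX.tensor.a_closed A.l_distr
          additive_add[OF E_additive[OF b]] E.A.abelian_group_axioms XX.tensor_abelian_group)
    show "rmult (\<gamma> b) (End_tgt M r \<otimes>\<^bsub>E\<^esub> u) v = rmult (\<gamma> b) u (End_src M r \<otimes>\<^bsub>E\<^esub> v)"
      if "r \<in> carrier R" "v \<in> carrier E" for r v
      by (intro pairing_eqI) (simp_all add: u that p rmult_closed \<gamma> A.m_assoc)
  qed
  show ?thesis
    unfolding tensor_mult_def
  proof (rule pairing_eqI)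
    show "tensor_lift X2 (rmult (\<gamma> b)) (\<gamma> c) \<in> carrier X2" by (rule XX.lift_closed[OF bal \<gamma>(2)])
    show "\<gamma> (b \<otimes>\<^bsub>E\<^esub> c) \<in> carrier X2" by (simp add: b c comul_E)
    fix m m' assume m: "m \<in> carrier M" "m' \<in> carrier M"
    have "pairing (tensor_lift X2 (rmult (\<gamma> b)) (\<gamma> c)) m m' = tensor_lift M (\<lambda>u v. pairing (rmult (\<gamma> b) u v) m m') (\<gamma> c)"
      by (rule XX.lift_comp[OF bal pairing_additive[OF m] \<gamma>(2)])
    also have "\<dots> = tensor_lift M (\<lambda>u v. b (u m \<otimes> v m')) (\<gamma> c)"
      by (rule XX.lift_cong[OF balanced_map_comp[OF bal pairing_additive[OF m]] _ \<gamma>(2)]) (simp add: p m)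
    also have "\<dots> = b (pairing (\<gamma> c) m m')"
      unfolding pairing_def by (rule XX.lift_comp[OF pairing_balanced[OF m] E_additive[OF b] \<gamma>(2), symmetric])
    finally show "pairing (tensor_lift X2 (rmult (\<gamma> b)) (\<gamma> c)) m m' = pairing (\<gamma> (b \<otimes>\<^bsub>E\<^esub> c)) m m'"
      by (simp add: m b c comul_E)
  qed
qed

theorem End_left_bialgebroid: "left_bialgebroid K \<AA>"
proof (rule left_bialgebroid.intro)
  show "comonoid (balg \<AA>) (bim \<AA>) (comul \<AA>) (counit \<AA>)" using End_comonoid by simp
  show "tensor_mult (balg \<AA>) (bim \<AA>) (bim \<AA>) (mult (talg \<AA>)) (mult (talg \<AA>)) (\<gamma> b) (\<gamma> c) =
      \<gamma> (b \<otimes>\<^bsub>talg \<AA>\<^esub> c)" if "b \<in> carrier (talg \<AA>)" "c \<in> carrier (talg \<AA>)" for b c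
    using that by (simp add: comul_multiplicative)
  show "tensor_rmult (balg \<AA>) (bim \<AA>) (bim \<AA>) (mult (talg \<AA>)) (mult (talg \<AA>)) (\<gamma> b) (tgt \<AA> r) \<one>\<^bsub>talg \<AA>\<^esub> =
      tensor_rmult (balg \<AA>) (bim \<AA>) (bim \<AA>) (mult (talg \<AA>)) (mult (talg \<AA>)) (\<gamma> b) \<one>\<^bsub>talg \<AA>\<^esub> (src \<AA> r)"
    if "b \<in> carrier (talg \<AA>)" "r \<in> carrier (balg \<AA>)" for b r
    using that unfolding End_bialgebroid_simps
    by (intro pairing_eqI) (simp_all add: rmult_closed pairing_rmult comul_E A.m_assoc)
  show "\<gamma> \<one>\<^bsub>talg \<AA>\<^esub> = tens (balg \<AA>) (bim \<AA>) (bim \<AA>) \<one>\<^bsub>talg \<AA>\<^esub> \<one>\<^bsub>talg \<AA>\<^esub>"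
    unfolding End_bialgebroid_simps by (intro pairing_eqI) (simp_all add: comul_E tensX_closed)
qed (simp_all add: E_k_algebra R_k_algebra src_alg_hom tgt_alg_hom src_tgt_commute)

theorem End_finite: "finite_bialgebroid \<AA>"
proof -
  obtain n b \<beta> where "left_quasibasis n b \<beta>"
    using depth_two left_quasibasis_exists unfolding depth_two_def by metis
  moreover obtain n' c g where "right_quasibasis n' c g"
    using depth_two right_quasibasis_exists unfolding depth_two_def by metis
  ultimately show ?thesis
    by (simp add: finite_bialgebroid_def fg_projective_left_E fg_projective_right_E)
qed

theorem End_Aut_object: "Aut_object K M N \<AA> (\<lambda>a m. a m)"
proof -
  have "left_module_action K (talg \<AA>) M (\<lambda>a m. a m)"
    by (simp add: left_module_action_def additive_add[OF E_additive] E_smult)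
  moreover have "tensor_lift M (\<lambda>x y. x m \<otimes> y m') (\<gamma> a) = a (m \<otimes> m')"
    if "a \<in> carrier E" "m \<in> carrier M" "m' \<in> carrier M" for a m m'
    using comul_E(2)[OF that] by (simp add: pairing_def)
  ultimately have "module_algebroid_action K \<AA> M (\<lambda>a m. a m)"
    by (simp add: module_algebroid_action_def A.m_assoc)
  moreover have "N \<subseteq> invariants \<AA> M (\<lambda>a m. a m)"
    using E_right_N[of _ _ "\<one>"] by (auto simp: invariants_def)
  ultimately show ?thesis
    by (simp add: Aut_object_def End_left_bialgebroid End_finite)
qed

end


section \<open>The universal property\<close>

lemma left_module_actionD:
  assumes "left_module_action K B M act"
  shows "b \<in> carrier B \<Longrightarrow> m \<in> carrier M \<Longrightarrow> act b m \<in> carrier M"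
    "b \<in> carrier B \<Longrightarrow> b' \<in> carrier B \<Longrightarrow> m \<in> carrier M \<Longrightarrow> act (b \<oplus>\<^bsub>B\<^esub> b') m = act b m \<oplus>\<^bsub>M\<^esub> act b' m"
    "b \<in> carrier B \<Longrightarrow> m \<in> carrier M \<Longrightarrow> m' \<in> carrier M \<Longrightarrow> act b (m \<oplus>\<^bsub>M\<^esub> m') = act b m \<oplus>\<^bsub>M\<^esub> act b m'"
    "c \<in> carrier K \<Longrightarrow> b \<in> carrier B \<Longrightarrow> m \<in> carrier M \<Longrightarrow> act (c \<odot>\<^bsub>B\<^esub> b) m = c \<odot>\<^bsub>M\<^esub> act b m"
    "c \<in> carrier K \<Longrightarrow> b \<in> carrier B \<Longrightarrow> m \<in> carrier M \<Longrightarrow> act b (c \<odot>\<^bsub>M\<^esub> m) = c \<odot>\<^bsub>M\<^esub> act b m"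
    "b \<in> carrier B \<Longrightarrow> b' \<in> carrier B \<Longrightarrow> m \<in> carrier M \<Longrightarrow> act (b \<otimes>\<^bsub>B\<^esub> b') m = act b (act b' m)"
    "m \<in> carrier M \<Longrightarrow> act \<one>\<^bsub>B\<^esub> m = m"
  using assms by (simp_all add: left_module_action_def)

lemma left_module_action_additive:
  assumes "left_module_action K B M act" "abelian_group B" "abelian_group M"
  shows "m \<in> carrier M \<Longrightarrow> additive B M (\<lambda>b. act b m)" "b \<in> carrier B \<Longrightarrow> additive M M (act b)"
  using left_module_actionD[OF assms(1)] assms(2,3) by (auto intro!: additiveI)

definition action_map :: "('k, 'b) module \<Rightarrow> ('k, 'm) module \<Rightarrow> ('b \<Rightarrow> 'm \<Rightarrow> 'm) \<Rightarrow> 'b \<Rightarrow> 'm \<Rightarrow> 'm" where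
  "action_map B M act = (\<lambda>b\<in>carrier B. \<lambda>m\<in>carrier M. act b m)"

context depth_two_extension
begin

text \<open>
  An action by \<open>N\<close>-\<open>N\<close>-bimodule maps for which the images of source and target are the left and
  right multiplications by elements of \<open>R\<close> is a map of bialgebroids to \<open>A\<close>: compatibility with
  the comultiplications is checked under the injective map \<open>A \<otimes>\<^sub>R A \<rightarrow> Hom(M \<otimes>\<^sub>N M, M)\<close>, where it
  is the rule for the action on a product.  The hypotheses are stated so as to be met by actions of
  bialgebroids and, through \<open>\<beta>\<^sub>l\<close>, of weak bialgebras.
\<close>

lemma action_map_bialgebroid_map:
  fixes B :: "('k, 's, 'b) left_bialgebroid"
  assumes alg: "k_algebra K (talg B)" and act: "left_module_action K (talg B) M act"
    and st: "\<And>r. r \<in> carrier (balg B) \<Longrightarrow> src B r \<in> carrier (talg B)"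
      "\<And>r. r \<in> carrier (balg B) \<Longrightarrow> tgt B r \<in> carrier (talg B)"
    and \<omega>: "alg_hom K (balg B) R \<omega>"
    and src: "\<And>r m. r \<in> carrier (balg B) \<Longrightarrow> m \<in> carrier M \<Longrightarrow> act (src B r) m = \<omega> r \<otimes> m"
    and tgt: "\<And>r m. r \<in> carrier (balg B) \<Longrightarrow> m \<in> carrier M \<Longrightarrow> act (tgt B r) m = m \<otimes> \<omega> r"
    and left_N: "\<And>b n m. b \<in> carrier (talg B) \<Longrightarrow> n \<in> N \<Longrightarrow> m \<in> carrier M \<Longrightarrow>
      act b (n \<otimes> m) = n \<otimes> act b m"
    and right_N: "\<And>b n m. b \<in> carrier (talg B) \<Longrightarrow> n \<in> N \<Longrightarrow> m \<in> carrier M \<Longrightarrow>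
      act b (m \<otimes> n) = act b m \<otimes> n"
    and counit: "\<And>b. b \<in> carrier (talg B) \<Longrightarrow> act b \<one> = \<omega> (counit B b)"
    and comul_closed: "\<And>b. b \<in> carrier (talg B) \<Longrightarrow> comul B b \<in> carrier (tensor (balg B) (bim B) (bim B))"
    and comul: "\<And>b m m'. b \<in> carrier (talg B) \<Longrightarrow> m \<in> carrier M \<Longrightarrow> m' \<in> carrier M \<Longrightarrow>
      act b (m \<otimes> m') = tensor_lift M (\<lambda>x y. act x m \<otimes> act y m') (comul B b)"
  shows "bialgebroid_map K B \<AA> (action_map (talg B) M act)"
proof -
  interpret B: assoc_algebra K "talg B" by (rule assoc_algebra.intro[OF alg])
  let ?f = "action_map (talg B) M act"
  let ?S = "balg B" and ?bim\<omega> = "bgd_bimod E (End_src M \<circ> \<omega>) (End_tgt M \<circ> \<omega>)"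
  let ?\<tau> = "tensor_lift X2 tensX"
  note a = left_module_actionD[OF act]
  note add = left_module_action_additive[OF act B.A.abelian_group_axioms A.abelian_group_axioms]
  have \<omega>R: "\<omega> r \<in> carrier R" if "r \<in> carrier ?S" for r
    using \<omega> that by (auto simp: alg_hom_def ring_hom_def)
  have f_apply [simp]: "?f b m = act b m" if "b \<in> carrier (talg B)" "m \<in> carrier M" for b m
    using that by (simp add: action_map_def)
  have f_closed: "?f b \<in> carrier E" if b: "b \<in> carrier (talg B)" for b
    unfolding action_map_def using b by (simp add: E_restrictI add left_N right_N)
  have f_hom: "alg_hom K (talg B) E ?f"
    unfolding alg_hom_def
    by (intro conjI ballI ring_hom_memI E_eqI) (simp_all add: f_closed a)
  have f_add: "additive (talg B) E ?f"
    using f_hom B.A.abelian_group_axioms E.A.abelian_group_axioms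
    by (auto simp: alg_hom_def ring_hom_def additive_def)
  have f_src: "?f (src B r) = End_src M (\<omega> r)" and f_tgt: "?f (tgt B r) = End_tgt M (\<omega> r)"
    if "r \<in> carrier ?S" for r
    by (rule E_eqI; simp add: that f_closed st \<omega>R src tgt)+
  interpret BB: tensor_product ?S "bim B" "bim B"
    by (intro tensor_product.intro B.bgd_left_operators B.bgd_right_operators st)
  interpret WW: tensor_product ?S ?bim\<omega> ?bim\<omega>
    by (intro tensor_product.intro E.bgd_left_operators E.bgd_right_operators) (simp_all add: \<omega>R)
  have ff: "balanced_map ?S (bim B) (bim B) (tensor ?S ?bim\<omega> ?bim\<omega>) (\<lambda>u v. tens ?S ?bim\<omega> ?bim\<omega> (?f u) (?f v))"
  proof (rule WW.tensor_map_balanced)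
    show "?f (ract (bim B) x s) = ract ?bim\<omega> (?f x) s" if "x \<in> carrier (bim B)" "s \<in> carrier ?S" for x s
      using that f_hom by (simp add: f_tgt[symmetric] alg_hom_def ring_hom_def st)
    show "?f (lact (bim B) s x) = lact ?bim\<omega> s (?f x)" if "s \<in> carrier ?S" "x \<in> carrier (bim B)" for x s
      using that f_hom by (simp add: f_src[symmetric] alg_hom_def ring_hom_def st)
  qed (simp_all add: f_add)
  have tau: "balanced_map ?S ?bim\<omega> ?bim\<omega> X2 tensX"
  proof (rule balanced_mapI)
    show "additive ?bim\<omega> X2 (tensX x)" if "x \<in> carrier ?bim\<omega>" for x
      using XX.tens_balanced_map that unfolding balanced_map_def by simp
    show "additive ?bim\<omega> X2 (\<lambda>x. tensX x y)" if "y \<in> carrier ?bim\<omega>" for y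
      using XX.tens_balanced_map that unfolding balanced_map_def by simp
    show "tensX (ract ?bim\<omega> x s) y = tensX x (lact ?bim\<omega> s y)"
      if "x \<in> carrier ?bim\<omega>" "s \<in> carrier ?S" "y \<in> carrier ?bim\<omega>" for x s y
      using XX.tens_balanced[of x "\<omega> s" y] that by (simp add: \<omega>R)
  qed
  have f_comul: "\<gamma> (?f b) = ?\<tau> (tensor_map ?S ?bim\<omega> ?bim\<omega> ?f ?f (comul B b))" if b: "b \<in> carrier (talg B)" for b
  proof (rule pairing_eqI)
    note c = comul_closed[OF b]
    show "\<gamma> (?f b) \<in> carrier X2" by (rule comul_E(1)[OF f_closed[OF b]])
    show "?\<tau> (tensor_map ?S ?bim\<omega> ?bim\<omega> ?f ?f (comul B b)) \<in> carrier X2"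
      unfolding tensor_map_def by (rule WW.lift_closed[OF tau BB.lift_closed[OF ff c]])
    fix m m' assume m: "m \<in> carrier M" "m' \<in> carrier M"
    note p = additive_comp[OF WW.lift_additive(1)[OF tau] pairing_additive[OF m]]
    have "pairing (?\<tau> (tensor_map ?S ?bim\<omega> ?bim\<omega> ?f ?f (comul B b))) m m' =
        tensor_lift M (\<lambda>x y. pairing (?\<tau> (tens ?S ?bim\<omega> ?bim\<omega> (?f x) (?f y))) m m') (comul B b)"
      unfolding tensor_map_def by (rule BB.lift_comp[OF ff p c])
    also have "\<dots> = tensor_lift M (\<lambda>x y. act x m \<otimes> act y m') (comul B b)"
      by (rule BB.lift_cong[OF balanced_map_comp[OF ff p] _ c]) (simp add: WW.lift_tens[OF tau] f_closed m)
    finally show "pairing (\<gamma> (?f b)) m m' = pairing (?\<tau> (tensor_map ?S ?bim\<omega> ?bim\<omega> ?f ?f (comul B b))) m m'"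
      by (simp add: comul_E f_closed b m comul)
  qed
  have "?f \<in> extensional (carrier (talg B))" by (simp add: action_map_def)
  then show ?thesis
    unfolding bialgebroid_map_def End_bialgebroid_simps Let_def
    using f_hom \<omega> f_src f_tgt f_comul counit by auto
qed

lemma action_map_unique:
  assumes f: "f \<in> extensional (carrier B)" "\<And>b. b \<in> carrier B \<Longrightarrow> f b \<in> carrier E"
    "\<And>b m. b \<in> carrier B \<Longrightarrow> m \<in> carrier M \<Longrightarrow> f b m = act b m"
  shows "f = action_map B M act"
proof (rule extensionalityI[OF f(1)])
  show "action_map B M act \<in> extensional (carrier B)" by (simp add: action_map_def)
  show "f b = action_map B M act b" if "b \<in> carrier B" for b
    using that f by (intro extensionalityI[of _ "carrier M"]) (simp_all add: E_extensional action_map_def)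
qed

text \<open>
  Put \<open>\<omega>(r) = s(r) \<triangleright> 1\<close>.  The action of \<open>s(r)\<close> is the left and that of \<open>t(r)\<close> the right multiplication
  by \<open>\<omega>(r)\<close>, because the multiplication of \<open>M\<close> is balanced over the base.  On \<open>n \<in> N\<close> they agree, so
  \<open>\<omega>(r)\<close> centralizes \<open>N\<close>, and then \<open>b \<triangleright> (n m) = (b\<^sub>1 \<triangleright> n)(b\<^sub>2 \<triangleright> m) = n \<omega>(\<pi>(b\<^sub>1)) (b\<^sub>2 \<triangleright> m) = n (b \<triangleright> m)\<close>.
\<close>

lemma Aut_object_arrow:
  fixes B :: "('k, 's, 'b) left_bialgebroid"
  assumes obj: "Aut_object K M N B act"
  shows "bialgebroid_map K B \<AA> (action_map (talg B) M act)"
proof -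
  interpret lb: left_bialgebroid K B using obj by (simp add: Aut_object_def)
  interpret B: assoc_algebra K "talg B" by (rule assoc_algebra.intro[OF lb.total_algebra])
  interpret S: assoc_algebra K "balg B" by (rule assoc_algebra.intro[OF lb.base_algebra])
  let ?S = "balg B"
  have act: "left_module_action K (talg B) M act"
    and bal: "\<And>r m m'. r \<in> carrier ?S \<Longrightarrow> m \<in> carrier M \<Longrightarrow> m' \<in> carrier M \<Longrightarrow>
        act (tgt B r) m \<otimes> m' = m \<otimes> act (src B r) m'"
    and prod: "\<And>b m m'. b \<in> carrier (talg B) \<Longrightarrow> m \<in> carrier M \<Longrightarrow> m' \<in> carrier M \<Longrightarrow>
      act b (m \<otimes> m') = tensor_lift M (\<lambda>x y. act x m \<otimes> act y m') (comul B b)"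
    and unit: "\<And>b. b \<in> carrier (talg B) \<Longrightarrow> act b \<one> = act (src B (counit B b)) \<one>"
    using obj by (simp_all add: Aut_object_def module_algebroid_action_def)
  have inv: "act b n = act (src B (counit B b)) n" if "n \<in> N" "b \<in> carrier (talg B)" for n b
    using obj that by (auto simp: Aut_object_def invariants_def)
  note a = left_module_actionD[OF act]
  note add = left_module_action_additive[OF act B.A.abelian_group_axioms A.abelian_group_axioms]
  have s: "src B r \<in> carrier (talg B)" and t: "tgt B r \<in> carrier (talg B)" if "r \<in> carrier ?S" for r
    using lb.src_hom lb.tgt_hom that by (auto simp: alg_hom_def ring_hom_def op_alg_def)
  have com: "bimod_hom (carrier ?S) (carrier ?S) (bim B) (tensor ?S (bim B) (bim B)) (comul B)"
    and cou: "bimod_hom (carrier ?S) (carrier ?S) (bim B) (reg_bimod ?S) (counit B)"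
    and cl: "\<And>x. x \<in> carrier (talg B) \<Longrightarrow>
       tensor_lift (talg B) (\<lambda>u v. src B (counit B u) \<otimes>\<^bsub>talg B\<^esub> v) (comul B x) = x"
    and cr: "\<And>x. x \<in> carrier (talg B) \<Longrightarrow>
       tensor_lift (talg B) (\<lambda>u v. tgt B (counit B v) \<otimes>\<^bsub>talg B\<^esub> u) (comul B x) = x"
    using lb.comonoid by (simp_all add: comonoid_def)
  note com = bimod_homD[OF com, simplified] and cou = bimod_homD[OF cou, simplified]
  define \<omega> where "\<omega> r = act (src B r) \<one>" for r
  have \<omega>M: "\<omega> r \<in> carrier M" if "r \<in> carrier ?S" for r using that by (simp add: \<omega>_def a s)
  have tgt: "act (tgt B r) m = m \<otimes> \<omega> r" if "r \<in> carrier ?S" "m \<in> carrier M" for r m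
    using bal[of r m "\<one>"] that by (simp add: \<omega>_def a t)
  have src: "act (src B r) m = \<omega> r \<otimes> m" if "r \<in> carrier ?S" "m \<in> carrier M" for r m
    using bal[of r "\<one>" m] that by (simp add: a s \<omega>M tgt)
  have counit_tgt: "counit B (tgt B r) = r" if "r \<in> carrier ?S" for r
    using cou(4)[of r "\<one>\<^bsub>talg B\<^esub>"] that by (simp add: t lb.counit_one)
  have \<omega>R: "\<omega> r \<in> carrier R" if r: "r \<in> carrier ?S" for r
    unfolding centralizer_iff
  proof (intro conjI ballI)
    fix n assume n: "n \<in> N"
    show "\<omega> r \<otimes> n = n \<otimes> \<omega> r"
      using inv[OF n t[OF r]] by (simp add: counit_tgt r n src[OF r] tgt[OF r])
  qed (rule \<omega>M[OF r])
  have \<omega>_hom: "alg_hom K ?S R \<omega>"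
  proof -
    have s_hom: "src B (r \<otimes>\<^bsub>?S\<^esub> r') = src B r \<otimes>\<^bsub>talg B\<^esub> src B r'"
      "src B (r \<oplus>\<^bsub>?S\<^esub> r') = src B r \<oplus>\<^bsub>talg B\<^esub> src B r'"
      if "r \<in> carrier ?S" "r' \<in> carrier ?S" for r r'
      using lb.src_hom that by (simp_all add: alg_hom_def ring_hom_def)
    have "\<omega> (r \<otimes>\<^bsub>?S\<^esub> r') = \<omega> r \<otimes> \<omega> r'" if "r \<in> carrier ?S" "r' \<in> carrier ?S" for r r'
      unfolding src[OF that(1) \<omega>M[OF that(2)], symmetric] using that by (simp add: \<omega>_def s_hom a s)
    moreover have "src B (c \<odot>\<^bsub>?S\<^esub> r) = c \<odot>\<^bsub>talg B\<^esub> src B r" if "c \<in> carrier K" "r \<in> carrier ?S" for c r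
      using lb.src_hom that by (simp add: alg_hom_def ring_hom_def)
    moreover have "src B \<one>\<^bsub>?S\<^esub> = \<one>\<^bsub>talg B\<^esub>" using lb.src_hom by (simp add: alg_hom_def ring_hom_def)
    ultimately show ?thesis
      unfolding alg_hom_def by (intro conjI ballI ring_hom_memI) (simp_all add: \<omega>R, simp_all add: \<omega>_def s_hom a s)
  qed
  interpret BB: tensor_product ?S "bim B" "bim B"
    by (intro tensor_product.intro B.bgd_left_operators B.bgd_right_operators s t)
  have s_mult: "src B (r \<otimes>\<^bsub>?S\<^esub> r') = src B r \<otimes>\<^bsub>talg B\<^esub> src B r'"
    and t_mult: "tgt B (r \<otimes>\<^bsub>?S\<^esub> r') = tgt B r' \<otimes>\<^bsub>talg B\<^esub> tgt B r" if "r \<in> carrier ?S" "r' \<in> carrier ?S" for r r'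
    using lb.src_hom lb.tgt_hom that by (simp_all add: alg_hom_def ring_hom_def op_alg_def)
  have s_add: "additive (talg B) (talg B) (\<lambda>u. src B (counit B u))"
    and t_add: "additive (talg B) (talg B) (\<lambda>u. tgt B (counit B u))"
    using lb.src_hom lb.tgt_hom cou(1,2) B.A.abelian_group_axioms
    by (auto intro!: additiveI simp: alg_hom_def ring_hom_def op_alg_def s t)
  have bl: "balanced_map ?S (bim B) (bim B) (talg B) (\<lambda>u v. src B (counit B u) \<otimes>\<^bsub>talg B\<^esub> v)"
  proof (rule balanced_mapI)
    show "additive (bim B) (talg B) (\<lambda>v. src B (counit B u) \<otimes>\<^bsub>talg B\<^esub> v)" if "u \<in> carrier (bim B)" for u
      using B.additive_left_mult[of "src B (counit B u)"] that cou(1) s by simp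
    show "additive (bim B) (talg B) (\<lambda>u. src B (counit B u) \<otimes>\<^bsub>talg B\<^esub> v)" if "v \<in> carrier (bim B)" for v
      using additive_comp[OF s_add B.additive_right_mult[of v]] that by simp
  qed (simp add: cou s s_mult B.A.m_assoc)
  have br: "balanced_map ?S (bim B) (bim B) (talg B) (\<lambda>u v. tgt B (counit B v) \<otimes>\<^bsub>talg B\<^esub> u)"
  proof (rule balanced_mapI)
    show "additive (bim B) (talg B) (\<lambda>u. tgt B (counit B v) \<otimes>\<^bsub>talg B\<^esub> u)" if "v \<in> carrier (bim B)" for v
      using B.additive_left_mult[of "tgt B (counit B v)"] that cou(1) t by simp
    show "additive (bim B) (talg B) (\<lambda>v. tgt B (counit B v) \<otimes>\<^bsub>talg B\<^esub> u)" if "u \<in> carrier (bim B)" for u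
      using additive_comp[OF t_add B.additive_right_mult[of u]] that by simp
  qed (simp add: cou t t_mult B.A.m_assoc)
  have left_N: "act b (n \<otimes> m) = n \<otimes> act b m"
    if b: "b \<in> carrier (talg B)" and n: "n \<in> N" and m: "m \<in> carrier M" for b n m
  proof -
    have h: "additive (talg B) M (\<lambda>b. n \<otimes> act b m)"
      by (rule additive_comp[OF add(1)[OF m] additive_left_mult]) (simp add: n)
    have "n \<otimes> act b m =
        n \<otimes> act (tensor_lift (talg B) (\<lambda>u v. src B (counit B u) \<otimes>\<^bsub>talg B\<^esub> v) (comul B b)) m"
      by (simp add: cl b)
    also have "\<dots> = tensor_lift M (\<lambda>u v. n \<otimes> act (src B (counit B u) \<otimes>\<^bsub>talg B\<^esub> v) m) (comul B b)"
      by (rule BB.lift_comp[OF bl h com(1)[OF b]])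
    also have "\<dots> = tensor_lift M (\<lambda>u v. act u n \<otimes> act v m) (comul B b)"
    proof (rule BB.lift_cong[OF balanced_map_comp[OF bl h] _ com(1)[OF b]])
      fix u v assume "u \<in> carrier (bim B)" "v \<in> carrier (bim B)"
      then have uv: "u \<in> carrier (talg B)" "v \<in> carrier (talg B)" "counit B u \<in> carrier ?S" using cou(1) by simp_all
      have "act u n = n \<otimes> \<omega> (counit B u)"
        using inv[OF n uv(1)] n uv by (simp add: src R_commute \<omega>R)
      then show "n \<otimes> act (src B (counit B u) \<otimes>\<^bsub>talg B\<^esub> v) m = act u n \<otimes> act v m"
        using uv n m by (simp add: a s src \<omega>M A.m_assoc)
    qed
    finally show ?thesis using prod[OF b _ m, of n] n by simp
  qed
  have right_N: "act b (m \<otimes> n) = act b m \<otimes> n"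
    if b: "b \<in> carrier (talg B)" and n: "n \<in> N" and m: "m \<in> carrier M" for b n m
  proof -
    have h: "additive (talg B) M (\<lambda>b. act b m \<otimes> n)"
      by (rule additive_comp[OF add(1)[OF m] additive_right_mult]) (simp add: n)
    have "act b m \<otimes> n =
        act (tensor_lift (talg B) (\<lambda>u v. tgt B (counit B v) \<otimes>\<^bsub>talg B\<^esub> u) (comul B b)) m \<otimes> n"
      by (simp add: cr b)
    also have "\<dots> = tensor_lift M (\<lambda>u v. act (tgt B (counit B v) \<otimes>\<^bsub>talg B\<^esub> u) m \<otimes> n) (comul B b)"
      by (rule BB.lift_comp[OF br h com(1)[OF b]])
    also have "\<dots> = tensor_lift M (\<lambda>u v. act u m \<otimes> act v n) (comul B b)"
    proof (rule BB.lift_cong[OF balanced_map_comp[OF br h] _ com(1)[OF b]])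
      fix u v assume "u \<in> carrier (bim B)" "v \<in> carrier (bim B)"
      then have uv: "u \<in> carrier (talg B)" "v \<in> carrier (talg B)" "counit B v \<in> carrier ?S" using cou(1) by simp_all
      have "act v n = \<omega> (counit B v) \<otimes> n"
        using inv[OF n uv(2)] n uv by (simp add: src)
      then show "act (tgt B (counit B v) \<otimes>\<^bsub>talg B\<^esub> u) m \<otimes> n = act u m \<otimes> act v n"
        using uv n m by (simp add: a t tgt \<omega>M A.m_assoc)
    qed
    finally show ?thesis using prod[OF b m, of n] n by simp
  qed
  show ?thesis
    by (rule action_map_bialgebroid_map[OF lb.total_algebra act s t \<omega>_hom src tgt left_N right_N])
      (simp_all add: unit com prod \<omega>_def)
qed

theorem End_terminal:
  fixes B :: "('k, 's, 'b) left_bialgebroid"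
  assumes "Aut_object K M N B act"
  shows "\<exists>!f. Aut_arrow K M B act \<AA> (\<lambda>a m. a m) f"
proof (rule ex1I)
  show "Aut_arrow K M B act \<AA> (\<lambda>a m. a m) (action_map (talg B) M act)"
    using Aut_object_arrow[OF assms] by (simp add: Aut_arrow_def action_map_def)
  show "f = action_map (talg B) M act" if "Aut_arrow K M B act \<AA> (\<lambda>a m. a m) f" for f
    using that by (intro action_map_unique) (auto simp: Aut_arrow_def bialgebroid_map_def alg_hom_def ring_hom_def)
qed

end


section \<open>Tensor products over a commutative ring\<close>

text \<open>
  Modules over a commutative ring \<open>K\<close> as symmetric bimodules.  On them, tensor products are again
  modules of this kind, and products of tensors are defined without restriction.
\<close>

definition sym_operators :: "('k, 'q) ring_scheme \<Rightarrow> ('k, 'k, 'x) bimod \<Rightarrow> bool" where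
  "sym_operators K X \<longleftrightarrow> bi_operators (carrier K) (carrier K) X \<and>
     (\<forall>c\<in>carrier K. \<forall>x\<in>carrier X. ract X x c = lact X c x)"

definition bilinear_op :: "('k, 'q) ring_scheme \<Rightarrow> ('k, 'k, 'x) bimod \<Rightarrow> ('x \<Rightarrow> 'x \<Rightarrow> 'x) \<Rightarrow> bool" where
  "bilinear_op K X f \<longleftrightarrow> (\<forall>x\<in>carrier X. additive X X (f x) \<and> additive X X (\<lambda>u. f u x)) \<and>
     (\<forall>c\<in>carrier K. \<forall>x\<in>carrier X. \<forall>y\<in>carrier X.
        f (lact X c x) y = lact X c (f x y) \<and> f x (lact X c y) = lact X c (f x y))"

lemma bilinear_opD:
  assumes "bilinear_op K X f"
  shows "x \<in> carrier X \<Longrightarrow> additive X X (f x)" "x \<in> carrier X \<Longrightarrow> additive X X (\<lambda>u. f u x)"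
    "c \<in> carrier K \<Longrightarrow> x \<in> carrier X \<Longrightarrow> y \<in> carrier X \<Longrightarrow> f (lact X c x) y = lact X c (f x y)"
    "c \<in> carrier K \<Longrightarrow> x \<in> carrier X \<Longrightarrow> y \<in> carrier X \<Longrightarrow> f x (lact X c y) = lact X c (f x y)"
  using assms by (simp_all add: bilinear_op_def)

lemma sym_operatorsD:
  assumes "sym_operators K X"
  shows "bi_operators (carrier K) (carrier K) X" "bi_operators {} (carrier K) X" "bi_operators (carrier K) {} X"
    "c \<in> carrier K \<Longrightarrow> x \<in> carrier X \<Longrightarrow> ract X x c = lact X c x"
    "c \<in> carrier K \<Longrightarrow> x \<in> carrier X \<Longrightarrow> lact X c x \<in> carrier X"
    "c \<in> carrier K \<Longrightarrow> additive X X (lact X c)"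
  using assms additive_closed[OF bi_operators_lact]
  by (auto simp: sym_operators_def intro: bi_operators_left bi_operators_right bi_operators_lact)

lemma tensor_sym_operators:
  assumes X: "sym_operators K X" and Y: "sym_operators K Y"
  shows "sym_operators K (tensor K X Y)"
  unfolding sym_operators_def
proof (intro conjI ballI)
  note t = tensor_bi_operators[OF sym_operatorsD(1)[OF X] sym_operatorsD(1)[OF Y]]
  interpret tensor_product K X Y
    by (rule tensor_product.intro[OF sym_operatorsD(2)[OF X] sym_operatorsD(3)[OF Y]])
  show "bi_operators (carrier K) (carrier K) (tensor K X Y)" by (rule t(1))
  fix c z assume c: "c \<in> carrier K" and z: "z \<in> carrier (tensor K X Y)"
  show "ract (tensor K X Y) z c = lact (tensor K X Y) c z"
    by (rule additive_eq_on_tens[where g = "\<lambda>z. ract (tensor K X Y) z c", OF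
          bi_operators_ract[OF t(1) c] bi_operators_lact[OF t(1) c] _ z])
      (simp add: c t(2,3) tens_balanced[symmetric] sym_operatorsD(4)[OF X] sym_operatorsD(4)[OF Y])
qed

lemma tensor_mult_bilinear:
  assumes X: "sym_operators K X" and Y: "sym_operators K Y"
    and f: "bilinear_op K X f" and g: "bilinear_op K Y g"
  shows "bilinear_op K (tensor K X Y) (tensor_mult K X Y f g)"
    and "\<And>x y u v. x \<in> carrier X \<Longrightarrow> y \<in> carrier Y \<Longrightarrow> u \<in> carrier X \<Longrightarrow> v \<in> carrier Y \<Longrightarrow>
      tensor_mult K X Y f g (tens K X Y x y) (tens K X Y u v) = tens K X Y (f x u) (g y v)"
proof -
  let ?T = "tensor K X Y" and ?r = "tensor_rmult K X Y f g" and ?m = "tensor_mult K X Y f g"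
  note t = tensor_bi_operators[OF sym_operatorsD(1)[OF X] sym_operatorsD(1)[OF Y]]
  interpret tensor_product K X Y
    by (rule tensor_product.intro[OF sym_operatorsD(2)[OF X] sym_operatorsD(3)[OF Y]])
  note f' = bilinear_opD[OF f] and g' = bilinear_opD[OF g]
  have fc: "f x u \<in> carrier X" if "x \<in> carrier X" "u \<in> carrier X" for x u
    using additive_closed[OF f'(1)] that by blast
  have gc: "g x u \<in> carrier Y" if "x \<in> carrier Y" "u \<in> carrier Y" for x u
    using additive_closed[OF g'(1)] that by blast
  have tx: "additive X ?T (\<lambda>x. tens K X Y x y)" if "y \<in> carrier Y" for y
    using tens_balanced_map that unfolding balanced_map_def by blast
  have ty: "additive Y ?T (tens K X Y x)" if "x \<in> carrier X" for x
    using tens_balanced_map that unfolding balanced_map_def by blast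
  have b: "balanced_map K X Y ?T (\<lambda>x y. tens K X Y (f x u) (g y v))" if "u \<in> carrier X" "v \<in> carrier Y" for u v
    by (rule tensor_map_balanced[OF f'(2)[OF that(1)] g'(2)[OF that(2)]])
      (simp_all add: that f' g' fc sym_operatorsD(4)[OF X])
  have r_add: "additive ?T ?T (\<lambda>c. ?r c u v)" if "u \<in> carrier X" "v \<in> carrier Y" for u v
    unfolding tensor_rmult_def by (rule lift_additive(1)[OF b[OF that]])
  have r_bal: "balanced_map K X Y ?T (?r c)" if c: "c \<in> carrier ?T" for c
  proof (rule balanced_mapI)
    show "additive Y ?T (?r c u)" if "u \<in> carrier X" for u
      unfolding tensor_rmult_def
      by (rule lift_param_additive[OF Y.abelian_group_axioms b[OF that] _ c])
        (simp_all add: additive_comp[OF g'(1) ty] fc that)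
    show "additive X ?T (\<lambda>u. ?r c u v)" if v: "v \<in> carrier Y" for v
      unfolding tensor_rmult_def
    proof (rule lift_param_additive[OF X.abelian_group_axioms b[OF _ v] _ c])
      show "additive X ?T (\<lambda>p. tens K X Y (f x p) (g y v))" if "x \<in> carrier X" "y \<in> carrier Y" for x y
        by (rule additive_comp[OF f'(1)[OF that(1)] tx[OF gc[OF that(2) v]]])
    qed
    show "?r c (ract X u s) v = ?r c u (lact Y s v)"
      if u: "u \<in> carrier X" and s: "s \<in> carrier K" and v: "v \<in> carrier Y" for u s v
      unfolding tensor_rmult_def
    proof (rule lift_cong[OF b[OF ract_closed[OF u s] v] _ c])
      show "tens K X Y (f x (ract X u s)) (g y v) = tens K X Y (f x u) (g y (lact Y s v))"
        if "x \<in> carrier X" "y \<in> carrier Y" for x y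
        using tens_balanced[OF fc[OF that(1) u] s gc[OF that(2) v]] that u s v
        by (simp add: sym_operatorsD(4)[OF X] f' g' fc)
    qed
  qed
  have m1: "additive ?T ?T (?m c)" if "c \<in> carrier ?T" for c
    unfolding tensor_mult_def by (rule lift_additive(1)[OF r_bal[OF that]])
  have m2: "additive ?T ?T (\<lambda>c. ?m c d)" if "d \<in> carrier ?T" for d
    unfolding tensor_mult_def
    by (rule lift_param_additive[OF tensor_abelian_group r_bal r_add that])
  show pure: "?m (tens K X Y x y) (tens K X Y u v) = tens K X Y (f x u) (g y v)"
    if "x \<in> carrier X" "y \<in> carrier Y" "u \<in> carrier X" "v \<in> carrier Y" for x y u v
    unfolding tensor_mult_def
    by (subst lift_tens[OF r_bal[OF tens_closed]]) (simp_all add: that tensor_rmult_def lift_tens[OF b])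
  have ext2: "h c d = k c d"
    if "\<And>d. d \<in> carrier ?T \<Longrightarrow> additive ?T ?T (\<lambda>c. h c d)" "\<And>d. d \<in> carrier ?T \<Longrightarrow> additive ?T ?T (\<lambda>c. k c d)"
      "\<And>c. c \<in> carrier ?T \<Longrightarrow> additive ?T ?T (h c)" "\<And>c. c \<in> carrier ?T \<Longrightarrow> additive ?T ?T (k c)"
      "\<And>x y u v. x \<in> carrier X \<Longrightarrow> y \<in> carrier Y \<Longrightarrow> u \<in> carrier X \<Longrightarrow> v \<in> carrier Y \<Longrightarrow>
        h (tens K X Y x y) (tens K X Y u v) = k (tens K X Y x y) (tens K X Y u v)"
      "c \<in> carrier ?T" "d \<in> carrier ?T" for h k c d
  proof (rule additive_eq_on_tens[OF that(1,2)[OF that(7)] _ that(6)])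
    fix x y assume xy: "x \<in> carrier X" "y \<in> carrier Y"
    show "h (tens K X Y x y) d = k (tens K X Y x y) d"
      by (rule additive_eq_on_tens[OF that(3,4)[OF tens_closed[OF xy]] that(5)[OF xy] that(7)])
  qed
  have l: "additive ?T ?T (lact ?T c)" if "c \<in> carrier K" for c by (rule bi_operators_lact[OF t(1) that])
  note lc = additive_closed[OF l]
  show "bilinear_op K ?T ?m"
    unfolding bilinear_op_def
  proof (intro conjI ballI m1 m2)
    fix c z w assume c: "c \<in> carrier K" and z: "z \<in> carrier ?T" and w: "w \<in> carrier ?T"
    show "?m (lact ?T c z) w = lact ?T c (?m z w)"
      by (rule ext2[where h = "\<lambda>z. ?m (lact ?T c z)" and k = "\<lambda>z w. lact ?T c (?m z w)", OF _ _ _ _ _ z w])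
        (simp_all add: c m1 lc additive_comp[OF l m2] additive_comp[OF m1 l] additive_comp[OF m2 l] t(2)
          pure sym_operatorsD(5)[OF X] f' fc gc)
    show "?m z (lact ?T c w) = lact ?T c (?m z w)"
      by (rule ext2[where h = "\<lambda>z w. ?m z (lact ?T c w)" and k = "\<lambda>z w. lact ?T c (?m z w)", OF _ _ _ _ _ z w])
        (simp_all add: c m2 lc additive_comp[OF l m1] additive_comp[OF m1 l] additive_comp[OF m2 l] t(2)
          pure sym_operatorsD(5)[OF X] f' fc gc)
  qed
qed


section \<open>Weak bialgebras\<close>

locale weak_bialg =
  fixes K :: "('k, 'q) ring_scheme" and W :: "('k, 'w) weak_bialgebra"
  assumes wba: "weak_bialgebra K W"
begin

abbreviation A where "A \<equiv> walg W"
abbreviation X where "X \<equiv> sym_bimod A"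
abbreviation XX where "XX \<equiv> tensor K X X"
abbreviation X3 where "X3 \<equiv> tensor K X XX"
abbreviation tX where "tX \<equiv> tens K X X"
abbreviation \<Delta> where "\<Delta> \<equiv> wcomul W"
abbreviation \<epsilon> where "\<epsilon> \<equiv> wcounit W"
abbreviation mult2 where "mult2 \<equiv> tensor_mult K X X (mult A) (mult A)"
abbreviation mult3 where "mult3 \<equiv> tensor_mult K X XX (mult A) mult2"

sublocale assoc_algebra K A
  using wba by (intro assoc_algebra.intro) (simp add: weak_bialgebra_def Let_def)

lemma X_sym: "sym_operators K X"
  by (simp add: sym_operators_def bi_operators_def A.abelian_group_axioms additive_smult
      V.R.m_comm flip: V.smult_assoc1) (simp add: sym_bimod_def as_bimod_def additive_def A.abelian_group_axioms V.smult_r_distr)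

lemma XX_sym: "sym_operators K XX" by (rule tensor_sym_operators[OF X_sym X_sym])

sublocale XX: tensor_product K X X
  by (rule tensor_product.intro[OF sym_operatorsD(2)[OF X_sym] sym_operatorsD(3)[OF X_sym]])
sublocale X_XX: tensor_product K X XX
  by (rule tensor_product.intro[OF sym_operatorsD(2)[OF X_sym] sym_operatorsD(3)[OF XX_sym]])
sublocale XX_X: tensor_product K XX X
  by (rule tensor_product.intro[OF sym_operatorsD(2)[OF XX_sym] sym_operatorsD(3)[OF X_sym]])

lemmas XX_ops = tensor_bi_operators[OF sym_operatorsD(1)[OF X_sym] sym_operatorsD(1)[OF X_sym]]

lemma mult_bilinear: "bilinear_op K X (mult A)"
  by (simp add: bilinear_op_def additive_left_mult additive_right_mult smult_mult)

lemmas mult2 = tensor_mult_bilinear[OF X_sym X_sym mult_bilinear mult_bilinear]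
lemmas mult3 = tensor_mult_bilinear[OF X_sym XX_sym mult_bilinear mult2(1)]

lemma K_balancedI:
  assumes "\<And>a. a \<in> carrier A \<Longrightarrow> additive A Z (f a)" "\<And>a. a \<in> carrier A \<Longrightarrow> additive A Z (\<lambda>b. f b a)"
    "\<And>c a b. c \<in> carrier K \<Longrightarrow> a \<in> carrier A \<Longrightarrow> b \<in> carrier A \<Longrightarrow> f (c \<odot>\<^bsub>A\<^esub> a) b = f a (c \<odot>\<^bsub>A\<^esub> b)"
  shows "balanced_map K X X Z f"
  by (rule balanced_mapI) (simp_all add: assms)

lemma sym_lact: "lact X = smult A" by (simp add: sym_bimod_def)

lemma comul_hom: "bimod_hom (carrier K) (carrier K) X XX \<Delta>"
  and counit_hom: "bimod_hom (carrier K) (carrier K) X (reg_bimod K) \<epsilon>"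
  and coassoc: "x \<in> carrier A \<Longrightarrow> tensor_assoc K X X X (tensor_map K XX X \<Delta> id (\<Delta> x)) = tensor_map K X XX id \<Delta> (\<Delta> x)"
  and counit_left: "x \<in> carrier A \<Longrightarrow> tensor_lift A (\<lambda>u v. \<epsilon> u \<odot>\<^bsub>A\<^esub> v) (\<Delta> x) = x"
  and counit_right: "x \<in> carrier A \<Longrightarrow> tensor_lift A (\<lambda>u v. \<epsilon> v \<odot>\<^bsub>A\<^esub> u) (\<Delta> x) = x"
  using wba by (simp_all add: weak_bialgebra_def comonoid_def Let_def sym_lact)

lemma comul_mult: "x \<in> carrier A \<Longrightarrow> y \<in> carrier A \<Longrightarrow> \<Delta> (x \<otimes>\<^bsub>A\<^esub> y) = mult2 (\<Delta> x) (\<Delta> y)"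
  and counit_mult: "x \<in> carrier A \<Longrightarrow> y \<in> carrier A \<Longrightarrow> z \<in> carrier A \<Longrightarrow>
    tensor_lift K (\<lambda>u v. \<epsilon> (x \<otimes>\<^bsub>A\<^esub> u) \<otimes>\<^bsub>K\<^esub> \<epsilon> (v \<otimes>\<^bsub>A\<^esub> z)) (\<Delta> y) = \<epsilon> (x \<otimes>\<^bsub>A\<^esub> y \<otimes>\<^bsub>A\<^esub> z)"
    "x \<in> carrier A \<Longrightarrow> y \<in> carrier A \<Longrightarrow> z \<in> carrier A \<Longrightarrow>
    tensor_lift K (\<lambda>u v. \<epsilon> (x \<otimes>\<^bsub>A\<^esub> v) \<otimes>\<^bsub>K\<^esub> \<epsilon> (u \<otimes>\<^bsub>A\<^esub> z)) (\<Delta> y) = \<epsilon> (x \<otimes>\<^bsub>A\<^esub> y \<otimes>\<^bsub>A\<^esub> z)"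
  and comul_one:
    "mult3 (tensor_assoc K X X X (tens K XX X (\<Delta> \<one>\<^bsub>A\<^esub>) \<one>\<^bsub>A\<^esub>)) (tens K X XX \<one>\<^bsub>A\<^esub> (\<Delta> \<one>\<^bsub>A\<^esub>)) =
     tensor_assoc K X X X (tensor_map K XX X \<Delta> id (\<Delta> \<one>\<^bsub>A\<^esub>))"
    "mult3 (tens K X XX \<one>\<^bsub>A\<^esub> (\<Delta> \<one>\<^bsub>A\<^esub>)) (tensor_assoc K X X X (tens K XX X (\<Delta> \<one>\<^bsub>A\<^esub>) \<one>\<^bsub>A\<^esub>)) =
     tensor_assoc K X X X (tensor_map K XX X \<Delta> id (\<Delta> \<one>\<^bsub>A\<^esub>))"
  using wba by (simp_all add: weak_bialgebra_def Let_def)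

lemma comul_closed: "x \<in> carrier A \<Longrightarrow> \<Delta> x \<in> carrier XX"
  using bimod_homD(1)[OF comul_hom] by simp

lemma comul_additive: "additive A XX \<Delta>"
  using bimod_hom_additive[OF comul_hom] A.abelian_group_axioms XX.tensor_abelian_group by simp

lemma counit_closed [simp]: "x \<in> carrier A \<Longrightarrow> \<epsilon> x \<in> carrier K"
  using bimod_homD(1)[OF counit_hom] by simp

lemma counit_additive: "additive A K \<epsilon>"
  using bimod_hom_additive[OF counit_hom] A.abelian_group_axioms V.R.abelian_group_axioms by simp

lemma counit_smult: "c \<in> carrier K \<Longrightarrow> x \<in> carrier A \<Longrightarrow> \<epsilon> (c \<odot>\<^bsub>A\<^esub> x) = c \<otimes>\<^bsub>K\<^esub> \<epsilon> x"
  using bimod_homD(3)[OF counit_hom] by simp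

lemma smult_scalar_additive: "a \<in> carrier A \<Longrightarrow> additive K A (\<lambda>c. c \<odot>\<^bsub>A\<^esub> a)"
  by (intro additiveI) (simp_all add: V.R.abelian_group_axioms A.abelian_group_axioms V.smult_l_distr)

lemma counit_mult_additive:
  "z \<in> carrier A \<Longrightarrow> additive A K (\<lambda>u. \<epsilon> (u \<otimes>\<^bsub>A\<^esub> z))" "z \<in> carrier A \<Longrightarrow> additive A K (\<lambda>u. \<epsilon> (z \<otimes>\<^bsub>A\<^esub> u))"
  by (rule additive_comp[OF additive_right_mult counit_additive] additive_comp[OF additive_left_mult counit_additive]; simp)+

text \<open>
  Identities in \<open>W \<otimes> W \<otimes> W\<close> are used in the form of equations between the values of an arbitrary
  trilinear map.
\<close>

definition trilinear :: "('z, 'p) ring_scheme \<Rightarrow> ('w \<Rightarrow> 'w \<Rightarrow> 'w \<Rightarrow> 'z) \<Rightarrow> bool" where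
  "trilinear Z T \<longleftrightarrow>
     (\<forall>a\<in>carrier A. \<forall>b\<in>carrier A. additive A Z (T a b) \<and> additive A Z (\<lambda>c. T a c b) \<and> additive A Z (\<lambda>c. T c a b)) \<and>
     (\<forall>k\<in>carrier K. \<forall>a\<in>carrier A. \<forall>b\<in>carrier A. \<forall>c\<in>carrier A.
        T (k \<odot>\<^bsub>A\<^esub> a) b c = T a (k \<odot>\<^bsub>A\<^esub> b) c \<and> T a (k \<odot>\<^bsub>A\<^esub> b) c = T a b (k \<odot>\<^bsub>A\<^esub> c))"

lemma trilinearD:
  assumes "trilinear Z T"
  shows "a \<in> carrier A \<Longrightarrow> b \<in> carrier A \<Longrightarrow> additive A Z (T a b)"
    "a \<in> carrier A \<Longrightarrow> b \<in> carrier A \<Longrightarrow> additive A Z (\<lambda>c. T a c b)"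
    "a \<in> carrier A \<Longrightarrow> b \<in> carrier A \<Longrightarrow> additive A Z (\<lambda>c. T c a b)"
    "k \<in> carrier K \<Longrightarrow> a \<in> carrier A \<Longrightarrow> b \<in> carrier A \<Longrightarrow> c \<in> carrier A \<Longrightarrow> T (k \<odot>\<^bsub>A\<^esub> a) b c = T a (k \<odot>\<^bsub>A\<^esub> b) c"
    "k \<in> carrier K \<Longrightarrow> a \<in> carrier A \<Longrightarrow> b \<in> carrier A \<Longrightarrow> c \<in> carrier A \<Longrightarrow> T a (k \<odot>\<^bsub>A\<^esub> b) c = T a b (k \<odot>\<^bsub>A\<^esub> c)"
  using assms by (simp_all add: trilinear_def)

definition tri_lift where "tri_lift Z T = tensor_lift Z (\<lambda>a z. tensor_lift Z (T a) z)"

lemma tri_inner: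
  assumes T: "trilinear Z T"
  shows "a \<in> carrier A \<Longrightarrow> balanced_map K X X Z (T a)" "v \<in> carrier A \<Longrightarrow> balanced_map K X X Z (\<lambda>a b. T a b v)"
  by (rule K_balancedI; simp add: trilinearD[OF T])+

lemma tri_balanced:
  assumes T: "trilinear Z T"
  shows "balanced_map K X XX Z (\<lambda>a z. tensor_lift Z (T a) z)"
proof (rule balanced_mapI)
  note b = tri_inner(1)[OF T]
  show "additive XX Z (tensor_lift Z (T a))" if "a \<in> carrier X" for a
    using that by (simp add: XX.lift_additive(1)[OF b])
  show "additive X Z (\<lambda>a. tensor_lift Z (T a) z)" if "z \<in> carrier XX" for z
    using XX.lift_param_additive[OF A.abelian_group_axioms b _ that] by (simp add: trilinearD[OF T])
  fix a k z assume a: "a \<in> carrier X" and k: "k \<in> carrier K" and z: "z \<in> carrier XX"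
  have a': "a \<in> carrier A" and ka: "k \<odot>\<^bsub>A\<^esub> a \<in> carrier A" using a k by simp_all
  have "tensor_lift Z (T a) (lact XX k z) = tensor_lift Z (T (k \<odot>\<^bsub>A\<^esub> a)) z"
    by (rule XX.lift_eqI[OF b[OF ka] additive_comp[OF bi_operators_lact[OF XX_ops(1) k] XX.lift_additive(1)[OF b[OF a']]] _ z])
      (use a' k in \<open>simp add: XX_ops(2) XX.lift_tens[OF b] trilinearD(4)[OF T]\<close>)
  then show "tensor_lift Z (T (ract X a k)) z = tensor_lift Z (T a) (lact XX k z)" by simp
qed

lemma tri_lift_additive: "trilinear Z T \<Longrightarrow> additive X3 Z (tri_lift Z T)"
  unfolding tri_lift_def by (rule X_XX.lift_additive(1)[OF tri_balanced])

lemma tri_lift_tens: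
  assumes "trilinear Z T" "a \<in> carrier A" "z \<in> carrier XX"
  shows "tri_lift Z T (tens K X XX a z) = tensor_lift Z (T a) z"
  unfolding tri_lift_def using X_XX.lift_tens[OF tri_balanced[OF assms(1)], of a z] assms by simp

lemmas assoc = tensor_assoc_additive[OF sym_operatorsD(2)[OF X_sym] sym_operatorsD(1)[OF X_sym] sym_operatorsD(3)[OF X_sym]]

lemma tri_lift_assoc:
  assumes T: "trilinear Z T" and c: "c \<in> carrier XX" and v: "v \<in> carrier A"
  shows "tri_lift Z T (tensor_assoc K X X X (tens K XX X c v)) = tensor_lift Z (\<lambda>a b. T a b v) c"
proof -
  have v': "v \<in> carrier X" using v by simp
  note t = tri_lift_additive[OF T]
  have "tri_lift Z T (tensor_assoc K X X X (tens K XX X c v)) =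
      tri_lift Z T (tensor_lift X3 (\<lambda>x y. tens K X XX x (tX y v)) c)"
    by (simp only: assoc(3)[OF c v'])
  also have "\<dots> = tensor_lift Z (\<lambda>x y. tri_lift Z T (tens K X XX x (tX y v))) c"
    by (rule XX.lift_comp[OF assoc(2)[OF v'] t c])
  also have "\<dots> = tensor_lift Z (\<lambda>a b. T a b v) c"
    by (rule XX.lift_cong[OF balanced_map_comp[OF assoc(2)[OF v'] t] _ c])
      (simp add: tri_lift_tens[OF T] XX.tens_closed v XX.lift_tens[OF tri_inner(1)[OF T]])
  finally show ?thesis .
qed

lemma tri_lift_coproducts:
  assumes T: "trilinear Z T" and z: "z \<in> carrier XX"
  shows "tri_lift Z T (tensor_assoc K X X X (tensor_map K XX X \<Delta> id z)) =
      tensor_lift Z (\<lambda>u v. tensor_lift Z (\<lambda>a b. T a b v) (\<Delta> u)) z"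
    and "tri_lift Z T (tensor_map K X XX id \<Delta> z) = tensor_lift Z (\<lambda>u v. tensor_lift Z (T u) (\<Delta> v)) z"
proof -
  note t = tri_lift_additive[OF T]
  note hom = bimod_homD[OF comul_hom, simplified]
  have f: "balanced_map K X X (tensor K XX X) (\<lambda>u v. tens K XX X (\<Delta> u) (id v))"
    by (rule XX_X.tensor_map_balanced) (simp_all add: comul_additive hom comul_closed
        sym_operatorsD(4)[OF XX_sym] id_def additive_ident A.abelian_group_axioms)
  have g: "balanced_map K X X X3 (\<lambda>u v. tens K X XX (id u) (\<Delta> v))"
    by (rule X_XX.tensor_map_balanced) (simp_all add: comul_additive hom id_def additive_ident A.abelian_group_axioms)
  have "tri_lift Z T (tensor_assoc K X X X (tensor_map K XX X \<Delta> id z)) =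
      tensor_lift Z (\<lambda>u v. tri_lift Z T (tensor_assoc K X X X (tens K XX X (\<Delta> u) (id v)))) z"
    unfolding tensor_map_def by (rule XX.lift_comp[OF f additive_comp[OF assoc(1) t] z])
  also have "\<dots> = tensor_lift Z (\<lambda>u v. tensor_lift Z (\<lambda>a b. T a b v) (\<Delta> u)) z"
    by (rule XX.lift_cong[OF balanced_map_comp[OF f additive_comp[OF assoc(1) t]] _ z])
      (simp add: tri_lift_assoc[OF T] comul_closed)
  finally show "tri_lift Z T (tensor_assoc K X X X (tensor_map K XX X \<Delta> id z)) =
      tensor_lift Z (\<lambda>u v. tensor_lift Z (\<lambda>a b. T a b v) (\<Delta> u)) z" .
  have "tri_lift Z T (tensor_map K X XX id \<Delta> z) = tensor_lift Z (\<lambda>u v. tri_lift Z T (tens K X XX (id u) (\<Delta> v))) z"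
    unfolding tensor_map_def by (rule XX.lift_comp[OF g t z])
  also have "\<dots> = tensor_lift Z (\<lambda>u v. tensor_lift Z (T u) (\<Delta> v)) z"
    by (rule XX.lift_cong[OF balanced_map_comp[OF g t] _ z]) (simp add: tri_lift_tens[OF T] comul_closed)
  finally show "tri_lift Z T (tensor_map K X XX id \<Delta> z) = tensor_lift Z (\<lambda>u v. tensor_lift Z (T u) (\<Delta> v)) z" .
qed

text \<open>
  This evaluates products in \<open>W \<otimes> W \<otimes> W\<close> that involve two copies of \<open>\<Delta>(1)\<close>.
\<close>

lemma double_lift:
  assumes h1: "\<And>D. D \<in> carrier XX \<Longrightarrow> additive XX Z (h D)"
    and h2: "\<And>E. E \<in> carrier XX \<Longrightarrow> additive XX Z (\<lambda>D. h D E)"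
    and pure: "\<And>u v u' v'. u \<in> carrier A \<Longrightarrow> v \<in> carrier A \<Longrightarrow> u' \<in> carrier A \<Longrightarrow> v' \<in> carrier A \<Longrightarrow>
      h (tX u v) (tX u' v') = g u v u' v'"
    and D: "D \<in> carrier XX" and E: "E \<in> carrier XX"
  shows "h D E = tensor_lift Z (\<lambda>u v. tensor_lift Z (g u v) E) D"
proof -
  have bal: "balanced_map K X X Z' (\<lambda>u v. k (tX u v))" if "additive XX Z' k" for Z' :: "('z, 'p) ring_scheme" and k
    by (rule balanced_map_comp[OF XX.tens_balanced_map that])
  have g: "h (tX u v) E = tensor_lift Z (g u v) E" if "u \<in> carrier A" "v \<in> carrier A" for u v
  proof -
    have uv: "tX u v \<in> carrier XX" using that by (simp add: XX.tens_closed)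
    have "h (tX u v) E = tensor_lift Z (\<lambda>u' v'. h (tX u v) (tX u' v')) E"
      by (rule XX.lift_eqI[OF bal[OF h1[OF uv]] h1[OF uv] refl E])
    also have "\<dots> = tensor_lift Z (g u v) E"
      by (rule XX.lift_cong[OF bal[OF h1[OF uv]] _ E]) (simp add: pure that)
    finally show ?thesis .
  qed
  have "h D E = tensor_lift Z (\<lambda>u v. h (tX u v) E) D"
    by (rule XX.lift_eqI[OF bal[OF h2[OF E]] h2[OF E] refl D])
  also have "\<dots> = tensor_lift Z (\<lambda>u v. tensor_lift Z (g u v) E) D"
    by (rule XX.lift_cong[OF bal[OF h2[OF E]] _ D]) (simp add: g)
  finally show ?thesis .
qed

text \<open>
  The values of \<open>T\<close> on \<open>(\<Delta>(1) \<otimes> 1)(1 \<otimes> \<Delta>(1)) = (\<Delta> \<otimes> id)\<Delta>(1)\<close> and on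
  \<open>(1 \<otimes> \<Delta>(1))(\<Delta>(1) \<otimes> 1) = (id \<otimes> \<Delta>)\<Delta>(1)\<close>; the form of the second right-hand side is due to
  coassociativity.
\<close>

lemma comul_one_trilinear:
  assumes T: "trilinear Z T"
  shows "tensor_lift Z (\<lambda>u v. tensor_lift Z (\<lambda>u' v'. T u (v \<otimes>\<^bsub>A\<^esub> u') v') (\<Delta> \<one>\<^bsub>A\<^esub>)) (\<Delta> \<one>\<^bsub>A\<^esub>) =
      tensor_lift Z (\<lambda>u v. tensor_lift Z (\<lambda>a b. T a b v) (\<Delta> u)) (\<Delta> \<one>\<^bsub>A\<^esub>)" (is ?thesis1)
    and "tensor_lift Z (\<lambda>u v. tensor_lift Z (\<lambda>u' v'. T u (u' \<otimes>\<^bsub>A\<^esub> v) v') (\<Delta> \<one>\<^bsub>A\<^esub>)) (\<Delta> \<one>\<^bsub>A\<^esub>) =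
      tensor_lift Z (\<lambda>u v. tensor_lift Z (T u) (\<Delta> v)) (\<Delta> \<one>\<^bsub>A\<^esub>)" (is ?thesis2)
proof -
  note t = tri_lift_additive[OF T]
  let ?l = "\<lambda>D. tensor_assoc K X X X (tens K XX X D \<one>\<^bsub>A\<^esub>)" and ?r = "\<lambda>E. tens K X XX \<one>\<^bsub>A\<^esub> E"
  have D1: "\<Delta> \<one>\<^bsub>A\<^esub> \<in> carrier XX" by (simp add: comul_closed)
  have l: "additive XX X3 ?l"
    using XX_X.tens_balanced_map additive_comp[OF _ assoc(1), of XX "\<lambda>D. tens K XX X D \<one>\<^bsub>A\<^esub>"]
    unfolding balanced_map_def by simp
  have r: "additive XX X3 ?r"
    using X_XX.tens_balanced_map unfolding balanced_map_def by simp
  have lp: "?l (tX u v) = tens K X XX u (tX v \<one>\<^bsub>A\<^esub>)" if "u \<in> carrier A" "v \<in> carrier A" for u v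
    using that assoc(3)[of "tX u v" "\<one>\<^bsub>A\<^esub>"] XX.lift_tens[OF assoc(2), of "\<one>\<^bsub>A\<^esub>" u v] by (simp add: XX.tens_closed)
  note lc = additive_closed[OF l] and rc = additive_closed[OF r]
  note m = bilinear_opD(1,2)[OF mult3(1)]
  have "tri_lift Z T (mult3 (?l (\<Delta> \<one>\<^bsub>A\<^esub>)) (?r (\<Delta> \<one>\<^bsub>A\<^esub>))) =
      tensor_lift Z (\<lambda>u v. tensor_lift Z (\<lambda>u' v'. T u (v \<otimes>\<^bsub>A\<^esub> u') v') (\<Delta> \<one>\<^bsub>A\<^esub>)) (\<Delta> \<one>\<^bsub>A\<^esub>)"
  proof (rule double_lift[where h = "\<lambda>D E. tri_lift Z T (mult3 (?l D) (?r E))", OF _ _ _ D1 D1])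
    show "additive XX Z (\<lambda>E. tri_lift Z T (mult3 (?l D) (?r E)))" if "D \<in> carrier XX" for D
      by (rule additive_comp[OF additive_comp[OF r m(1)[OF lc[OF that]]] t])
    show "additive XX Z (\<lambda>D. tri_lift Z T (mult3 (?l D) (?r E)))" if "E \<in> carrier XX" for E
      by (rule additive_comp[OF additive_comp[OF l m(2)[OF rc[OF that]]] t])
  qed (simp add: lp mult3(2) mult2(2) XX.tens_closed tri_lift_tens[OF T] XX.lift_tens[OF tri_inner(1)[OF T]])
  then show ?thesis1
    unfolding comul_one(1) tri_lift_coproducts(1)[OF T D1] by (rule sym)
  have "tri_lift Z T (mult3 (?r (\<Delta> \<one>\<^bsub>A\<^esub>)) (?l (\<Delta> \<one>\<^bsub>A\<^esub>))) =
      tensor_lift Z (\<lambda>u v. tensor_lift Z (\<lambda>u' v'. T u (u' \<otimes>\<^bsub>A\<^esub> v) v') (\<Delta> \<one>\<^bsub>A\<^esub>)) (\<Delta> \<one>\<^bsub>A\<^esub>)"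
  proof (rule double_lift[where h = "\<lambda>D E. tri_lift Z T (mult3 (?r E) (?l D))", OF _ _ _ D1 D1])
    show "additive XX Z (\<lambda>E. tri_lift Z T (mult3 (?r E) (?l D)))" if "D \<in> carrier XX" for D
      by (rule additive_comp[OF additive_comp[OF r m(2)[OF lc[OF that]]] t])
    show "additive XX Z (\<lambda>D. tri_lift Z T (mult3 (?r E) (?l D)))" if "E \<in> carrier XX" for E
      by (rule additive_comp[OF additive_comp[OF l m(1)[OF rc[OF that]]] t])
  qed (simp add: lp mult3(2) mult2(2) XX.tens_closed tri_lift_tens[OF T] XX.lift_tens[OF tri_inner(1)[OF T]])
  then show ?thesis2
    unfolding comul_one(2) coassoc[OF A.one_closed] tri_lift_coproducts(2)[OF T D1] by (rule sym)
qed

lemma pi_balanced: "w \<in> carrier A \<Longrightarrow> balanced_map K X X A (\<lambda>u v. \<epsilon> (u \<otimes>\<^bsub>A\<^esub> w) \<odot>\<^bsub>A\<^esub> v)"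
proof (rule K_balancedI)
  assume w: "w \<in> carrier A"
  show "additive A A (\<lambda>v. \<epsilon> (u \<otimes>\<^bsub>A\<^esub> w) \<odot>\<^bsub>A\<^esub> v)" if "u \<in> carrier A" for u
    by (rule additive_smult) (simp add: that w)
  show "additive A A (\<lambda>u. \<epsilon> (u \<otimes>\<^bsub>A\<^esub> w) \<odot>\<^bsub>A\<^esub> v)" if "v \<in> carrier A" for v
    by (rule additive_comp[OF counit_mult_additive(1)[OF w] smult_scalar_additive[OF that]])
qed (simp add: smult_mult counit_smult V.R.m_comm flip: V.smult_assoc1)

lemma tgt_balanced: "w \<in> carrier A \<Longrightarrow> balanced_map K X X A (\<lambda>u v. \<epsilon> (v \<otimes>\<^bsub>A\<^esub> w) \<odot>\<^bsub>A\<^esub> u)"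
proof (rule K_balancedI)
  assume w: "w \<in> carrier A"
  show "additive A A (\<lambda>u. \<epsilon> (v \<otimes>\<^bsub>A\<^esub> w) \<odot>\<^bsub>A\<^esub> u)" if "v \<in> carrier A" for v
    by (rule additive_smult) (simp add: that w)
  show "additive A A (\<lambda>v. \<epsilon> (v \<otimes>\<^bsub>A\<^esub> w) \<odot>\<^bsub>A\<^esub> u)" if "u \<in> carrier A" for u
    by (rule additive_comp[OF counit_mult_additive(1)[OF w] smult_scalar_additive[OF that]])
qed (simp add: smult_mult counit_smult V.R.m_comm flip: V.smult_assoc1)

lemma one_comul: "\<Delta> \<one>\<^bsub>A\<^esub> \<in> carrier XX" by (simp add: comul_closed)

lemma pi_closed [simp]: "w \<in> carrier A \<Longrightarrow> wpiL W w \<in> carrier A"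
  unfolding wpiL_def by (rule XX.lift_closed[OF pi_balanced one_comul])

lemma tgt_closed [simp]: "w \<in> carrier A \<Longrightarrow> wtgt W w \<in> carrier A"
  unfolding wtgt_def by (rule XX.lift_closed[OF tgt_balanced one_comul])

lemma pi_additive: "additive A A (wpiL W)"
  unfolding wpiL_def
  by (rule XX.lift_param_additive[OF A.abelian_group_axioms pi_balanced _ one_comul])
    (simp_all add: additive_comp[OF counit_mult_additive(2) smult_scalar_additive])

lemma tgt_additive: "additive A A (wtgt W)"
  unfolding wtgt_def
  by (rule XX.lift_param_additive[OF A.abelian_group_axioms tgt_balanced _ one_comul])
    (simp_all add: additive_comp[OF counit_mult_additive(2) smult_scalar_additive])

lemma pi_smult: "c \<in> carrier K \<Longrightarrow> w \<in> carrier A \<Longrightarrow> wpiL W (c \<odot>\<^bsub>A\<^esub> w) = c \<odot>\<^bsub>A\<^esub> wpiL W w"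
proof -
  assume c: "c \<in> carrier K" and w: "w \<in> carrier A"
  have "c \<odot>\<^bsub>A\<^esub> wpiL W w = tensor_lift A (\<lambda>u v. c \<odot>\<^bsub>A\<^esub> (\<epsilon> (u \<otimes>\<^bsub>A\<^esub> w) \<odot>\<^bsub>A\<^esub> v)) (\<Delta> \<one>\<^bsub>A\<^esub>)"
    unfolding wpiL_def by (rule XX.lift_comp[OF pi_balanced[OF w] additive_smult[OF c] one_comul])
  also have "\<dots> = wpiL W (c \<odot>\<^bsub>A\<^esub> w)"
    unfolding wpiL_def
    by (rule XX.lift_cong[OF balanced_map_comp[OF pi_balanced[OF w] additive_smult[OF c]] _ one_comul])
      (simp add: c w smult_mult counit_smult V.smult_assoc1)
  finally show ?thesis ..
qed

lemma tgt_smult: "c \<in> carrier K \<Longrightarrow> w \<in> carrier A \<Longrightarrow> wtgt W (c \<odot>\<^bsub>A\<^esub> w) = c \<odot>\<^bsub>A\<^esub> wtgt W w"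
proof -
  assume c: "c \<in> carrier K" and w: "w \<in> carrier A"
  have "c \<odot>\<^bsub>A\<^esub> wtgt W w = tensor_lift A (\<lambda>u v. c \<odot>\<^bsub>A\<^esub> (\<epsilon> (v \<otimes>\<^bsub>A\<^esub> w) \<odot>\<^bsub>A\<^esub> u)) (\<Delta> \<one>\<^bsub>A\<^esub>)"
    unfolding wtgt_def by (rule XX.lift_comp[OF tgt_balanced[OF w] additive_smult[OF c] one_comul])
  also have "\<dots> = wtgt W (c \<odot>\<^bsub>A\<^esub> w)"
    unfolding wtgt_def
    by (rule XX.lift_cong[OF balanced_map_comp[OF tgt_balanced[OF w] additive_smult[OF c]] _ one_comul])
      (simp add: c w smult_mult counit_smult V.smult_assoc1)
  finally show ?thesis ..
qed

lemma pi_one: "wpiL W \<one>\<^bsub>A\<^esub> = \<one>\<^bsub>A\<^esub>"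
proof -
  have "wpiL W \<one>\<^bsub>A\<^esub> = tensor_lift A (\<lambda>u v. \<epsilon> u \<odot>\<^bsub>A\<^esub> v) (\<Delta> \<one>\<^bsub>A\<^esub>)"
    unfolding wpiL_def by (rule XX.lift_cong[OF pi_balanced[OF A.one_closed] _ one_comul]) simp
  then show ?thesis by (simp add: counit_left)
qed

lemma tgt_one: "wtgt W \<one>\<^bsub>A\<^esub> = \<one>\<^bsub>A\<^esub>"
proof -
  have "wtgt W \<one>\<^bsub>A\<^esub> = tensor_lift A (\<lambda>u v. \<epsilon> v \<odot>\<^bsub>A\<^esub> u) (\<Delta> \<one>\<^bsub>A\<^esub>)"
    unfolding wtgt_def by (rule XX.lift_cong[OF tgt_balanced[OF A.one_closed] _ one_comul]) simp
  then show ?thesis by (simp add: counit_right)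
qed

text \<open>
  Weak multiplicativity of \<open>\<epsilon>\<close> in the case \<open>y = 1\<close>: \<open>\<epsilon>(x 1\<^sub>2) \<epsilon>(1\<^sub>1 w) = \<epsilon>(x w)\<close>, and below
  \<open>\<epsilon>(x 1\<^sub>1) \<epsilon>(1\<^sub>2 w) = \<epsilon>(x w)\<close>.
\<close>

lemma counit_pi:
  assumes x: "x \<in> carrier A" and w: "w \<in> carrier A"
  shows "\<epsilon> (x \<otimes>\<^bsub>A\<^esub> wpiL W w) = \<epsilon> (x \<otimes>\<^bsub>A\<^esub> w)"
proof -
  have "\<epsilon> (x \<otimes>\<^bsub>A\<^esub> wpiL W w) = tensor_lift K (\<lambda>u v. \<epsilon> (x \<otimes>\<^bsub>A\<^esub> (\<epsilon> (u \<otimes>\<^bsub>A\<^esub> w) \<odot>\<^bsub>A\<^esub> v))) (\<Delta> \<one>\<^bsub>A\<^esub>)"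
    unfolding wpiL_def by (rule XX.lift_comp[OF pi_balanced[OF w] counit_mult_additive(2)[OF x] one_comul])
  also have "\<dots> = tensor_lift K (\<lambda>u v. \<epsilon> (x \<otimes>\<^bsub>A\<^esub> v) \<otimes>\<^bsub>K\<^esub> \<epsilon> (u \<otimes>\<^bsub>A\<^esub> w)) (\<Delta> \<one>\<^bsub>A\<^esub>)"
    by (rule XX.lift_cong[OF balanced_map_comp[OF pi_balanced[OF w] counit_mult_additive(2)[OF x]] _ one_comul])
      (simp add: x w smult_mult counit_smult V.R.m_comm)
  finally show ?thesis using counit_mult(2)[OF x A.one_closed w] x w by simp
qed

lemma counit_tgt:
  assumes x: "x \<in> carrier A" and w: "w \<in> carrier A"
  shows "\<epsilon> (x \<otimes>\<^bsub>A\<^esub> wtgt W w) = \<epsilon> (x \<otimes>\<^bsub>A\<^esub> w)"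
proof -
  have "\<epsilon> (x \<otimes>\<^bsub>A\<^esub> wtgt W w) = tensor_lift K (\<lambda>u v. \<epsilon> (x \<otimes>\<^bsub>A\<^esub> (\<epsilon> (v \<otimes>\<^bsub>A\<^esub> w) \<odot>\<^bsub>A\<^esub> u))) (\<Delta> \<one>\<^bsub>A\<^esub>)"
    unfolding wtgt_def by (rule XX.lift_comp[OF tgt_balanced[OF w] counit_mult_additive(2)[OF x] one_comul])
  also have "\<dots> = tensor_lift K (\<lambda>u v. \<epsilon> (x \<otimes>\<^bsub>A\<^esub> u) \<otimes>\<^bsub>K\<^esub> \<epsilon> (v \<otimes>\<^bsub>A\<^esub> w)) (\<Delta> \<one>\<^bsub>A\<^esub>)"
    by (rule XX.lift_cong[OF balanced_map_comp[OF tgt_balanced[OF w] counit_mult_additive(2)[OF x]] _ one_comul])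
      (simp add: x w smult_mult counit_smult V.R.m_comm)
  finally show ?thesis using counit_mult(1)[OF x A.one_closed w] x w by simp
qed

lemma pi_tgt: "w \<in> carrier A \<Longrightarrow> wpiL W (wtgt W w) = wpiL W w"
  unfolding wpiL_def[of W "wtgt W w"] wpiL_def[of W w]
  by (rule XX.lift_cong[OF pi_balanced[OF tgt_closed] _ one_comul]) (simp_all add: counit_tgt)

lemma pi_pi: "w \<in> carrier A \<Longrightarrow> wpiL W (wpiL W w) = wpiL W w"
  unfolding wpiL_def[of W "wpiL W w"] 
  by (subst (2) wpiL_def, rule XX.lift_cong[OF pi_balanced[OF pi_closed] _ one_comul]) (simp_all add: counit_pi)

lemma tgt_pi: "w \<in> carrier A \<Longrightarrow> wtgt W (wpiL W w) = wtgt W w"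
  unfolding wtgt_def
  by (rule XX.lift_cong[OF tgt_balanced[OF pi_closed] _ one_comul]) (simp_all add: counit_pi)

text \<open>
  The counit laws of the underlying bialgebroid, \<open>\<pi>(w\<^sub>1) w\<^sub>2 = w\<close> and \<open>t(w\<^sub>2) w\<^sub>1 = w\<close>: apply
  \<open>\<epsilon> \<otimes> id\<close> and \<open>id \<otimes> \<epsilon>\<close> to \<open>\<Delta>(w) = \<Delta>(1)\<Delta>(w)\<close>.
\<close>

lemma pi_mult_balanced: "balanced_map K X X A (\<lambda>x y. wpiL W x \<otimes>\<^bsub>A\<^esub> y)"
  and tgt_mult_balanced: "balanced_map K X X A (\<lambda>x y. wtgt W y \<otimes>\<^bsub>A\<^esub> x)"
  by (rule K_balancedI; simp add: additive_left_mult additive_comp[OF pi_additive additive_right_mult]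
    additive_comp[OF tgt_additive additive_right_mult] smult_mult pi_smult tgt_smult)+

lemma pi_comul:
  assumes w: "w \<in> carrier A" shows "tensor_lift A (\<lambda>x y. wpiL W x \<otimes>\<^bsub>A\<^esub> y) (\<Delta> w) = w"
proof -
  have b: "balanced_map K X X A (\<lambda>u v. \<epsilon> u \<odot>\<^bsub>A\<^esub> v)"
    by (rule K_balancedI) (simp_all add: additive_smult additive_comp[OF counit_additive smult_scalar_additive]
        counit_smult V.R.m_comm flip: V.smult_assoc1)
  let ?L = "tensor_lift A (\<lambda>u v. \<epsilon> u \<odot>\<^bsub>A\<^esub> v)"
  note L = XX.lift_additive(1)[OF b] and m = bilinear_opD(1,2)[OF mult2(1)]
  have "?L (mult2 (\<Delta> \<one>\<^bsub>A\<^esub>) (\<Delta> w)) =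
      tensor_lift A (\<lambda>x y. tensor_lift A (\<lambda>u v. \<epsilon> (u \<otimes>\<^bsub>A\<^esub> x) \<odot>\<^bsub>A\<^esub> (v \<otimes>\<^bsub>A\<^esub> y)) (\<Delta> \<one>\<^bsub>A\<^esub>)) (\<Delta> w)"
    by (rule double_lift[where h = "\<lambda>E D. ?L (mult2 D E)", OF additive_comp[OF m(2) L] additive_comp[OF m(1) L] _
          comul_closed[OF w] one_comul])
      (simp_all add: mult2(2) XX.lift_tens[OF b])
  also have "\<dots> = tensor_lift A (\<lambda>x y. wpiL W x \<otimes>\<^bsub>A\<^esub> y) (\<Delta> w)"
  proof (rule XX.lift_cong[OF pi_mult_balanced _ comul_closed[OF w], symmetric])
    fix x y assume "x \<in> carrier X" "y \<in> carrier X"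
    then have xy: "x \<in> carrier A" "y \<in> carrier A" by simp_all
    have "wpiL W x \<otimes>\<^bsub>A\<^esub> y = tensor_lift A (\<lambda>u v. (\<epsilon> (u \<otimes>\<^bsub>A\<^esub> x) \<odot>\<^bsub>A\<^esub> v) \<otimes>\<^bsub>A\<^esub> y) (\<Delta> \<one>\<^bsub>A\<^esub>)"
      unfolding wpiL_def by (rule XX.lift_comp[OF pi_balanced[OF xy(1)] additive_right_mult[OF xy(2)] one_comul])
    also have "\<dots> = tensor_lift A (\<lambda>u v. \<epsilon> (u \<otimes>\<^bsub>A\<^esub> x) \<odot>\<^bsub>A\<^esub> (v \<otimes>\<^bsub>A\<^esub> y)) (\<Delta> \<one>\<^bsub>A\<^esub>)"
      by (rule XX.lift_cong[OF balanced_map_comp[OF pi_balanced[OF xy(1)] additive_right_mult[OF xy(2)]] _ one_comul])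
        (simp add: xy smult_mult)
    finally show "wpiL W x \<otimes>\<^bsub>A\<^esub> y = tensor_lift A (\<lambda>u v. \<epsilon> (u \<otimes>\<^bsub>A\<^esub> x) \<odot>\<^bsub>A\<^esub> (v \<otimes>\<^bsub>A\<^esub> y)) (\<Delta> \<one>\<^bsub>A\<^esub>)" .
  qed
  finally show ?thesis using comul_mult[OF A.one_closed w] counit_left[OF w] w by simp
qed

lemma tgt_comul:
  assumes w: "w \<in> carrier A" shows "tensor_lift A (\<lambda>x y. wtgt W y \<otimes>\<^bsub>A\<^esub> x) (\<Delta> w) = w"
proof -
  have b: "balanced_map K X X A (\<lambda>u v. \<epsilon> v \<odot>\<^bsub>A\<^esub> u)"
    by (rule K_balancedI) (simp_all add: additive_smult additive_comp[OF counit_additive smult_scalar_additive]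
        counit_smult V.R.m_comm flip: V.smult_assoc1)
  let ?L = "tensor_lift A (\<lambda>u v. \<epsilon> v \<odot>\<^bsub>A\<^esub> u)"
  note L = XX.lift_additive(1)[OF b] and m = bilinear_opD(1,2)[OF mult2(1)]
  have "?L (mult2 (\<Delta> \<one>\<^bsub>A\<^esub>) (\<Delta> w)) =
      tensor_lift A (\<lambda>x y. tensor_lift A (\<lambda>u v. \<epsilon> (v \<otimes>\<^bsub>A\<^esub> y) \<odot>\<^bsub>A\<^esub> (u \<otimes>\<^bsub>A\<^esub> x)) (\<Delta> \<one>\<^bsub>A\<^esub>)) (\<Delta> w)"
    by (rule double_lift[where h = "\<lambda>E D. ?L (mult2 D E)", OF additive_comp[OF m(2) L] additive_comp[OF m(1) L] _
          comul_closed[OF w] one_comul])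
      (simp_all add: mult2(2) XX.lift_tens[OF b])
  also have "\<dots> = tensor_lift A (\<lambda>x y. wtgt W y \<otimes>\<^bsub>A\<^esub> x) (\<Delta> w)"
  proof (rule XX.lift_cong[OF tgt_mult_balanced _ comul_closed[OF w], symmetric])
    fix x y assume "x \<in> carrier X" "y \<in> carrier X"
    then have xy: "x \<in> carrier A" "y \<in> carrier A" by simp_all
    have "wtgt W y \<otimes>\<^bsub>A\<^esub> x = tensor_lift A (\<lambda>u v. (\<epsilon> (v \<otimes>\<^bsub>A\<^esub> y) \<odot>\<^bsub>A\<^esub> u) \<otimes>\<^bsub>A\<^esub> x) (\<Delta> \<one>\<^bsub>A\<^esub>)"
      unfolding wtgt_def by (rule XX.lift_comp[OF tgt_balanced[OF xy(2)] additive_right_mult[OF xy(1)] one_comul])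
    also have "\<dots> = tensor_lift A (\<lambda>u v. \<epsilon> (v \<otimes>\<^bsub>A\<^esub> y) \<odot>\<^bsub>A\<^esub> (u \<otimes>\<^bsub>A\<^esub> x)) (\<Delta> \<one>\<^bsub>A\<^esub>)"
      by (rule XX.lift_cong[OF balanced_map_comp[OF tgt_balanced[OF xy(2)] additive_right_mult[OF xy(1)]] _ one_comul])
        (simp add: xy smult_mult)
    finally show "wtgt W y \<otimes>\<^bsub>A\<^esub> x = tensor_lift A (\<lambda>u v. \<epsilon> (v \<otimes>\<^bsub>A\<^esub> y) \<odot>\<^bsub>A\<^esub> (u \<otimes>\<^bsub>A\<^esub> x)) (\<Delta> \<one>\<^bsub>A\<^esub>)" .
  qed
  finally show ?thesis using comul_mult[OF A.one_closed w] counit_right[OF w] w by simp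
qed

end


section \<open>Actions of weak bialgebras\<close>

context depth_two_extension
begin

text \<open>
  The base \<open>R\<close> is identified with its image under the source map, and the identification of the
  tensor squares is determined by pure tensors; hence the comultiplications remain compatible.
\<close>

lemma bialgebroid_map_underlying:
  fixes B :: "('k, 's, 'b) left_bialgebroid" and V :: "('k, 'm \<Rightarrow> 'm) weak_bialgebra"
  assumes f: "bialgebroid_map K B \<AA> f" and V: "has_underlying_bialgebroid V \<AA>"
    and alg: "k_algebra K (talg B)"
    and st: "\<And>r. r \<in> carrier (balg B) \<Longrightarrow> src B r \<in> carrier (talg B)"
      "\<And>r. r \<in> carrier (balg B) \<Longrightarrow> tgt B r \<in> carrier (talg B)"
    and comul_closed: "\<And>b. b \<in> carrier (talg B) \<Longrightarrow> comul B b \<in> carrier (tensor (balg B) (bim B) (bim B))"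
  shows "bialgebroid_map K B (beta_l V) f"
proof -
  interpret B: assoc_algebra K "talg B" by (rule assoc_algebra.intro[OF alg])
  let ?S = "balg B" and ?P = "wleft V" and ?X = "bgd_bimod E id (wtgt V)"
  have E: "walg V = E"
    and bij: "bij_betw (End_src M) (carrier R) (carrier ?P)"
    and tgt: "\<And>r. r \<in> carrier R \<Longrightarrow> wtgt V (End_src M r) = End_tgt M r"
    and counit: "\<And>b. b \<in> carrier E \<Longrightarrow> wpiL V b = End_src M (b \<one>)"
    using V by (simp_all add: has_underlying_bialgebroid_def beta_l_def Let_def)
  have L: "talg (beta_l V) = E" "balg (beta_l V) = ?P" "src (beta_l V) = id" "tgt (beta_l V) = wtgt V"
    "counit (beta_l V) = wpiL V"
    by (simp_all add: beta_l_def Let_def E)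
  have comul: "\<And>b. b \<in> carrier E \<Longrightarrow> comul (beta_l V) b = tensor_lift (tensor ?P ?X ?X) (tens ?P ?X ?X) (\<gamma> b)"
    using V by (simp add: has_underlying_bialgebroid_def Let_def L)
  have P: "p \<in> carrier ?P \<Longrightarrow> \<exists>r\<in>carrier R. p = End_src M r" for p
    using bij by (auto simp: bij_betw_def)
  have Ps: "End_src M r \<in> carrier ?P" if "r \<in> carrier R" for r
    using bij that by (auto simp: bij_betw_def)
  have P_simps: "mult ?P = mult E" "add ?P = add E" "\<one>\<^bsub>?P\<^esub> = \<one>\<^bsub>E\<^esub>" "smult ?P = smult E"
    by (simp_all add: wleft_def E)
  interpret PP: tensor_product ?P ?X ?X
  proof (intro tensor_product.intro E.bgd_left_operators E.bgd_right_operators)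
    fix p assume "p \<in> carrier ?P"
    then obtain r where "r \<in> carrier R" "p = End_src M r" using P by blast
    then show "id p \<in> carrier E" "wtgt V p \<in> carrier E" by (simp_all add: tgt)
  qed
  obtain \<omega> where \<omega>: "alg_hom K ?S R \<omega>"
    and f_src: "\<And>r. r \<in> carrier ?S \<Longrightarrow> f (src B r) = End_src M (\<omega> r)"
    and f_tgt: "\<And>r. r \<in> carrier ?S \<Longrightarrow> f (tgt B r) = End_tgt M (\<omega> r)"
    and f_counit: "\<And>b. b \<in> carrier (talg B) \<Longrightarrow> f b \<one> = \<omega> (counit B b)"
    and f_comul: "\<And>b. b \<in> carrier (talg B) \<Longrightarrow> \<gamma> (f b) = tensor_lift X2 tensX
      (tensor_map ?S (bgd_bimod E (End_src M \<circ> \<omega>) (End_tgt M \<circ> \<omega>)) (bgd_bimod E (End_src M \<circ> \<omega>) (End_tgt M \<circ> \<omega>)) f f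
        (comul B b))"
    using f unfolding bialgebroid_map_def End_bialgebroid_simps Let_def by blast
  have f_ext: "f \<in> extensional (carrier (talg B))" and f_hom: "alg_hom K (talg B) E f"
    using f by (simp_all add: bialgebroid_map_def)
  have fE: "f b \<in> carrier E" if "b \<in> carrier (talg B)" for b
    using f_hom that by (auto simp: alg_hom_def ring_hom_def)
  have f_mult: "f (b \<otimes>\<^bsub>talg B\<^esub> b') = f b \<otimes>\<^bsub>E\<^esub> f b'" if "b \<in> carrier (talg B)" "b' \<in> carrier (talg B)" for b b'
    using f_hom that by (auto simp: alg_hom_def ring_hom_def)
  have f_add: "additive (talg B) E f"
    using f_hom B.A.abelian_group_axioms E.A.abelian_group_axioms
    by (auto simp: alg_hom_def ring_hom_def additive_def)
  have \<omega>R: "\<omega> r \<in> carrier R" if "r \<in> carrier ?S" for r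
    using \<omega> that by (auto simp: alg_hom_def ring_hom_def)
  let ?\<omega> = "End_src M \<circ> \<omega>"
  let ?Y = "bgd_bimod E (End_src M \<circ> \<omega>) (End_tgt M \<circ> \<omega>)" and ?Y' = "bgd_bimod E (id \<circ> ?\<omega>) (wtgt V \<circ> ?\<omega>)"
  have \<omega>': "alg_hom K ?S ?P ?\<omega>"
    using \<omega> src_alg_hom unfolding alg_hom_def by (auto simp: ring_hom_def Ps P_simps \<omega>R)
  interpret BB: tensor_product ?S "bim B" "bim B"
    by (intro tensor_product.intro B.bgd_left_operators B.bgd_right_operators st)
  interpret Y: tensor_product ?S ?Y ?Y
    by (intro tensor_product.intro E.bgd_left_operators E.bgd_right_operators) (simp_all add: \<omega>R)
  interpret Y': tensor_product ?S ?Y' ?Y'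
    by (intro tensor_product.intro E.bgd_left_operators E.bgd_right_operators) (simp_all add: \<omega>R tgt)
  have ff: "balanced_map ?S (bim B) (bim B) (tensor ?S ?Y ?Y) (\<lambda>u v. tens ?S ?Y ?Y (f u) (f v))"
    by (rule Y.tensor_map_balanced) (simp_all add: f_add f_mult f_src f_tgt st)
  have ff': "balanced_map ?S (bim B) (bim B) (tensor ?S ?Y' ?Y') (\<lambda>u v. tens ?S ?Y' ?Y' (f u) (f v))"
    by (rule Y'.tensor_map_balanced) (simp_all add: f_add f_mult f_src f_tgt st \<omega>R tgt)
  have tY: "additive E (tensor R X X) (tensX x)" "additive E (tensor R X X) (\<lambda>y. tensX y x)" 
    "additive E (tensor ?P ?X ?X) (tens ?P ?X ?X x)" "additive E (tensor ?P ?X ?X) (\<lambda>y. tens ?P ?X ?X y x)"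
    if "x \<in> carrier E" for x
    using XX.tens_balanced_map PP.tens_balanced_map that unfolding balanced_map_def by simp_all
  have P_bal: "tens ?P ?X ?X (End_tgt M r \<otimes>\<^bsub>E\<^esub> x) y = tens ?P ?X ?X x (End_src M r \<otimes>\<^bsub>E\<^esub> y)"
    if "r \<in> carrier R" "x \<in> carrier E" "y \<in> carrier E" for r x y
    using PP.tens_balanced[of x "End_src M r" y] that by (simp add: Ps tgt)
  have R_bal: "tensX (End_tgt M r \<otimes>\<^bsub>E\<^esub> x) y = tensX x (End_src M r \<otimes>\<^bsub>E\<^esub> y)"
    if "r \<in> carrier R" "x \<in> carrier E" "y \<in> carrier E" for r x y
    using XX.tens_balanced[of x r y] that by simp
  have R_P: "balanced_map R X X (tensor ?P ?X ?X) (tens ?P ?X ?X)"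
    by (rule R_balancedI) (simp_all add: tY P_bal)
  have Y_R: "balanced_map ?S ?Y ?Y X2 tensX"
    by (rule balanced_mapI) (simp_all add: tY R_bal \<omega>R)
  have Y'_P: "balanced_map ?S ?Y' ?Y' (tensor ?P ?X ?X) (tens ?P ?X ?X)"
    by (rule balanced_mapI) (simp_all add: tY P_bal \<omega>R tgt)
  have f_comul': "comul (beta_l V) (f b) =
      tensor_lift (tensor ?P ?X ?X) (tens ?P ?X ?X) (tensor_map ?S ?Y' ?Y' f f (comul B b))"
    if b: "b \<in> carrier (talg B)" for b
  proof -
    note c = comul_closed[OF b]
    have h: "additive (tensor ?S ?Y ?Y) (tensor ?P ?X ?X)
        (\<lambda>z. tensor_lift (tensor ?P ?X ?X) (tens ?P ?X ?X) (tensor_lift X2 tensX z))"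
      by (rule additive_comp[OF Y.lift_additive(1)[OF Y_R] XX.lift_additive(1)[OF R_P]])
    have h': "additive (tensor ?S ?Y' ?Y') (tensor ?P ?X ?X) (tensor_lift (tensor ?P ?X ?X) (tens ?P ?X ?X))"
      by (rule Y'.lift_additive(1)[OF Y'_P])
    have "comul (beta_l V) (f b) = tensor_lift (tensor ?P ?X ?X) (\<lambda>u v. tensor_lift (tensor ?P ?X ?X) (tens ?P ?X ?X)
        (tensor_lift X2 tensX (tens ?S ?Y ?Y (f u) (f v)))) (comul B b)"
      unfolding comul[OF fE[OF b]] f_comul[OF b] tensor_map_def by (rule BB.lift_comp[OF ff h c])
    also have "\<dots> = tensor_lift (tensor ?P ?X ?X) (\<lambda>u v. tensor_lift (tensor ?P ?X ?X) (tens ?P ?X ?X)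
        (tens ?S ?Y' ?Y' (f u) (f v))) (comul B b)"
      by (rule BB.lift_cong[OF balanced_map_comp[OF ff h] _ c])
        (simp add: fE Y.lift_tens[OF Y_R] XX.lift_tens[OF R_P] Y'.lift_tens[OF Y'_P, unfolded id_comp])
    also have "\<dots> = tensor_lift (tensor ?P ?X ?X) (tens ?P ?X ?X) (tensor_map ?S ?Y' ?Y' f f (comul B b))"
      unfolding tensor_map_def by (rule BB.lift_comp[OF ff' h' c, symmetric])
    finally show ?thesis .
  qed
  have "\<forall>r\<in>carrier ?S. f (src B r) = id (?\<omega> r) \<and> f (tgt B r) = wtgt V (?\<omega> r)"
    by (simp add: f_src f_tgt \<omega>R tgt)
  moreover have "\<forall>b\<in>carrier (talg B). wpiL V (f b) = ?\<omega> (counit B b)"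
    by (simp add: counit fE f_counit)
  ultimately show ?thesis
    unfolding bialgebroid_map_def L Let_def using f_ext f_hom \<omega>' f_comul' by blast
qed

text \<open>
  For \<open>l\<close> in the base \<open>W\<^sup>L\<close> put \<open>\<omega>(l) = l \<triangleright> 1\<close>.  The two expressions of \<open>(\<Delta> \<otimes> id)\<Delta>(1)\<close> by
  products of two copies of \<open>\<Delta>(1)\<close>, evaluated on \<open>M\<close>, show that \<open>l\<close> and \<open>t(l)\<close> act as the left and
  the right multiplication by \<open>\<omega>(l)\<close>.  For instance, with \<open>l = \<pi>(w)\<close>,
  \<open>\<omega>(l) m = 1 \<triangleright> (\<omega>(l) m) = \<epsilon>(1\<^sub>1 w) (1'\<^sub>1 1\<^sub>2 \<triangleright> 1)(1'\<^sub>2 \<triangleright> m) =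
  \<epsilon>(1\<^sub>1 w) (1\<^sub>2 \<triangleright> 1)(1\<^sub>3 \<triangleright> m) = l \<triangleright> m\<close>.
\<close>

lemma wba_action_base:
  fixes W :: "('k, 'w) weak_bialgebra"
  assumes W: "weak_bialgebra K W" and act: "wba_module_action K W M act"
    and w: "w \<in> carrier (walg W)" and m: "m \<in> carrier M"
  shows "act (wpiL W w) m = act (wpiL W w) \<one> \<otimes> m" (is ?thesis1)
    and "act (wtgt W (wpiL W w)) m = m \<otimes> act (wpiL W w) \<one>" (is ?thesis2)
proof -
  interpret W: weak_bialg K W by (rule weak_bialg.intro[OF W])
  have lm: "left_module_action K (walg W) M act"
    and prod: "\<And>b m m'. b \<in> carrier (walg W) \<Longrightarrow> m \<in> carrier M \<Longrightarrow> m' \<in> carrier M \<Longrightarrow>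
      act b (m \<otimes> m') = tensor_lift M (\<lambda>x y. act x m \<otimes> act y m') (wcomul W b)"
    and unit: "\<And>b. b \<in> carrier (walg W) \<Longrightarrow> act b \<one> = act (wpiL W b) \<one>"
    using act by (simp_all add: wba_module_action_def)
  note a = left_module_actionD[OF lm]
  note add = left_module_action_additive[OF lm W.A.abelian_group_axioms A.abelian_group_axioms]
  have smult_add: "additive K M (\<lambda>c. c \<odot> y)" if "y \<in> carrier M" for y
    by (intro additiveI) (simp_all add: that V.R.abelian_group_axioms A.abelian_group_axioms V.smult_l_distr)
  have pb: "balanced_map K W.X W.X M (\<lambda>x y. act x p \<otimes> act y q)" if "p \<in> carrier M" "q \<in> carrier M" for p q
    by (rule W.K_balancedI)
      (simp_all add: that a smult_mult additive_comp[OF add(1) additive_left_mult] additive_comp[OF add(1) additive_right_mult])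
  note D1 = W.one_comul
  let ?\<Delta> = "wcomul W" and ?\<epsilon> = "wcounit W" and ?A = "walg W"
  have scale: "c \<odot> act b (p \<otimes> q) = tensor_lift M (\<lambda>x y. c \<odot> (act x p \<otimes> act y q)) (?\<Delta> b)"
    if "c \<in> carrier K" "b \<in> carrier ?A" "p \<in> carrier M" "q \<in> carrier M" for c b p q
    unfolding prod[OF that(2-4)]
    by (rule W.XX.lift_comp[OF pb[OF that(3,4)] additive_smult[OF that(1)] W.comul_closed[OF that(2)]])
  have pbs: "balanced_map K W.X W.X M (\<lambda>x y. c \<odot> (act x p \<otimes> act y q))"
    if "c \<in> carrier K" "p \<in> carrier M" "q \<in> carrier M" for c p q
    by (rule balanced_map_comp[OF pb[OF that(2,3)] additive_smult[OF that(1)]])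
  have eps: "?\<epsilon> ((c \<odot>\<^bsub>?A\<^esub> x) \<otimes>\<^bsub>?A\<^esub> y) = c \<otimes>\<^bsub>K\<^esub> ?\<epsilon> (x \<otimes>\<^bsub>?A\<^esub> y)"
    if "c \<in> carrier K" "x \<in> carrier ?A" "y \<in> carrier ?A" for c x y
    by (simp add: that W.smult_mult W.counit_smult)
  show ?thesis1
  proof -
    let ?T = "\<lambda>a b c. ?\<epsilon> (a \<otimes>\<^bsub>?A\<^esub> w) \<odot> (act b \<one> \<otimes> act c m)"
    have T: "W.trilinear M ?T"
      unfolding W.trilinear_def
    proof (intro conjI ballI)
      fix x y assume x: "x \<in> carrier ?A" and y: "y \<in> carrier ?A"
      show "additive ?A M (\<lambda>c. ?T x y c)"
        by (rule additive_comp[OF additive_comp[OF add(1)[OF m] additive_left_mult] additive_smult]) (simp_all add: x y w a)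
      show "additive ?A M (\<lambda>c. ?T x c y)"
        by (rule additive_comp[OF additive_comp[OF add(1) additive_right_mult] additive_smult]) (simp_all add: x y w m a)
      show "additive ?A M (\<lambda>c. ?T c x y)"
        by (rule additive_comp[OF W.counit_mult_additive(1)[OF w] smult_add]) (simp add: x y m a)
    next
      fix k x y z assume k: "k \<in> carrier K" and x: "x \<in> carrier ?A" and y: "y \<in> carrier ?A" and z: "z \<in> carrier ?A"
      show "?T (k \<odot>\<^bsub>?A\<^esub> x) y z = ?T x (k \<odot>\<^bsub>?A\<^esub> y) z"
        using k x y z w m by (simp add: eps a smult_mult V.R.m_comm flip: V.smult_assoc1)
      show "?T x (k \<odot>\<^bsub>?A\<^esub> y) z = ?T x y (k \<odot>\<^bsub>?A\<^esub> z)"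
        using k x y z w m by (simp add: a smult_mult)
    qed
    have h: "additive ?A M (\<lambda>b. act b \<one> \<otimes> m)" by (rule additive_comp[OF add(1) additive_right_mult]) (simp_all add: m)
    have "act (wpiL W w) \<one> \<otimes> m =
        tensor_lift M (\<lambda>u v. act (?\<epsilon> (u \<otimes>\<^bsub>?A\<^esub> w) \<odot>\<^bsub>?A\<^esub> v) \<one> \<otimes> m) (?\<Delta> \<one>\<^bsub>?A\<^esub>)"
      unfolding wpiL_def by (rule W.XX.lift_comp[OF W.pi_balanced[OF w] h D1])
    also have "\<dots> = tensor_lift M (\<lambda>u v. tensor_lift M (\<lambda>u' v'. ?T u (u' \<otimes>\<^bsub>?A\<^esub> v) v') (?\<Delta> \<one>\<^bsub>?A\<^esub>)) (?\<Delta> \<one>\<^bsub>?A\<^esub>)"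
    proof (rule W.XX.lift_cong[OF balanced_map_comp[OF W.pi_balanced[OF w] h] _ D1])
      fix u v assume "u \<in> carrier W.X" "v \<in> carrier W.X"
      then have uv: "u \<in> carrier ?A" "v \<in> carrier ?A" by simp_all
      have av: "act v \<one> \<in> carrier M" using uv by (simp add: a)
      have e: "?\<epsilon> (u \<otimes>\<^bsub>?A\<^esub> w) \<in> carrier K" using uv w by simp
      have "act (?\<epsilon> (u \<otimes>\<^bsub>?A\<^esub> w) \<odot>\<^bsub>?A\<^esub> v) \<one> \<otimes> m = ?\<epsilon> (u \<otimes>\<^bsub>?A\<^esub> w) \<odot> act \<one>\<^bsub>?A\<^esub> (act v \<one> \<otimes> m)"
        using uv m e by (simp add: a smult_mult)
      also have "\<dots> = tensor_lift M (\<lambda>x y. ?\<epsilon> (u \<otimes>\<^bsub>?A\<^esub> w) \<odot> (act x (act v \<one>) \<otimes> act y m)) (?\<Delta> \<one>\<^bsub>?A\<^esub>)"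
        by (rule scale[OF e W.A.one_closed av m])
      also have "\<dots> = tensor_lift M (\<lambda>u' v'. ?T u (u' \<otimes>\<^bsub>?A\<^esub> v) v') (?\<Delta> \<one>\<^bsub>?A\<^esub>)"
        by (rule W.XX.lift_cong[OF pbs[OF e av m] _ D1]) (simp add: uv a)
      finally show "act (?\<epsilon> (u \<otimes>\<^bsub>?A\<^esub> w) \<odot>\<^bsub>?A\<^esub> v) \<one> \<otimes> m =
          tensor_lift M (\<lambda>u' v'. ?T u (u' \<otimes>\<^bsub>?A\<^esub> v) v') (?\<Delta> \<one>\<^bsub>?A\<^esub>)" .
    qed
    also have "\<dots> = tensor_lift M (\<lambda>u v. tensor_lift M (?T u) (?\<Delta> v)) (?\<Delta> \<one>\<^bsub>?A\<^esub>)"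
      by (rule W.comul_one_trilinear(2)[OF T])
    also have "\<dots> = tensor_lift M (\<lambda>u v. act (?\<epsilon> (u \<otimes>\<^bsub>?A\<^esub> w) \<odot>\<^bsub>?A\<^esub> v) m) (?\<Delta> \<one>\<^bsub>?A\<^esub>)"
    proof (rule W.XX.lift_cong[OF balanced_map_comp[OF W.pi_balanced[OF w] add(1)[OF m]] _ D1, symmetric])
      fix u v assume "u \<in> carrier W.X" "v \<in> carrier W.X"
      then have uv: "u \<in> carrier ?A" "v \<in> carrier ?A" by simp_all
      have e: "?\<epsilon> (u \<otimes>\<^bsub>?A\<^esub> w) \<in> carrier K" using uv w by simp
      show "act (?\<epsilon> (u \<otimes>\<^bsub>?A\<^esub> w) \<odot>\<^bsub>?A\<^esub> v) m = tensor_lift M (?T u) (?\<Delta> v)"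
        using scale[OF e uv(2) A.one_closed m] uv m e by (simp add: a)
    qed
    also have "\<dots> = act (wpiL W w) m"
      unfolding wpiL_def by (rule W.XX.lift_comp[OF W.pi_balanced[OF w] add(1)[OF m] D1, symmetric])
    finally show ?thesis ..
  qed
  show ?thesis2
  proof -
    define l where "l = wpiL W w"
    have l: "l \<in> carrier ?A" using w by (simp add: l_def)
    let ?t = "act (wtgt W l) \<one>"
    have t: "?t \<in> carrier M" by (simp add: a l)
    let ?T = "\<lambda>a b c. ?\<epsilon> (c \<otimes>\<^bsub>?A\<^esub> l) \<odot> (act a m \<otimes> act b \<one>)"
    have T: "W.trilinear M ?T"
      unfolding W.trilinear_def
    proof (intro conjI ballI)
      fix x y assume x: "x \<in> carrier ?A" and y: "y \<in> carrier ?A"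
      show "additive ?A M (\<lambda>c. ?T x y c)"
        by (rule additive_comp[OF W.counit_mult_additive(1)[OF l] smult_add]) (simp add: x y m a)
      show "additive ?A M (\<lambda>c. ?T x c y)"
        by (rule additive_comp[OF additive_comp[OF add(1)[OF A.one_closed] additive_left_mult] additive_smult]) (simp_all add: x y l m a)
      show "additive ?A M (\<lambda>c. ?T c x y)"
        by (rule additive_comp[OF additive_comp[OF add(1) additive_right_mult] additive_smult]) (simp_all add: x y l m a)
    next
      fix k x y z assume k: "k \<in> carrier K" and x: "x \<in> carrier ?A" and y: "y \<in> carrier ?A" and z: "z \<in> carrier ?A"
      show "?T (k \<odot>\<^bsub>?A\<^esub> x) y z = ?T x (k \<odot>\<^bsub>?A\<^esub> y) z"
        using k x y z l m by (simp add: a smult_mult)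
      show "?T x (k \<odot>\<^bsub>?A\<^esub> y) z = ?T x y (k \<odot>\<^bsub>?A\<^esub> z)"
        using k x y z l m by (simp add: eps a smult_mult V.R.m_comm flip: V.smult_assoc1)
    qed
    have "m \<otimes> ?t = act \<one>\<^bsub>?A\<^esub> (m \<otimes> ?t)" using m t by (simp add: a)
    also have "\<dots> = tensor_lift M (\<lambda>u v. act u m \<otimes> act v ?t) (?\<Delta> \<one>\<^bsub>?A\<^esub>)"
      by (rule prod[OF W.A.one_closed m t])
    also have "\<dots> = tensor_lift M (\<lambda>u v. tensor_lift M (\<lambda>u' v'. ?T u (v \<otimes>\<^bsub>?A\<^esub> u') v') (?\<Delta> \<one>\<^bsub>?A\<^esub>)) (?\<Delta> \<one>\<^bsub>?A\<^esub>)"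
    proof (rule W.XX.lift_cong[OF pb[OF m t] _ D1])
      fix u v assume "u \<in> carrier W.X" "v \<in> carrier W.X"
      then have uv: "u \<in> carrier ?A" "v \<in> carrier ?A" by simp_all
      have h: "additive ?A M (\<lambda>b. act u m \<otimes> act v (act b \<one>))"
        by (rule additive_comp[OF additive_comp[OF add(1)[OF A.one_closed] add(2)[OF uv(2)]] additive_left_mult])
          (simp add: a uv m)
      have "act u m \<otimes> act v ?t =
          tensor_lift M (\<lambda>u' v'. act u m \<otimes> act v (act (?\<epsilon> (v' \<otimes>\<^bsub>?A\<^esub> l) \<odot>\<^bsub>?A\<^esub> u') \<one>)) (?\<Delta> \<one>\<^bsub>?A\<^esub>)"
        unfolding wtgt_def by (rule W.XX.lift_comp[OF W.tgt_balanced[OF l] h D1])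
      also have "\<dots> = tensor_lift M (\<lambda>u' v'. ?T u (v \<otimes>\<^bsub>?A\<^esub> u') v') (?\<Delta> \<one>\<^bsub>?A\<^esub>)"
        by (rule W.XX.lift_cong[OF balanced_map_comp[OF W.tgt_balanced[OF l] h] _ D1])
          (simp add: a uv m l smult_mult)
      finally show "act u m \<otimes> act v ?t = tensor_lift M (\<lambda>u' v'. ?T u (v \<otimes>\<^bsub>?A\<^esub> u') v') (?\<Delta> \<one>\<^bsub>?A\<^esub>)" .
    qed
    also have "\<dots> = tensor_lift M (\<lambda>u v. tensor_lift M (\<lambda>a b. ?T a b v) (?\<Delta> u)) (?\<Delta> \<one>\<^bsub>?A\<^esub>)"
      by (rule W.comul_one_trilinear(1)[OF T])
    also have "\<dots> = tensor_lift M (\<lambda>u v. act (?\<epsilon> (v \<otimes>\<^bsub>?A\<^esub> l) \<odot>\<^bsub>?A\<^esub> u) m) (?\<Delta> \<one>\<^bsub>?A\<^esub>)"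
    proof (rule W.XX.lift_cong[OF balanced_map_comp[OF W.tgt_balanced[OF l] add(1)[OF m]] _ D1, symmetric])
      fix u v assume "u \<in> carrier W.X" "v \<in> carrier W.X"
      then have uv: "u \<in> carrier ?A" "v \<in> carrier ?A" by simp_all
      have e: "?\<epsilon> (v \<otimes>\<^bsub>?A\<^esub> l) \<in> carrier K" using uv l by simp
      show "act (?\<epsilon> (v \<otimes>\<^bsub>?A\<^esub> l) \<odot>\<^bsub>?A\<^esub> u) m = tensor_lift M (\<lambda>a b. ?T a b v) (?\<Delta> u)"
        using scale[OF e uv(1) m A.one_closed] uv m e by (simp add: a)
    qed
    also have "\<dots> = act (wtgt W l) m"
      unfolding wtgt_def by (rule W.XX.lift_comp[OF W.tgt_balanced[OF l] add(1)[OF m] D1, symmetric])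
    finally have "act (wtgt W l) m = m \<otimes> ?t" ..
    moreover have "?t = act l \<one>"
      using unit[OF W.tgt_closed[OF l]] w by (simp add: W.pi_tgt l) (simp add: l_def W.pi_pi)
    ultimately show ?thesis by (simp add: l_def)
  qed
qed

text \<open>
  On \<open>N\<close> the elements \<open>l\<close> and \<open>t(l)\<close> act alike because \<open>\<pi>(t(l)) = l\<close>, so \<open>\<omega>(l)\<close> lies in \<open>R\<close>; with
  the counit laws the \<open>N\<close>-linearity follows as for bialgebroids.
\<close>

lemma wba_action_arrow:
  fixes W :: "('k, 'w) weak_bialgebra" and V :: "('k, 'm \<Rightarrow> 'm) weak_bialgebra"
  assumes W: "weak_bialgebra K W" and act: "wba_module_action K W M act" and inv: "N \<subseteq> wba_invariants W M act"
    and V: "has_underlying_bialgebroid V \<AA>"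
  shows "weak_left_morphism K W V (action_map (walg W) M act)"
proof -
  interpret W: weak_bialg K W by (rule weak_bialg.intro[OF W])
  have lm: "left_module_action K (walg W) M act"
    and prod: "\<And>b m m'. b \<in> carrier (walg W) \<Longrightarrow> m \<in> carrier M \<Longrightarrow> m' \<in> carrier M \<Longrightarrow>
      act b (m \<otimes> m') = tensor_lift M (\<lambda>x y. act x m \<otimes> act y m') (wcomul W b)"
    and unit: "\<And>b. b \<in> carrier (walg W) \<Longrightarrow> act b \<one> = act (wpiL W b) \<one>"
    using act by (simp_all add: wba_module_action_def)
  note a = left_module_actionD[OF lm]
  note add = left_module_action_additive[OF lm W.A.abelian_group_axioms A.abelian_group_axioms]
  let ?A = "walg W" and ?L = "wleft W" and ?X = "bgd_bimod (walg W) id (wtgt W)" and ?\<Delta> = "wcomul W"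
  have inv: "act b n = act (wpiL W b) n" if "n \<in> N" "b \<in> carrier ?A" for n b
    using inv that by (auto simp: wba_invariants_def)
  have L_simps: "mult ?L = mult ?A" "add ?L = add ?A" "\<one>\<^bsub>?L\<^esub> = \<one>\<^bsub>?A\<^esub>" "smult ?L = smult ?A"
    "carrier ?L = wpiL W ` carrier ?A"
    by (simp_all add: wleft_def)
  have LA: "l \<in> carrier ?A" if "l \<in> carrier ?L" for l using that by (auto simp: L_simps)
  define \<omega> where "\<omega> l = act l \<one>" for l
  have src: "act l m = \<omega> l \<otimes> m" and tgt: "act (wtgt W l) m = m \<otimes> \<omega> l"
    if "l \<in> carrier ?L" "m \<in> carrier M" for l m
    using wba_action_base[OF W act _ that(2)] that(1) by (auto simp: L_simps \<omega>_def)
  have \<omega>R: "\<omega> l \<in> carrier R" if l: "l \<in> carrier ?L" for l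
    unfolding centralizer_iff
  proof (intro conjI ballI)
    show "\<omega> l \<in> carrier M" using LA[OF l] by (simp add: \<omega>_def a)
    fix n assume n: "n \<in> N"
    have "act (wtgt W l) n = act l n"
      using inv[OF n, of "wtgt W l"] l by (auto simp: L_simps W.pi_tgt W.pi_pi)
    then show "\<omega> l \<otimes> n = n \<otimes> \<omega> l" using n by (simp add: src tgt l)
  qed
  have \<omega>_hom: "alg_hom K ?L R \<omega>"
  proof -
    have "\<omega> (l \<otimes>\<^bsub>?A\<^esub> l') = \<omega> l \<otimes> \<omega> l'" if "l \<in> carrier ?L" "l' \<in> carrier ?L" for l l'
      using src[OF that(1), of "\<omega> l'"] that by (simp add: \<omega>_def a LA)
    then show ?thesis
      unfolding alg_hom_def
      by (intro conjI ballI ring_hom_memI) (simp_all add: \<omega>R L_simps(1-4), simp_all add: \<omega>_def a LA)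
  qed
  have pb: "balanced_map K W.X W.X M (\<lambda>x y. act x p \<otimes> act y q)" if "p \<in> carrier M" "q \<in> carrier M" for p q
    by (rule W.K_balancedI)
      (simp_all add: that a smult_mult additive_comp[OF add(1) additive_left_mult] additive_comp[OF add(1) additive_right_mult])
  have left_N: "act b (n \<otimes> m) = n \<otimes> act b m"
    if b: "b \<in> carrier ?A" and n: "n \<in> N" and m: "m \<in> carrier M" for b n m
  proof -
    have h: "additive ?A M (\<lambda>b. n \<otimes> act b m)"
      by (rule additive_comp[OF add(1)[OF m] additive_left_mult]) (simp add: n)
    have "n \<otimes> act b m = n \<otimes> act (tensor_lift ?A (\<lambda>x y. wpiL W x \<otimes>\<^bsub>?A\<^esub> y) (?\<Delta> b)) m"
      by (simp add: W.pi_comul b)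
    also have "\<dots> = tensor_lift M (\<lambda>u v. n \<otimes> act (wpiL W u \<otimes>\<^bsub>?A\<^esub> v) m) (?\<Delta> b)"
      by (rule W.XX.lift_comp[OF W.pi_mult_balanced h W.comul_closed[OF b]])
    also have "\<dots> = tensor_lift M (\<lambda>u v. act u n \<otimes> act v m) (?\<Delta> b)"
    proof (rule W.XX.lift_cong[OF balanced_map_comp[OF W.pi_mult_balanced h] _ W.comul_closed[OF b]])
      fix u v assume "u \<in> carrier W.X" "v \<in> carrier W.X"
      then have uv: "u \<in> carrier ?A" "v \<in> carrier ?A" and l: "wpiL W u \<in> carrier ?L" by (simp_all add: L_simps)
      have "act u n = n \<otimes> \<omega> (wpiL W u)"
        using inv[OF n uv(1)] n by (simp add: src l R_commute \<omega>R)
      then show "n \<otimes> act (wpiL W u \<otimes>\<^bsub>?A\<^esub> v) m = act u n \<otimes> act v m"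
        using uv n m by (simp add: a src l R_closed[OF \<omega>R] A.m_assoc)
    qed
    finally show ?thesis using prod[OF b _ m, of n] n by simp
  qed
  have right_N: "act b (m \<otimes> n) = act b m \<otimes> n"
    if b: "b \<in> carrier ?A" and n: "n \<in> N" and m: "m \<in> carrier M" for b n m
  proof -
    have h: "additive ?A M (\<lambda>b. act b m \<otimes> n)"
      by (rule additive_comp[OF add(1)[OF m] additive_right_mult]) (simp add: n)
    have "act b m \<otimes> n = act (tensor_lift ?A (\<lambda>x y. wtgt W y \<otimes>\<^bsub>?A\<^esub> x) (?\<Delta> b)) m \<otimes> n"
      by (simp add: W.tgt_comul b)
    also have "\<dots> = tensor_lift M (\<lambda>u v. act (wtgt W v \<otimes>\<^bsub>?A\<^esub> u) m \<otimes> n) (?\<Delta> b)"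
      by (rule W.XX.lift_comp[OF W.tgt_mult_balanced h W.comul_closed[OF b]])
    also have "\<dots> = tensor_lift M (\<lambda>u v. act u m \<otimes> act v n) (?\<Delta> b)"
    proof (rule W.XX.lift_cong[OF balanced_map_comp[OF W.tgt_mult_balanced h] _ W.comul_closed[OF b]])
      fix u v assume "u \<in> carrier W.X" "v \<in> carrier W.X"
      then have uv: "u \<in> carrier ?A" "v \<in> carrier ?A" and l: "wpiL W v \<in> carrier ?L" by (simp_all add: L_simps)
      have "act v n = \<omega> (wpiL W v) \<otimes> n"
        using inv[OF n uv(2)] n by (simp add: src l)
      moreover have "act (wtgt W v) (act u m) = act u m \<otimes> \<omega> (wpiL W v)"
        using tgt[OF l, of "act u m"] uv m by (simp add: a W.tgt_pi)
      ultimately show "act (wtgt W v \<otimes>\<^bsub>?A\<^esub> u) m \<otimes> n = act u m \<otimes> act v n"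
        using uv n m by (simp add: a R_closed[OF \<omega>R] l A.m_assoc)
    qed
    finally show ?thesis using prod[OF b m, of n] n by simp
  qed
  interpret LL: tensor_product ?L ?X ?X
    by (intro tensor_product.intro W.bgd_left_operators W.bgd_right_operators) (simp_all add: LA)
  have tL: "additive ?A (tensor ?L ?X ?X) (tens ?L ?X ?X x)" "additive ?A (tensor ?L ?X ?X) (\<lambda>y. tens ?L ?X ?X y x)"
    if "x \<in> carrier ?A" for x
    using LL.tens_balanced_map that unfolding balanced_map_def by simp_all
  \<comment> \<open>The multiples of \<open>1\<close> lie in the base, so the tensor product over the base is a quotient of
    the one over \<open>K\<close>.\<close>
  have KL: "balanced_map K W.X W.X (tensor ?L ?X ?X) (tens ?L ?X ?X)"
  proof (rule W.K_balancedI)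
    fix c x y assume c: "c \<in> carrier K" and x: "x \<in> carrier ?A" and y: "y \<in> carrier ?A"
    have "c \<odot>\<^bsub>?A\<^esub> \<one>\<^bsub>?A\<^esub> = wpiL W (c \<odot>\<^bsub>?A\<^esub> \<one>\<^bsub>?A\<^esub>)" using c by (simp add: W.pi_smult W.pi_one)
    then have l: "c \<odot>\<^bsub>?A\<^esub> \<one>\<^bsub>?A\<^esub> \<in> carrier ?L" unfolding L_simps(5) by (rule image_eqI) (simp add: c)
    show "tens ?L ?X ?X (c \<odot>\<^bsub>?A\<^esub> x) y = tens ?L ?X ?X x (c \<odot>\<^bsub>?A\<^esub> y)"
      using LL.tens_balanced[of x "c \<odot>\<^bsub>?A\<^esub> \<one>\<^bsub>?A\<^esub>" y] c x y l by (simp add: W.tgt_smult W.tgt_one W.smult_mult)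
  qed (simp_all add: tL)
  have beta: "talg (beta_l W) = ?A" "balg (beta_l W) = ?L" "src (beta_l W) = id" "tgt (beta_l W) = wtgt W"
    "counit (beta_l W) = wpiL W"
    "\<And>b. comul (beta_l W) b = tensor_lift (tensor ?L ?X ?X) (tens ?L ?X ?X) (?\<Delta> b)"
    by (simp_all add: beta_l_def Let_def)
  have comul_closed: "comul (beta_l W) b \<in> carrier (tensor (balg (beta_l W)) (bim (beta_l W)) (bim (beta_l W)))"
    if "b \<in> carrier (talg (beta_l W))" for b
    using W.XX.lift_closed[OF KL W.comul_closed] that by (simp add: beta)
  have comul: "act b (m \<otimes> m') = tensor_lift M (\<lambda>x y. act x m \<otimes> act y m') (comul (beta_l W) b)"
    if b: "b \<in> carrier (talg (beta_l W))" and m: "m \<in> carrier M" "m' \<in> carrier M" for b m m'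
  proof -
    have b': "b \<in> carrier ?A" using b by (simp add: beta)
    have F: "balanced_map ?L ?X ?X M (\<lambda>x y. act x m \<otimes> act y m')"
    proof (rule balanced_mapI)
      show "additive ?X M (\<lambda>y. act x m \<otimes> act y m')" if "x \<in> carrier ?X" for x
        using pb[OF m] that unfolding balanced_map_def by simp
      show "additive ?X M (\<lambda>x. act x m \<otimes> act y m')" if "y \<in> carrier ?X" for y
        using pb[OF m] that unfolding balanced_map_def by simp
    qed (use m in \<open>simp add: a LA src tgt R_closed[OF \<omega>R] A.m_assoc\<close>)
    have "tensor_lift M (\<lambda>x y. act x m \<otimes> act y m') (comul (beta_l W) b) =
        tensor_lift M (\<lambda>x y. tensor_lift M (\<lambda>x y. act x m \<otimes> act y m') (tens ?L ?X ?X x y)) (?\<Delta> b)"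
      unfolding beta by (rule W.XX.lift_comp[OF KL LL.lift_additive(1)[OF F] W.comul_closed[OF b']])
    also have "\<dots> = tensor_lift M (\<lambda>x y. act x m \<otimes> act y m') (?\<Delta> b)"
      by (rule W.XX.lift_cong[OF balanced_map_comp[OF KL LL.lift_additive(1)[OF F]] _ W.comul_closed[OF b']])
        (simp add: LL.lift_tens[OF F])
    finally show ?thesis using prod[OF b' m] by simp
  qed
  have "bialgebroid_map K (beta_l W) \<AA> (action_map (talg (beta_l W)) M act)"
    by (rule action_map_bialgebroid_map[where \<omega> = \<omega>, OF _ _ _ _ _ _ _ _ _ _ comul_closed comul])
      (use unit in \<open>simp_all add: beta W.k_algebra lm LA \<omega>_hom src tgt left_N right_N \<omega>_def[symmetric]\<close>)
  then have "bialgebroid_map K (beta_l W) (beta_l V) (action_map (talg (beta_l W)) M act)"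
    by (rule bialgebroid_map_underlying[OF _ V _ _ _ comul_closed]) (simp_all add: beta W.k_algebra LA)
  then show ?thesis by (simp add: weak_left_morphism_def beta)
qed

theorem End_wba_universal:
  fixes W :: "('k, 'w) weak_bialgebra" and V :: "('k, 'm \<Rightarrow> 'm) weak_bialgebra"
  assumes W: "weak_bialgebra K W" "wba_module_action K W M act" "N \<subseteq> wba_invariants W M act"
    and V: "has_underlying_bialgebroid V \<AA>"
  shows "\<exists>!f. weak_left_morphism K W V f \<and> (\<forall>w\<in>carrier (walg W). \<forall>m\<in>carrier M. f w m = act w m)"
proof (rule ex1I)
  show "weak_left_morphism K W V (action_map (walg W) M act) \<and>
      (\<forall>w\<in>carrier (walg W). \<forall>m\<in>carrier M. action_map (walg W) M act w m = act w m)"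
    using wba_action_arrow[OF W V] by (simp add: action_map_def)
  fix f assume f: "weak_left_morphism K W V f \<and> (\<forall>w\<in>carrier (walg W). \<forall>m\<in>carrier M. f w m = act w m)"
  have "talg (beta_l W) = walg W" "talg (beta_l V) = E"
    using V by (simp_all add: beta_l_def has_underlying_bialgebroid_def Let_def)
  then show "f = action_map (walg W) M act"
    using f by (intro action_map_unique) (auto simp: weak_left_morphism_def bialgebroid_map_def alg_hom_def ring_hom_def)
qed

end


section \<open>The endomorphism bialgebroid is the Galois bialgebroid\<close>

theorem theorem2p2:
  fixes K :: "'k ring" and M :: "('k, 'm) module" and N :: "'m set"
  assumes "field K"
    and "k_algebra K M"
    and "subalgebra_of K N M"
    and "depth_two M N"
    and "balanced_extension M N"
    and "separable_algebra K (cent_alg M N)"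
  shows "let A = End_bialgebroid M N; \<alpha> = (\<lambda>(a :: 'm \<Rightarrow> 'm) m. a m) in
    (Aut_object K M N A \<alpha> \<and>
     (\<forall>(B :: ('k, 's, 'b) left_bialgebroid) act.
        Aut_object K M N B act \<longrightarrow> (\<exists>!f. Aut_arrow K M B act A \<alpha> f))) \<and>
    (\<forall>\<Delta> \<epsilon>. let A\<^sub>W = \<lparr>walg = bimod_End M N, wcomul = \<Delta>, wcounit = \<epsilon>\<rparr> in
       weak_bialgebra K A\<^sub>W \<and> has_underlying_bialgebroid A\<^sub>W A \<longrightarrow>
       (\<forall>(W :: ('k, 'w) weak_bialgebra) act.
          weak_bialgebra K W \<and> wba_module_action K W M act \<and> N \<subseteq> wba_invariants W M act \<longrightarrow>
          (\<exists>!f. weak_left_morphism K W A\<^sub>W f \<and>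
                (\<forall>w\<in>carrier (walg W). \<forall>m\<in>carrier M. \<alpha> (f w) m = act w m))))"
proof -
  interpret depth_two_extension K M N
    by (intro depth_two_extension.intro algebra_extension.intro assoc_algebra.intro
        depth_two_extension_axioms.intro algebra_extension_axioms.intro assms)
  show ?thesis
    unfolding Let_def using End_Aut_object End_terminal End_wba_universal by blast
qed

end
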